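(* Let $(M_t,J_t)_{t\in\mathbb D_\varepsilon}$ be an analytic family of compact complex manifolds such that $(M_0,J_0)$ admits a locally conformally symplectic form taming $J_0$. Then, for $\varepsilon>0$ small enough (i.e. after possibly shrinking $\varepsilon$), every $(M_t,J_t)$ with $t\in\mathbb D_\varepsilon$ admits a locally conformally symplectic form taming $J_t$.
   Context: $\mathbb D_\varepsilon\subset\mathbb C$ is the open disc of radius $\varepsilon$ centered at $0$. An analytic family of compact complex manifolds over $\mathbb D_\varepsilon$ is given by the fibers of a proper holomorphic submersion onto $\mathbb D_\varepsilon$. A locally conformally symplectic (LCS) form taming a complex structure $J$ is a real $2$-form $\Omega$ such that there is a closed real one-form $\theta$ (the Lee form) with $d\Omega=\theta\wedge\Omega$, and such that the $(1,1)$-component $\Omega^{(1,1)}$ with respect to $J$ is positive, equivalently $\Omega(X,JX)>0$ for every non-zero real tangent vector $X$. *)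

theory Defs
  imports "HOL-Analysis.Analysis"
begin

section \<open>Smooth and holomorphic functions\<close>

text \<open>These notions are meant for open sets \<open>S\<close>.\<close>

primrec Ck_on ::
  "nat \<Rightarrow> ('a::real_normed_vector \<Rightarrow> 'b::real_normed_vector) \<Rightarrow> 'a set \<Rightarrow> bool" where
  "Ck_on 0 f S \<longleftrightarrow> continuous_on S f"
| "Ck_on (Suc k) f S \<longleftrightarrow>
     (\<forall>x\<in>S. f differentiable (at x)) \<and>
     (\<forall>v. Ck_on k (\<lambda>x. frechet_derivative f (at x) v) S)"

definition smooth_on ::
  "('a::real_normed_vector \<Rightarrow> 'b::real_normed_vector) \<Rightarrow> 'a set \<Rightarrow> bool" where
  "smooth_on f S \<longleftrightarrow> (\<forall>k. Ck_on k f S)"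

text \<open>A function of several complex variables is holomorphic if it is smooth and its real
  differential is complex linear (the Cauchy--Riemann equations).\<close>

definition holomorphic_fun :: "(complex^'m \<Rightarrow> complex) \<Rightarrow> (complex^'m) set \<Rightarrow> bool" where
  "holomorphic_fun f S \<longleftrightarrow> smooth_on f S \<and>
     (\<forall>z\<in>S. \<forall>v. frechet_derivative f (at z) (\<i> *s v) = \<i> * frechet_derivative f (at z) v)"

definition holomorphic_map :: "(complex^'m \<Rightarrow> complex^'k) \<Rightarrow> (complex^'m) set \<Rightarrow> bool" where
  "holomorphic_map f S \<longleftrightarrow> (\<forall>i. holomorphic_fun (\<lambda>z. f z $ i) S)"


section \<open>Complex manifolds\<close>

text \<open>A chart is a pair of a domain and a coordinate map; the values of the coordinate map
  outside the domain are irrelevant.\<close>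

type_synonym ('a, 'n) chart = "'a set \<times> ('a \<Rightarrow> complex^'n)"

abbreviation dom_chart :: "('a, 'n) chart \<Rightarrow> 'a set" where
  "dom_chart c \<equiv> fst c"

abbreviation coord :: "('a, 'n) chart \<Rightarrow> 'a \<Rightarrow> complex^'n" where
  "coord c \<equiv> snd c"

definition is_chart :: "'a topology \<Rightarrow> ('a, 'n::finite) chart \<Rightarrow> bool" where
  "is_chart X c \<longleftrightarrow> openin X (dom_chart c) \<and> open (coord c ` dom_chart c) \<and>
     homeomorphic_map (subtopology X (dom_chart c)) (top_of_set (coord c ` dom_chart c)) (coord c)"

abbreviation inv_chart :: "('a, 'n) chart \<Rightarrow> complex^'n \<Rightarrow> 'a" where
  "inv_chart c \<equiv> inv_into (dom_chart c) (coord c)"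

definition transition ::
  "('a, 'n) chart \<Rightarrow> ('a, 'k) chart \<Rightarrow> complex^'n \<Rightarrow> complex^'k" where
  "transition c d = coord d \<circ> inv_chart c"

abbreviation overlap :: "('a, 'n) chart \<Rightarrow> ('a, 'k) chart \<Rightarrow> (complex^'n) set" where
  "overlap c d \<equiv> coord c ` (dom_chart c \<inter> dom_chart d)"

definition complex_manifold :: "'a topology \<Rightarrow> ('a, 'n::finite) chart set \<Rightarrow> bool" where
  "complex_manifold X A \<longleftrightarrow> Hausdorff_space X \<and> second_countable X \<and>
     (\<forall>c\<in>A. is_chart X c) \<and> (\<Union>c\<in>A. dom_chart c) = topspace X \<and>
     (\<forall>c\<in>A. \<forall>d\<in>A. holomorphic_map (transition c d) (overlap c d))"

definition holomorphic_submersion ::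
  "('a, 'm::finite) chart set \<Rightarrow> ('a \<Rightarrow> complex) \<Rightarrow> bool" where
  "holomorphic_submersion A \<pi> \<longleftrightarrow> (\<forall>c\<in>A.
     holomorphic_fun (\<pi> \<circ> inv_chart c) (coord c ` dom_chart c) \<and>
     (\<forall>z\<in>coord c ` dom_chart c. surj (frechet_derivative (\<pi> \<circ> inv_chart c) (at z))))"

definition analytic_family ::
  "'a topology \<Rightarrow> ('a, 'm::finite) chart set \<Rightarrow> ('a \<Rightarrow> complex) \<Rightarrow> real \<Rightarrow> bool" where
  "analytic_family X A \<pi> \<epsilon> \<longleftrightarrow> complex_manifold X A \<and> holomorphic_submersion A \<pi> \<and>
     proper_map X (top_of_set (ball 0 \<epsilon>)) \<pi> \<and> \<pi> ` topspace X = ball 0 \<epsilon>"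

definition fibre_space :: "'a topology \<Rightarrow> ('a \<Rightarrow> complex) \<Rightarrow> complex \<Rightarrow> 'a topology" where
  "fibre_space X \<pi> t = subtopology X {x. \<pi> x = t}"

text \<open>The complex structure of a fibre is the one it has as a complex submanifold of the total
  space: its charts are all topological charts of the fibre whose inverse is a holomorphic
  immersion into the total space. This is a maximal atlas.\<close>

definition fibre_atlas ::
  "'a topology \<Rightarrow> ('a, 'm::finite) chart set \<Rightarrow> ('a \<Rightarrow> complex) \<Rightarrow> complex
     \<Rightarrow> ('a, 'n::finite) chart set" where
  "fibre_atlas X A \<pi> t = {c. is_chart (fibre_space X \<pi> t) c \<and>
     (\<forall>d\<in>A. holomorphic_map (transition c d) (overlap c d) \<and>
        (\<forall>z\<in>overlap c d. inj (frechet_derivative (transition c d) (at z))))}"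


section \<open>Real differential forms\<close>

text \<open>On an open subset of \<open>\<complex>\<^sup>n\<close>, every real tangent space is \<open>\<complex>\<^sup>n\<close> regarded as a real vector
  space, on which \<open>J\<close> is multiplication by \<open>\<i>\<close>. The exterior derivative of a form is computed on
  constant vector fields, and wedge products are taken without normalising factors.\<close>

type_synonym 'n form1 = "complex^'n \<Rightarrow> complex^'n \<Rightarrow> real"
type_synonym 'n form2 = "complex^'n \<Rightarrow> complex^'n \<Rightarrow> complex^'n \<Rightarrow> real"
type_synonym 'n form3 = "complex^'n \<Rightarrow> complex^'n \<Rightarrow> complex^'n \<Rightarrow> complex^'n \<Rightarrow> real"

definition local_form1 :: "(complex^'n) set \<Rightarrow> 'n form1 \<Rightarrow> bool" where
  "local_form1 S \<alpha> \<longleftrightarrow> (\<forall>z\<in>S. linear (\<alpha> z)) \<and> (\<forall>v. smooth_on (\<lambda>z. \<alpha> z v) S)"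

definition local_form2 :: "(complex^'n) set \<Rightarrow> 'n form2 \<Rightarrow> bool" where
  "local_form2 S \<omega> \<longleftrightarrow>
     (\<forall>z\<in>S. (\<forall>v. linear (\<omega> z v)) \<and> (\<forall>w. linear (\<lambda>v. \<omega> z v w)) \<and> (\<forall>v. \<omega> z v v = 0)) \<and>
     (\<forall>v w. smooth_on (\<lambda>z. \<omega> z v w) S)"

definition d_form1 :: "'n::finite form1 \<Rightarrow> 'n form2" where
  "d_form1 \<alpha> z u v =
     frechet_derivative (\<lambda>y. \<alpha> y v) (at z) u - frechet_derivative (\<lambda>y. \<alpha> y u) (at z) v"

definition d_form2 :: "'n::finite form2 \<Rightarrow> 'n form3" where
  "d_form2 \<omega> z u v w =
     frechet_derivative (\<lambda>y. \<omega> y v w) (at z) u - frechet_derivative (\<lambda>y. \<omega> y u w) (at z) v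
     + frechet_derivative (\<lambda>y. \<omega> y u v) (at z) w"

definition wedge12 :: "'n::finite form1 \<Rightarrow> 'n form2 \<Rightarrow> 'n form3" where
  "wedge12 \<alpha> \<omega> z u v w = \<alpha> z u * \<omega> z v w - \<alpha> z v * \<omega> z u w + \<alpha> z w * \<omega> z u v"

text \<open>The real \<open>2\<close>-forms of type \<open>(1,1)\<close> are the \<open>J\<close>-invariant ones, and those of type
  \<open>(2,0) + (0,2)\<close> are the \<open>J\<close>-anti-invariant ones.\<close>

definition part11 :: "'n::finite form2 \<Rightarrow> 'n form2" where
  "part11 \<omega> z v w = (\<omega> z v w + \<omega> z (\<i> *s v) (\<i> *s w)) / 2"

text \<open>A form on a manifold is the family of its coordinate expressions in the charts of the
  atlas; these are related by pullback along the transition maps.\<close>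

definition manifold_form1 ::
  "('a, 'n::finite) chart set \<Rightarrow> (('a, 'n) chart \<Rightarrow> 'n form1) \<Rightarrow> bool" where
  "manifold_form1 A \<theta> \<longleftrightarrow>
     (\<forall>c\<in>A. local_form1 (coord c ` dom_chart c) (\<theta> c)) \<and>
     (\<forall>c\<in>A. \<forall>d\<in>A. \<forall>z\<in>overlap c d. \<forall>v.
        \<theta> c z v = \<theta> d (transition c d z) (frechet_derivative (transition c d) (at z) v))"

definition manifold_form2 ::
  "('a, 'n::finite) chart set \<Rightarrow> (('a, 'n) chart \<Rightarrow> 'n form2) \<Rightarrow> bool" where
  "manifold_form2 A \<Omega> \<longleftrightarrow>
     (\<forall>c\<in>A. local_form2 (coord c ` dom_chart c) (\<Omega> c)) \<and>
     (\<forall>c\<in>A. \<forall>d\<in>A. \<forall>z\<in>overlap c d. \<forall>v w.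
        \<Omega> c z v w = \<Omega> d (transition c d z) (frechet_derivative (transition c d) (at z) v)
                      (frechet_derivative (transition c d) (at z) w))"

definition closed_form1 ::
  "('a, 'n::finite) chart set \<Rightarrow> (('a, 'n) chart \<Rightarrow> 'n form1) \<Rightarrow> bool" where
  "closed_form1 A \<theta> \<longleftrightarrow> (\<forall>c\<in>A. \<forall>z\<in>coord c ` dom_chart c. \<forall>u v. d_form1 (\<theta> c) z u v = 0)"


section \<open>Locally conformally symplectic forms taming the complex structure\<close>

definition lee_form ::
  "('a, 'n::finite) chart set \<Rightarrow> (('a, 'n) chart \<Rightarrow> 'n form2) \<Rightarrow> (('a, 'n) chart \<Rightarrow> 'n form1)
     \<Rightarrow> bool" where
  "lee_form A \<Omega> \<theta> \<longleftrightarrow> manifold_form1 A \<theta> \<and> closed_form1 A \<theta> \<and>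
     (\<forall>c\<in>A. \<forall>z\<in>coord c ` dom_chart c. \<forall>u v w.
        d_form2 (\<Omega> c) z u v w = wedge12 (\<theta> c) (\<Omega> c) z u v w)"

definition positive_part11 ::
  "('a, 'n::finite) chart set \<Rightarrow> (('a, 'n) chart \<Rightarrow> 'n form2) \<Rightarrow> bool" where
  "positive_part11 A \<Omega> \<longleftrightarrow>
     (\<forall>c\<in>A. \<forall>z\<in>coord c ` dom_chart c. \<forall>v. v \<noteq> 0 \<longrightarrow> part11 (\<Omega> c) z v (\<i> *s v) > 0)"

definition taming_LCS_form ::
  "('a, 'n::finite) chart set \<Rightarrow> (('a, 'n) chart \<Rightarrow> 'n form2) \<Rightarrow> bool" where
  "taming_LCS_form A \<Omega> \<longleftrightarrow>
     manifold_form2 A \<Omega> \<and> (\<exists>\<theta>. lee_form A \<Omega> \<theta>) \<and> positive_part11 A \<Omega>"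

lemma positive_part11_iff:
  assumes "manifold_form2 A \<Omega>"
  shows "positive_part11 A \<Omega> \<longleftrightarrow>
    (\<forall>c\<in>A. \<forall>z\<in>coord c ` dom_chart c. \<forall>v. v \<noteq> 0 \<longrightarrow> \<Omega> c z v (\<i> *s v) > 0)"
proof -
  have "part11 (\<Omega> c) z v (\<i> *s v) = \<Omega> c z v (\<i> *s v)"
    if c: "c \<in> A" and z: "z \<in> coord c ` dom_chart c" for c z v
  proof -
    let ?\<omega> = "\<Omega> c z"
    have lr: "linear (?\<omega> x)" for x
      using assms c z unfolding manifold_form2_def local_form2_def by blast
    have ll: "linear (\<lambda>x. ?\<omega> x y)" for y
      using assms c z unfolding manifold_form2_def local_form2_def by blast
    have alt: "?\<omega> x x = 0" for x
      using assms c z unfolding manifold_form2_def local_form2_def by blast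
    have anti: "?\<omega> y x = - ?\<omega> x y" for x y
    proof -
      have "?\<omega> (x + y) (x + y) = ?\<omega> x (x + y) + ?\<omega> y (x + y)"
        by (rule linear_add[OF ll])
      also have "\<dots> = ?\<omega> x x + ?\<omega> x y + (?\<omega> y x + ?\<omega> y y)"
        by (simp only: linear_add[OF lr])
      finally show ?thesis
        using alt[of "x + y"] alt[of x] alt[of y] by linarith
    qed
    have "\<i> *s (\<i> *s v) = - v"
      by (simp add: vec_eq_iff vector_scalar_mult_def)
    then have "?\<omega> (\<i> *s v) (\<i> *s (\<i> *s v)) = ?\<omega> v (\<i> *s v)"
      using anti[of "\<i> *s v" v] linear_neg[OF lr, of "\<i> *s v" v] by simp
    then show ?thesis
      by (simp add: part11_def)
  qed
  then show ?thesis
    unfolding positive_part11_def by auto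
qed

end

theory Submission
  imports Defs
begin

text \<open>Ehresmann's theorem is not needed: a smooth retraction \<open>r\<close> of a neighbourhood of the central fibre
  \<open>M\<^sub>0\<close> in the total space onto \<open>M\<^sub>0\<close> is enough. The pullbacks of \<open>\<Omega>\<close> and of its Lee form \<open>\<theta>\<close> by \<open>r\<close> restrict
  to every nearby fibre \<open>M\<^sub>t\<close>, still satisfy \<open>d\<Omega> = \<theta> \<and> \<Omega>\<close> and \<open>d\<theta> = 0\<close>, and on \<open>M\<^sub>0\<close> they are the given
  forms because \<open>r\<close> is the identity there. Positivity on complex lines is an open condition, so it holds
  on the tangent spaces of the fibres at all points of a neighbourhood of \<open>M\<^sub>0\<close>, and this neighbourhood
  contains all fibres over a small disc since \<open>\<pi>\<close> is proper. The retraction is built by compactness from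
  local ones, which exist because \<open>\<pi>\<close> is a coordinate function in suitable charts.\<close>


section \<open>Calculus of smooth functions\<close>

text \<open>Since \<open>r\<close> is only smooth, the pullback of a (1,1)-form need not be of type
  (1,1) on nearby fibres; what survives is taming, because it is an open condition. The equations
  for \<Omega> and \<theta> survive exactly, being natural under pullback. A fibre carries a maximal
  atlas, whose charts are only known to be holomorphic immersions into the total space. Two
  obstacles follow. A coordinate of the central fibre can be composed smoothly with \<open>r\<close>
  once it extends to an open set of the total space, so pullbacks are formed with charts cut out of
  slice coordinates. And two charts of one fibre must be compared through the total space, by
  lifting a differentiable map through an immersion. Averaging two retractions requires
  \<open>x\<close> and \<open>r x\<close> to lie in one coordinate ball, so an extension step may
  lose points off the central fibre, but none on it, where \<open>r x = x\<close>. Complex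
  structures of different fibres are compared without transport: in a chart of the total space each
  is multiplication by \<open>\<i>\<close> on the kernel of the differential of \<pi>, a linear
  condition depending continuously on the point.\<close>

lemma frechet_derivative_eqI:
  "(f has_derivative f') (at x) \<Longrightarrow> frechet_derivative f (at x) = f'"
  by (metis frechet_derivative_at)

lemma frechet_derivative_worksI:
  "f differentiable at x \<Longrightarrow> (f has_derivative frechet_derivative f (at x)) (at x)"
  by (simp add: frechet_derivative_works)

lemma Ck_on_cong:
  assumes "open S" "\<And>x. x \<in> S \<Longrightarrow> f x = g x" "Ck_on k f S"
  shows "Ck_on k g S"
  using assms(2,3)
proof (induction k arbitrary: f g)
  case 0
  then show ?case by (simp cong: continuous_on_cong)
next
  case (Suc k)
  have d: "(g has_derivative frechet_derivative f (at x)) (at x)" if "x \<in> S" for x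
    by (rule has_derivative_transform_within_open[where f = f, OF _ assms(1) that])
      (use Suc.prems(1) Suc.prems(2)[simplified] that frechet_derivative_worksI in auto)
  have "Ck_on k (\<lambda>x. frechet_derivative g (at x) v) S" for v
    by (rule Suc.IH[of "\<lambda>x. frechet_derivative f (at x) v"])
      (use Suc.prems frechet_derivative_eqI[OF d] in auto)
  then show ?case
    using d by (auto simp: differentiable_def)
qed

text \<open>\<open>Ck_on\<close> recurses on \<open>frechet_derivative\<close>, while
  differentiation rules produce an explicit differential; this lets the inductions on
  \<open>k\<close> below work with the explicit one.\<close>

lemma Ck_on_SucI:
  assumes "\<And>x. x \<in> S \<Longrightarrow> (f has_derivative f' x) (at x)" "open S"
    and "\<And>v. Ck_on k (\<lambda>x. f' x v) S"
  shows "Ck_on (Suc k) f S"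
proof -
  have "Ck_on k (\<lambda>x. frechet_derivative f (at x) v) S" for v
    by (rule Ck_on_cong[OF assms(2) _ assms(3)[of v]]) (use assms(1) frechet_derivative_eqI in metis)
  then show ?thesis
    using assms(1) by (auto simp: differentiable_def)
qed

lemma Ck_on_has_derivative:
  "Ck_on (Suc k) f S \<Longrightarrow> x \<in> S \<Longrightarrow> (f has_derivative frechet_derivative f (at x)) (at x)"
  using frechet_derivative_works by auto

lemma Ck_on_SucD: "Ck_on (Suc k) f S \<Longrightarrow> Ck_on k f S"
proof (induction k arbitrary: f)
  case 0
  then show ?case
    by (auto intro!: continuous_at_imp_continuous_on differentiable_imp_continuous_within)
next
  case (Suc k)
  then show ?case by (metis Ck_on.simps(2))
qed

lemma Ck_on_subset: "Ck_on k f S \<Longrightarrow> T \<subseteq> S \<Longrightarrow> Ck_on k f T"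
  by (induction k arbitrary: f) (auto intro: continuous_on_subset)

lemma Ck_on_local:
  assumes "\<And>x. x \<in> S \<Longrightarrow> \<exists>N. open N \<and> x \<in> N \<and> Ck_on k f N"
  shows "Ck_on k f S"
  using assms
proof (induction k arbitrary: f)
  case 0
  then show ?case
    by (metis Ck_on.simps(1) continuous_at_imp_continuous_on continuous_on_eq_continuous_at)
next
  case (Suc k)
  have "Ck_on k (\<lambda>x. frechet_derivative f (at x) v) S" for v
    by (rule Suc.IH) (use Suc.prems in \<open>fastforce\<close>)
  moreover have "\<forall>x\<in>S. f differentiable at x"
    using Suc.prems by fastforce
  ultimately show ?case by simp
qed

lemma Ck_on_const: "open S \<Longrightarrow> Ck_on k (\<lambda>x. c) S"
  by (induction k arbitrary: c) (auto intro!: Ck_on_SucI[where f' = "\<lambda>_ _. 0"] derivative_eq_intros simp del: Ck_on.simps(2))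

lemma Ck_on_linear:
  assumes "bounded_linear f" "open S"
  shows "Ck_on k f S"
proof (cases k)
  case 0
  then show ?thesis using assms by (simp add: linear_continuous_on)
next
  case (Suc k)
  then show ?thesis
    by (auto intro!: Ck_on_SucI[where f' = "\<lambda>_. f"] bounded_linear_imp_has_derivative Ck_on_const assms
        simp del: Ck_on.simps(2))
qed

lemma Ck_on_add:
  assumes "open S" "Ck_on k f S" "Ck_on k g S"
  shows "Ck_on k (\<lambda>x. f x + g x) S"
  using assms(2,3)
proof (induction k arbitrary: f g)
  case 0
  then show ?case by (auto intro: continuous_intros)
next
  case (Suc k)
  show ?case
    by (rule Ck_on_SucI[OF has_derivative_add[OF Ck_on_has_derivative[OF Suc.prems(1)]
            Ck_on_has_derivative[OF Suc.prems(2)]] assms(1)])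
      (use Suc in auto)
qed

lemma Ck_on_sum:
  assumes "open S" "\<And>i. i \<in> I \<Longrightarrow> Ck_on k (f i) S"
  shows "Ck_on k (\<lambda>x. \<Sum>i\<in>I. f i x) S"
  using assms(2) by (induction I rule: infinite_finite_induct) (auto intro: Ck_on_const Ck_on_add assms(1))

text \<open>By Leibniz' rule the differential is again a sum of values of \<open>h\<close> at
  functions of class \<open>k\<close>, so the induction closes with \<open>f\<close> and
  \<open>g\<close> generalised. Scalar multiples, products and inner products are all
  instances.\<close>

lemma Ck_on_bilinear:
  assumes "bounded_bilinear h" "open S" "Ck_on k f S" "Ck_on k g S"
  shows "Ck_on k (\<lambda>x. h (f x) (g x)) S"
  using assms(3,4)
proof (induction k arbitrary: f g)
  case 0
  then show ?case by (auto intro: bounded_bilinear.continuous_on[OF assms(1)])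
next
  case (Suc k)
  show ?case
    by (rule Ck_on_SucI[OF bounded_bilinear.FDERIV[OF assms(1) Ck_on_has_derivative[OF Suc.prems(1)]
            Ck_on_has_derivative[OF Suc.prems(2)]] assms(2)])
      (use Suc in \<open>auto intro!: Ck_on_add Suc.IH assms(2) intro: Ck_on_SucD simp del: Ck_on.simps(2), auto\<close>)
qed

text \<open>Expanding the inner differential in a basis turns the chain rule into real coefficients
  times derivatives of \<open>g\<close> in fixed directions. \<open>Ck_on\<close> differentiates in
  constant directions only, so this is the form on which the induction for compositions can
  act.\<close>

lemma has_derivative_euclidean_compose:
  fixes f :: "'a::real_normed_vector \<Rightarrow> 'b::euclidean_space"
  assumes "(f has_derivative f') (at x)" "(g has_derivative g') (at (f x))"
  shows "((\<lambda>x. g (f x)) has_derivative (\<lambda>v. \<Sum>b\<in>Basis. (f' v \<bullet> b) *\<^sub>R g' b)) (at x)"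
proof -
  have "linear g'" using assms(2) has_derivative_linear by blast
  have "g' (f' v) = (\<Sum>b\<in>Basis. (f' v \<bullet> b) *\<^sub>R g' b)" for v
    using linear_sum[OF \<open>linear g'\<close>, of "\<lambda>b. (f' v \<bullet> b) *\<^sub>R b" Basis]
    by (simp add: euclidean_representation linear_scale[OF \<open>linear g'\<close>])
  then show ?thesis
    using has_derivative_compose[OF assms] by (simp only:)
qed

lemma Ck_on_compose:
  fixes f :: "'a::real_normed_vector \<Rightarrow> 'b::euclidean_space"
  assumes "open S" "open T" "f ` S \<subseteq> T" "Ck_on k f S" "Ck_on k g T"
  shows "Ck_on k (\<lambda>x. g (f x)) S"
  using assms(4,5)
proof (induction k arbitrary: g)
  case 0
  then show ?case using assms(3) by (auto intro: continuous_on_compose2)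
next
  case (Suc k)
  have f: "(f has_derivative frechet_derivative f (at x)) (at x)" if "x \<in> S" for x
    using Ck_on_has_derivative[OF Suc.prems(1) that] .
  have g: "(g has_derivative frechet_derivative g (at (f x))) (at (f x))" if "x \<in> S" for x
    using Ck_on_has_derivative[OF Suc.prems(2)] that assms(3) by auto
  have 1: "Ck_on k (\<lambda>x. frechet_derivative f (at x) v \<bullet> b) S" for v b
    by (rule Ck_on_bilinear[OF bounded_bilinear_inner assms(1)])
      (use Suc.prems in \<open>auto intro: Ck_on_const assms\<close>)
  show ?case
    by (rule Ck_on_SucI[OF has_derivative_euclidean_compose[OF f g] assms(1)])
      (use Suc in \<open>auto intro!: Ck_on_sum Ck_on_bilinear[OF bounded_bilinear_scaleR] assms(1) 1 Suc.IH
         intro: Ck_on_SucD simp del: Ck_on.simps(2), auto\<close>)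
qed

text \<open>The differential of the inverse contains the inverse itself only undifferentiated, so
  its class \<open>k\<close>, known by induction, gives class \<open>k + 1\<close>.\<close>

lemma Ck_on_inverse:
  fixes f :: "'a::real_normed_vector \<Rightarrow> 'b::real_normed_field"
  assumes "open S" "\<And>x. x \<in> S \<Longrightarrow> f x \<noteq> 0" "Ck_on k f S"
  shows "Ck_on k (\<lambda>x. inverse (f x)) S"
  using assms(3)
proof (induction k)
  case 0
  then show ?case using assms by (auto intro: continuous_intros)
next
  case (Suc k)
  have f: "(f has_derivative frechet_derivative f (at x)) (at x)" if "x \<in> S" for x
    using Ck_on_has_derivative[OF Suc.prems(1) that] .
  have 0: "Ck_on k (\<lambda>x. inverse (f x)) S"
    using Suc Ck_on_SucD by blast
  have 1: "Ck_on k (\<lambda>x. - (inverse (f x) * frechet_derivative f (at x) v * inverse (f x))) S" for v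
    by (rule Ck_on_bilinear[where f = "\<lambda>_. -1" and h = "(*)" and g = "\<lambda>x. inverse (f x) * frechet_derivative f (at x) v * inverse (f x)", simplified])
      (use 0 Suc.prems in \<open>auto intro!: Ck_on_bilinear[OF bounded_bilinear_mult] Ck_on_const bounded_bilinear_mult assms(1)\<close>)
  show ?case
    by (rule Ck_on_SucI[OF Deriv.has_derivative_inverse[OF _ f] assms(1) 1])
      (use assms in auto)
qed

section \<open>Closure properties of smooth functions\<close>

lemma smooth_on_cong: "open S \<Longrightarrow> (\<And>x. x \<in> S \<Longrightarrow> f x = g x) \<Longrightarrow> smooth_on f S \<Longrightarrow> smooth_on g S"
  unfolding smooth_on_def using Ck_on_cong by blast

lemma smooth_on_subset: "smooth_on f S \<Longrightarrow> T \<subseteq> S \<Longrightarrow> smooth_on f T"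
  unfolding smooth_on_def using Ck_on_subset by blast

lemma smooth_on_local:
  "(\<And>x. x \<in> S \<Longrightarrow> \<exists>N. open N \<and> x \<in> N \<and> smooth_on f N) \<Longrightarrow> smooth_on f S"
  unfolding smooth_on_def by (meson Ck_on_local)

lemma smooth_on_has_derivative:
  "smooth_on f S \<Longrightarrow> x \<in> S \<Longrightarrow> (f has_derivative frechet_derivative f (at x)) (at x)"
  unfolding smooth_on_def using Ck_on_has_derivative by blast

lemma smooth_on_derivative: "smooth_on f S \<Longrightarrow> smooth_on (\<lambda>x. frechet_derivative f (at x) v) S"
  unfolding smooth_on_def using Ck_on.simps(2) by blast

lemma smooth_on_continuous: "smooth_on f S \<Longrightarrow> continuous_on S f"
  unfolding smooth_on_def using Ck_on.simps(1) by blast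

lemma smooth_on_const: "open S \<Longrightarrow> smooth_on (\<lambda>x. c) S"
  unfolding smooth_on_def using Ck_on_const by blast

lemma smooth_on_linear: "bounded_linear f \<Longrightarrow> open S \<Longrightarrow> smooth_on f S"
  unfolding smooth_on_def using Ck_on_linear by blast

lemma smooth_on_add:
  "open S \<Longrightarrow> smooth_on f S \<Longrightarrow> smooth_on g S \<Longrightarrow> smooth_on (\<lambda>x. f x + g x) S"
  unfolding smooth_on_def using Ck_on_add by blast

lemma smooth_on_sum:
  "open S \<Longrightarrow> (\<And>i. i \<in> I \<Longrightarrow> smooth_on (f i) S) \<Longrightarrow> smooth_on (\<lambda>x. \<Sum>i\<in>I. f i x) S"
  by (simp add: smooth_on_def Ck_on_sum)

lemma smooth_on_bilinear:
  "bounded_bilinear h \<Longrightarrow> open S \<Longrightarrow> smooth_on f S \<Longrightarrow> smooth_on g S \<Longrightarrow> smooth_on (\<lambda>x. h (f x) (g x)) S"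
  unfolding smooth_on_def using Ck_on_bilinear by blast

lemmas smooth_on_scaleR = smooth_on_bilinear[OF bounded_bilinear_scaleR]
lemmas smooth_on_mult = smooth_on_bilinear[OF bounded_bilinear_mult]
lemmas smooth_on_inner = smooth_on_bilinear[OF bounded_bilinear_inner]

lemma smooth_on_compose:
  fixes f :: "'a::real_normed_vector \<Rightarrow> 'b::euclidean_space"
  shows "open S \<Longrightarrow> open T \<Longrightarrow> f ` S \<subseteq> T \<Longrightarrow> smooth_on f S \<Longrightarrow> smooth_on g T
    \<Longrightarrow> smooth_on (\<lambda>x. g (f x)) S"
  unfolding smooth_on_def using Ck_on_compose by blast

text \<open>Kept apart from \<open>smooth_on_compose\<close> because the spaces here are arbitrary
  normed ones, whereas there the middle space is Euclidean.\<close>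

lemma smooth_on_compose_linear:
  assumes "bounded_linear g" "open S" "smooth_on f S"
  shows "smooth_on (\<lambda>x. g (f x)) S"
proof -
  have "Ck_on k f S \<Longrightarrow> Ck_on k (\<lambda>x. g (f x)) S" for k f
  proof (induction k arbitrary: f)
    case 0
    then show ?case using bounded_linear.continuous_on[OF assms(1), of S f] by simp
  next
    case (Suc k)
    show ?case
      by (rule Ck_on_SucI[OF bounded_linear.has_derivative[OF assms(1) Ck_on_has_derivative[OF Suc.prems]]
          assms(2)]) (use Suc in auto)
  qed
  then show ?thesis using assms(3) by (simp add: smooth_on_def)
qed

lemma smooth_on_diff:
  assumes "open S" "smooth_on f S" "smooth_on g S"
  shows "smooth_on (\<lambda>x. f x - g x) S"
proof -
  have "smooth_on (\<lambda>x. - g x) S"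
    by (rule smooth_on_compose_linear[OF _ assms(1,3)]) (simp add: bounded_linear_minus bounded_linear_ident)
  from smooth_on_add[OF assms(1,2) this] show ?thesis by simp
qed

lemma smooth_on_inverse:
  fixes f :: "'a::real_normed_vector \<Rightarrow> 'b::real_normed_field"
  shows "open S \<Longrightarrow> (\<And>x. x \<in> S \<Longrightarrow> f x \<noteq> 0) \<Longrightarrow> smooth_on f S \<Longrightarrow> smooth_on (\<lambda>x. inverse (f x)) S"
  unfolding smooth_on_def using Ck_on_inverse by blast

lemma smooth_on_vec:
  fixes f :: "'a::real_normed_vector \<Rightarrow> complex^'m::finite"
  assumes "open S" "\<And>i. smooth_on (\<lambda>x. f x $ i) S"
  shows "smooth_on f S"
proof -
  have "linear (\<lambda>c::complex. c *s (axis i 1 :: complex^'m))" for i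
    by (auto intro!: linearI simp: vec_eq_iff algebra_simps axis_def)
  then have bl: "bounded_linear (\<lambda>c::complex. c *s (axis i 1 :: complex^'m))" for i
    using linear_conv_bounded_linear by blast
  have "smooth_on (\<lambda>x. \<Sum>i\<in>UNIV. (f x $ i) *s (axis i 1 :: complex^'m)) S"
    by (intro smooth_on_sum assms(1) smooth_on_compose_linear[OF bl] assms(2))
  then show ?thesis by (simp add: basis_expansion)
qed


section \<open>A smooth step function\<close>

text \<open>The functions \<open>x^(-n) exp(-1/x)\<close>, extended by zero, are closed under
  differentiation: the derivative of the \<open>n\<close>-th combines those with indices
  \<open>n + 1\<close> and \<open>n + 2\<close>. Class \<open>k\<close> is therefore proved for all
  \<open>n\<close> at once.\<close>

lemma smooth_exp_inverse: "smooth_on (\<lambda>x::real. if x > 0 then exp (- 1 / x) else 0) UNIV"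
proof -
  define f where "f n x = (if x > 0 then (1/x)^n * exp (- 1 / x) else 0)" for n and x :: real
  \<comment> \<open>As \<open>f n 0 = 0\<close>, this is the difference quotient at the origin.
    Substituting \<open>inverse x\<close> reduces the limit from the right to the decay of a power
    divided by \<open>exp\<close>.\<close>
  have lim: "((\<lambda>x. f n x / x) \<longlongrightarrow> 0) (at 0)" for n
  proof -
    have "((\<lambda>x. inverse x ^ Suc n / exp (inverse x)) \<longlongrightarrow> 0) (at_right (0::real))"
      using filterlim_compose[OF tendsto_power_div_exp_0 filterlim_inverse_at_top_right] .
    then have "((\<lambda>x. f n x / x) \<longlongrightarrow> 0) (at_right 0)"
      by (rule Lim_transform_eventually)
        (auto simp: f_def eventually_at_filter exp_minus field_simps inverse_eq_divide)
    moreover have "((\<lambda>x. f n x / x) \<longlongrightarrow> 0) (at_left 0)"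
      by (rule Lim_transform_eventually[OF tendsto_const]) (auto simp: f_def eventually_at_filter)
    ultimately show ?thesis
      by (simp add: filterlim_split_at)
  qed
  have der: "(f n has_real_derivative f (n+2) x - real n * f (n+1) x) (at x)" for n x
  proof -
    consider "x > 0" | "x < 0" | "x = 0" by linarith
    then show ?thesis
    proof cases
      case 1
      have "((\<lambda>x. (1/x)^n) has_real_derivative - (real n * (1/x)^(n+1))) (at x)"
      proof -
        have "((\<lambda>x. 1 / x) has_real_derivative - ((1/x)^2)) (at x)"
          using 1 by (auto intro!: derivative_eq_intros simp: power2_eq_square)
        from DERIV_power[OF this, of n] show ?thesis
          by (rule DERIV_cong) (cases n; simp add: power2_eq_square del: power_one_over)
      qed
      moreover have "((\<lambda>x. exp (- 1 / x)) has_real_derivative (1/x)^2 * exp (- 1 / x)) (at x)"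
        using 1 by (auto intro!: derivative_eq_intros simp: field_simps power2_eq_square)
      ultimately have "((\<lambda>x. (1/x)^n * exp (- 1 / x)) has_real_derivative
          - (real n * (1/x)^(n+1)) * exp (- 1 / x) + (1/x)^2 * exp (- 1 / x) * (1/x)^n) (at x)"
        by (rule DERIV_mult)
      then have "((\<lambda>x. (1/x)^n * exp (- 1 / x)) has_real_derivative f (n+2) x - real n * f (n+1) x) (at x)"
        using 1 by (simp add: f_def power_add mult_ac power2_eq_square)
      then show ?thesis
        by (rule has_field_derivative_transform_within_open[of _ _ _ "{0<..}"]) (use 1 in \<open>auto simp: f_def\<close>)
    next
      case 2
      have "((\<lambda>x. 0) has_real_derivative f (n+2) x - real n * f (n+1) x) (at x)"
        using 2 by (auto simp: f_def)
      then show ?thesis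
        by (rule has_field_derivative_transform_within_open[of _ _ _ "{..<0}"]) (use 2 in \<open>auto simp: f_def\<close>)
    next
      case 3
      then show ?thesis
        using lim[of n] by (simp add: has_field_derivative_iff f_def)
    qed
  qed
  have "Ck_on k (f n) UNIV" for k n
  proof (induction k arbitrary: n)
    case 0
    then show ?case
      using DERIV_isCont[OF der] by (auto intro: continuous_at_imp_continuous_on)
  next
    case (Suc k)
    have *: "Ck_on k (\<lambda>x. (f (n+2) x + (- real n) * f (n+1) x) * v) UNIV" for v
      by (intro Ck_on_bilinear[OF bounded_bilinear_mult] Ck_on_add Suc.IH Ck_on_const open_UNIV)
    show ?case
      by (rule Ck_on_SucI[where f' = "\<lambda>x v. (f (n+2) x + (- real n) * f (n+1) x) * v"])
        (use der * in \<open>auto simp: has_field_derivative_def\<close>)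
  qed
  then have "smooth_on (f 0) UNIV" by (simp add: smooth_on_def)
  then show ?thesis by (simp add: f_def[abs_def] cong: if_cong)
qed

lemma smooth_bump:
  fixes a :: "'a::euclidean_space"
  assumes "0 < r" "r < s"
  obtains h :: "'a \<Rightarrow> real" where "smooth_on h UNIV" "\<And>x. 0 \<le> h x \<and> h x \<le> 1"
    "\<And>x. x \<in> ball a r \<Longrightarrow> h x = 1" "\<And>x. x \<notin> ball a s \<Longrightarrow> h x = 0"
proof -
  define E where "E = (\<lambda>x::real. if x > 0 then exp (- 1 / x) else 0)"
  define N where "N x = (x - a) \<bullet> (x - a)" for x
  \<comment> \<open>The squared distance keeps \<open>N\<close> smooth at the centre. Because
    \<open>r < s\<close>, the two arguments of \<open>E\<close> are never both nonpositive, so the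
    denominator is positive.\<close>
  define h where "h x = E (s\<^sup>2 - N x) * inverse (E (s\<^sup>2 - N x) + E (N x - r\<^sup>2))" for x
  have N: "N x = (dist a x)\<^sup>2" for x
    by (simp add: N_def dist_norm power2_norm_eq_inner algebra_simps inner_commute)
  have rs: "r\<^sup>2 < s\<^sup>2" using assms by (simp add: power_strict_mono)
  have E: "E x \<ge> 0" "x > 0 \<Longrightarrow> E x > 0" "x \<le> 0 \<Longrightarrow> E x = 0" for x
    by (auto simp: E_def)
  have pos: "E (s\<^sup>2 - N x) + E (N x - r\<^sup>2) > 0" for x
    using E[of "s\<^sup>2 - N x"] E[of "N x - r\<^sup>2"] rs by (cases "s\<^sup>2 - N x > 0") (smt (verit))+
  have smE: "smooth_on E UNIV" using smooth_exp_inverse by (simp add: E_def)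
  have smd: "smooth_on (\<lambda>x. x - a) UNIV"
    by (intro smooth_on_diff open_UNIV smooth_on_const smooth_on_linear bounded_linear_ident)
  have smN: "smooth_on N UNIV"
    unfolding N_def by (intro smooth_on_inner open_UNIV smd)
  have 1: "smooth_on (\<lambda>x. E (s\<^sup>2 - N x)) UNIV" "smooth_on (\<lambda>x. E (N x - r\<^sup>2)) UNIV"
    by (rule smooth_on_compose[OF _ _ _ _ smE]; use smN in \<open>auto intro!: smooth_on_diff smooth_on_const\<close>)+
  show ?thesis
  proof (rule that[of h])
    show "smooth_on h UNIV"
    unfolding h_def using 1 pos by (intro smooth_on_mult smooth_on_inverse smooth_on_add) (auto simp: less_le)
    show "0 \<le> h x \<and> h x \<le> 1" for x
    using pos[of x] E(1)[of "s\<^sup>2 - N x"] E(1)[of "N x - r\<^sup>2"] by (auto simp: h_def field_simps)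
    show "h x = 1" if "x \<in> ball a r" for x
  proof -
    have "N x \<le> r\<^sup>2" using that by (auto simp: N intro: power_mono)
    then show ?thesis using pos[of x] E(3)[of "N x - r\<^sup>2"] by (simp add: h_def)
  qed
    show "h x = 0" if "x \<notin> ball a s" for x
  proof -
    have "N x \<ge> s\<^sup>2" using that assms by (auto simp: N intro: power_mono)
    then show ?thesis using E(3)[of "s\<^sup>2 - N x"] by (simp add: h_def)
  qed
  qed
qed

section \<open>Symmetry of second derivatives\<close>

text \<open>Two applications of the mean value theorem: along \<open>u\<close> to the increment of
  \<open>f\<close> in direction \<open>h v\<close>, then along \<open>v\<close> to the derivative so
  obtained.\<close>

lemma second_difference:
  fixes f :: "'a::real_normed_vector \<Rightarrow> real"
  assumes "smooth_on f (ball z r)" "h > 0" "h * (norm u + norm v) < r"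
  obtains x where "dist z x \<le> h * (norm u + norm v)"
    "f (z + h *\<^sub>R u + h *\<^sub>R v) - f (z + h *\<^sub>R u) - f (z + h *\<^sub>R v) + f z
      = h * h * frechet_derivative (\<lambda>y. frechet_derivative f (at y) u) (at x) v"
proof -
  have in_ball: "z + s *\<^sub>R u + t *\<^sub>R v \<in> ball z r" if "0 \<le> s" "s \<le> h" "0 \<le> t" "t \<le> h" for s t
  proof -
    have "norm (s *\<^sub>R u + t *\<^sub>R v) \<le> h * norm u + h * norm v"
      using that by (intro norm_triangle_le add_mono) (auto intro: mult_right_mono)
    then show ?thesis using assms(3) by (simp add: dist_norm algebra_simps norm_minus_commute add.assoc)
  qed
  define g where "g s = f (z + s *\<^sub>R u + h *\<^sub>R v) - f (z + s *\<^sub>R u)" for s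
  define D where "D y = frechet_derivative f (at y)" for y
  have Df: "(f has_derivative D y) (at y)" if "y \<in> ball z r" for y
    using smooth_on_has_derivative[OF assms(1) that] by (simp add: D_def)
  have aff: "((\<lambda>s. f (w + s *\<^sub>R u)) has_real_derivative D (w + s *\<^sub>R u) u) (at s)"
    if "w + s *\<^sub>R u \<in> ball z r" for w s
  proof -
    have "((\<lambda>s. w + s *\<^sub>R u) has_derivative (\<lambda>t. t *\<^sub>R u)) (at s)"
      by (auto intro!: derivative_eq_intros)
    from has_derivative_compose[OF this Df[OF that]]
    show ?thesis
      using linear_scale[OF has_derivative_linear[OF Df[OF that]]]
      by (simp add: has_field_derivative_def mult_commute_abs)
  qed
  have g': "(g has_real_derivative D (z + s *\<^sub>R u + h *\<^sub>R v) u - D (z + s *\<^sub>R u) u) (at s)"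
    if "0 \<le> s" "s \<le> h" for s
    unfolding g_def
    using aff[of "z + h *\<^sub>R v" s] aff[of z s] in_ball[of s h] in_ball[of s 0] that assms(2)
    by (auto intro!: derivative_intros simp: add_ac)
  obtain s where s: "0 < s" "s < h"
    and gs: "g h - g 0 = (h - 0) * (D (z + s *\<^sub>R u + h *\<^sub>R v) u - D (z + s *\<^sub>R u) u)"
    using MVT2[OF assms(2), of g "\<lambda>s. D (z + s *\<^sub>R u + h *\<^sub>R v) u - D (z + s *\<^sub>R u) u"] g' by auto
  define E where "E y = frechet_derivative (\<lambda>y. D y u) (at y)" for y
  have DE: "((\<lambda>y. D y u) has_derivative E y) (at y)" if "y \<in> ball z r" for y
    using smooth_on_has_derivative[OF smooth_on_derivative[OF assms(1)] that] by (simp add: D_def E_def)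
  have k': "((\<lambda>t. D (z + s *\<^sub>R u + t *\<^sub>R v) u) has_real_derivative E (z + s *\<^sub>R u + t *\<^sub>R v) v) (at t)"
    if "0 \<le> t" "t \<le> h" for t
  proof -
    have b: "z + s *\<^sub>R u + t *\<^sub>R v \<in> ball z r" using in_ball that s by simp
    have "((\<lambda>t. z + s *\<^sub>R u + t *\<^sub>R v) has_derivative (\<lambda>t. t *\<^sub>R v)) (at t)"
      by (auto intro!: derivative_eq_intros)
    from has_derivative_compose[OF this DE[OF b]]
    show ?thesis
      using linear_scale[OF has_derivative_linear[OF DE[OF b]]]
      by (simp add: has_field_derivative_def mult_commute_abs)
  qed
  obtain t where t: "0 < t" "t < h"
    and kt: "D (z + s *\<^sub>R u + h *\<^sub>R v) u - D (z + s *\<^sub>R u + 0 *\<^sub>R v) u = (h - 0) * E (z + s *\<^sub>R u + t *\<^sub>R v) v"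
    using MVT2[OF assms(2), of "\<lambda>t. D (z + s *\<^sub>R u + t *\<^sub>R v) u"
      "\<lambda>t. E (z + s *\<^sub>R u + t *\<^sub>R v) v"] k' by auto
  have "norm (s *\<^sub>R u + t *\<^sub>R v) \<le> h * norm u + h * norm v"
    using s t by (intro norm_triangle_le add_mono) (auto intro: mult_right_mono)
  then have "dist z (z + s *\<^sub>R u + t *\<^sub>R v) \<le> h * (norm u + norm v)"
    by (metis add.assoc add_diff_cancel_left' dist_commute dist_norm distrib_left)
  moreover have "f (z + h *\<^sub>R u + h *\<^sub>R v) - f (z + h *\<^sub>R u) - f (z + h *\<^sub>R v) + f z = g h - g 0"
    by (simp add: g_def)
  ultimately show ?thesis
    using that gs kt by (auto simp: E_def D_def)
qed

text \<open>The second difference is unchanged when \<open>u\<close> and \<open>v\<close> are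
  exchanged. Divided by the squared step it converges to either mixed derivative, since second
  derivatives are continuous at \<open>z\<close>.\<close>

lemma second_derivative_symmetric_real:
  fixes f :: "'a::real_normed_vector \<Rightarrow> real"
  assumes "smooth_on f S" "open S" "z \<in> S"
  shows "frechet_derivative (\<lambda>y. frechet_derivative f (at y) u) (at z) v
       = frechet_derivative (\<lambda>y. frechet_derivative f (at y) v) (at z) u"
proof -
  obtain r where r: "r > 0" "ball z r \<subseteq> S"
    using assms by (meson open_contains_ball)
  have sm: "smooth_on f (ball z r)"
    using assms(1) r(2) by (rule smooth_on_subset)
  define D where "D u v y = frechet_derivative (\<lambda>y. frechet_derivative f (at y) u) (at y) v" for u v y
  have cont: "isCont (D u v) z" for u v
    using smooth_on_continuous[OF smooth_on_derivative[OF smooth_on_derivative[OF sm]]] r(1)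
    unfolding D_def[abs_def] by (auto simp: continuous_on_eq_continuous_at)
  \<comment> \<open>The summand 1 keeps the quotient meaningful for \<open>u = v = 0\<close>, and
    \<open>2 + real n\<close> gives \<open>r / (2 + real n) < r\<close> already for
    \<open>n = 0\<close>.\<close>
  define h where "h n = r / (1 + norm u + norm v) / (2 + real n)" for n
  have np: "1 + norm u + norm v > 0" using norm_ge_zero[of u] norm_ge_zero[of v] by linarith
  have h0: "h n > 0" for n using r(1) np by (auto simp: h_def)
  have hlim: "h \<longlonglongrightarrow> 0"
  proof -
    have "(\<lambda>n. r / (1 + norm u + norm v) * inverse (real (n + 2))) \<longlonglongrightarrow> r / (1 + norm u + norm v) * 0"
      using LIMSEQ_inverse_real_of_nat LIMSEQ_ignore_initial_segment[OF lim_inverse_n[where 'a=real], of 2]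
      by (intro tendsto_intros) simp
    then show ?thesis by (simp add: h_def[abs_def] divide_inverse algebra_simps)
  qed
  have hr: "h n * (norm u + norm v) < r" for n
  proof -
    have "h n * (norm u + norm v) \<le> h n * (1 + norm u + norm v)"
      using h0[of n] by (intro mult_left_mono) auto
    also have "\<dots> = r / (2 + real n)" using np by (simp add: h_def)
    also have "\<dots> < r" using r(1) by (simp add: field_simps add_pos_nonneg)
    finally show ?thesis .
  qed
  define \<Delta> where "\<Delta> n = f (z + h n *\<^sub>R u + h n *\<^sub>R v) - f (z + h n *\<^sub>R u) - f (z + h n *\<^sub>R v) + f z" for n
  have lim: "(\<lambda>n. \<Delta>' n / (h n * h n)) \<longlonglongrightarrow> D u' v' z"
    if "\<And>n. \<exists>x. dist z x \<le> h n * (norm u + norm v) \<and> \<Delta>' n = h n * h n * D u' v' x" for u' v' \<Delta>'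
  proof -
    obtain x where x: "\<And>n. dist z (x n) \<le> h n * (norm u + norm v)" "\<And>n. \<Delta>' n = h n * h n * D u' v' (x n)"
      using \<open>\<And>n. \<exists>x. _ n x\<close> by metis
    have "(\<lambda>n. h n * (norm u + norm v)) \<longlonglongrightarrow> 0"
      using tendsto_mult_left_zero[OF hlim] by simp
    then have "(\<lambda>n. dist (x n) z) \<longlonglongrightarrow> 0"
      by (rule tendsto_sandwich[OF always_eventually always_eventually tendsto_const, rotated 2])
        (use x(1) in \<open>auto simp: dist_commute\<close>)
    then have "x \<longlonglongrightarrow> z" by (rule tendsto_dist_iff[THEN iffD2])
    then have "(\<lambda>n. D u' v' (x n)) \<longlonglongrightarrow> D u' v' z"
      using cont isCont_tendsto_compose by blast
    moreover have "\<Delta>' n / (h n * h n) = D u' v' (x n)" for n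
      using x(2)[of n] h0[of n] by simp
    ultimately show ?thesis by simp
  qed
  have "(\<lambda>n. \<Delta> n / (h n * h n)) \<longlonglongrightarrow> D u v z"
  proof (rule lim)
    show "\<exists>x. dist z x \<le> h n * (norm u + norm v) \<and> \<Delta> n = h n * h n * D u v x" for n
      by (rule second_difference[OF sm h0 hr, of n]) (auto simp: D_def \<Delta>_def)
  qed
  moreover have "(\<lambda>n. \<Delta> n / (h n * h n)) \<longlonglongrightarrow> D v u z"
  proof (rule lim)
    fix n
    have hr': "h n * (norm v + norm u) < r" using hr[of n] by (simp add: add.commute)
    have "\<Delta> n = f (z + h n *\<^sub>R v + h n *\<^sub>R u) - f (z + h n *\<^sub>R v) - f (z + h n *\<^sub>R u) + f z"
      by (simp add: \<Delta>_def add_ac)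
    then show "\<exists>x. dist z x \<le> h n * (norm u + norm v) \<and> \<Delta> n = h n * h n * D v u x"
      by (rule_tac second_difference[OF sm h0 hr']) (auto simp: D_def add.commute)
  qed
  ultimately show ?thesis
    unfolding D_def using LIMSEQ_unique by blast
qed

lemma second_derivative_symmetric:
  fixes f :: "'a::real_normed_vector \<Rightarrow> 'b::euclidean_space"
  assumes "smooth_on f S" "open S" "z \<in> S"
  shows "frechet_derivative (\<lambda>y. frechet_derivative f (at y) u) (at z) v
       = frechet_derivative (\<lambda>y. frechet_derivative f (at y) v) (at z) u"
proof (rule euclidean_eqI)
  fix b :: 'b assume "b \<in> Basis"
  have fb: "smooth_on (\<lambda>y. f y \<bullet> b) S"
    by (intro smooth_on_inner assms smooth_on_const)
  have 1: "frechet_derivative (\<lambda>y. f y \<bullet> b) (at y) = (\<lambda>w. frechet_derivative f (at y) w \<bullet> b)" if "y \<in> S" for y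
    by (rule frechet_derivative_eqI, rule has_derivative_inner_left, rule smooth_on_has_derivative[OF assms(1) that])
  have 2: "frechet_derivative (\<lambda>y. frechet_derivative (\<lambda>y. f y \<bullet> b) (at y) u) (at z) v
     = frechet_derivative (\<lambda>y. frechet_derivative f (at y) u) (at z) v \<bullet> b" for u v
  proof -
    have "((\<lambda>y. frechet_derivative f (at y) u \<bullet> b) has_derivative
       (\<lambda>w. frechet_derivative (\<lambda>y. frechet_derivative f (at y) u) (at z) w \<bullet> b)) (at z)"
      by (rule has_derivative_inner_left, rule smooth_on_has_derivative[OF smooth_on_derivative[OF assms(1)] assms(3)])
    then have "((\<lambda>y. frechet_derivative (\<lambda>y. f y \<bullet> b) (at y) u) has_derivative
       (\<lambda>w. frechet_derivative (\<lambda>y. frechet_derivative f (at y) u) (at z) w \<bullet> b)) (at z)"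
      by (rule has_derivative_transform_within_open[OF _ assms(2,3)]) (simp add: 1)
    then show ?thesis by (simp add: frechet_derivative_eqI)
  qed
  show "frechet_derivative (\<lambda>y. frechet_derivative f (at y) u) (at z) v \<bullet> b
       = frechet_derivative (\<lambda>y. frechet_derivative f (at y) v) (at z) u \<bullet> b"
    using second_derivative_symmetric_real[OF fb assms(2,3), of u v] by (simp add: 2)
qed


section \<open>Holomorphic maps and coordinates along a hypersurface\<close>

lemma linear_complex_vec_expand:
  fixes L :: "complex^'m::finite \<Rightarrow> 'b::real_vector"
  assumes "linear L"
  shows "L v = (\<Sum>k\<in>UNIV. L ((v $ k) *s axis k 1))"
  by (metis (no_types, lifting) assms basis_expansion linear_sum sum.cong)

lemma complex_linear_scale:
  fixes L :: "complex^'m::finite \<Rightarrow> complex"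
  assumes "linear L" "\<And>v. L (\<i> *s v) = \<i> * L v"
  shows "L (c *s v) = c * L v"
proof -
  have "c *s v = Re c *\<^sub>R v + Im c *\<^sub>R (\<i> *s v)"
    by (simp add: vec_eq_iff complex_eq_iff)
  then have "L (c *s v) = Re c *\<^sub>R L v + Im c *\<^sub>R (\<i> * L v)"
    by (simp add: linear_add[OF assms(1)] linear_scale[OF assms(1)] assms(2))
  then show ?thesis by (simp add: complex_eq_iff)
qed

lemma bounded_linear_scale_axis: "bounded_linear (\<lambda>c::complex. c *s (axis k 1 :: complex^'m::finite))"
proof -
  have "linear (\<lambda>c::complex. c *s (axis k 1 :: complex^'m))"
    by (auto intro!: linearI simp: vec_eq_iff algebra_simps axis_def)
  then show ?thesis using linear_conv_bounded_linear by blast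
qed

text \<open>Trades the componentwise definition for complex linearity of the whole differential, the
  form that chain rule and inverse maps respect.\<close>

lemma holomorphic_map_iff:
  fixes f :: "complex^'m::finite \<Rightarrow> complex^'k::finite"
  assumes "open S"
  shows "holomorphic_map f S \<longleftrightarrow> smooth_on f S \<and>
    (\<forall>z\<in>S. \<forall>v. frechet_derivative f (at z) (\<i> *s v) = \<i> *s frechet_derivative f (at z) v)"
proof -
  have comp: "frechet_derivative (\<lambda>z. f z $ i) (at z) v = frechet_derivative f (at z) v $ i"
    if "smooth_on f S" "z \<in> S" for z i v
  proof -
    have "((\<lambda>z. f z $ i) has_derivative (\<lambda>v. frechet_derivative f (at z) v $ i)) (at z)"
      by (rule bounded_linear.has_derivative[OF bounded_linear_vec_nth smooth_on_has_derivative[OF that]])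
    then show ?thesis by (simp add: frechet_derivative_eqI)
  qed
  show ?thesis
  proof
    assume h: "holomorphic_map f S"
    then have sm: "smooth_on f S"
      by (intro smooth_on_vec assms) (auto simp: holomorphic_map_def holomorphic_fun_def)
    moreover have "frechet_derivative f (at z) (\<i> *s v) = \<i> *s frechet_derivative f (at z) v"
      if "z \<in> S" for z v
      using h that by (simp add: vec_eq_iff holomorphic_map_def holomorphic_fun_def flip: comp[OF sm that])
    ultimately show "smooth_on f S \<and>
       (\<forall>z\<in>S. \<forall>v. frechet_derivative f (at z) (\<i> *s v) = \<i> *s frechet_derivative f (at z) v)" by blast
  next
    assume h: "smooth_on f S \<and>
       (\<forall>z\<in>S. \<forall>v. frechet_derivative f (at z) (\<i> *s v) = \<i> *s frechet_derivative f (at z) v)"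
    then have sm: "smooth_on f S" by blast
    show "holomorphic_map f S"
      unfolding holomorphic_map_def holomorphic_fun_def
    proof (intro allI conjI ballI)
      show "smooth_on (\<lambda>z. f z $ i) S" for i
        by (rule smooth_on_compose_linear[OF bounded_linear_vec_nth assms sm])
      show "frechet_derivative (\<lambda>z. f z $ i) (at z) (\<i> *s v) = \<i> * frechet_derivative (\<lambda>z. f z $ i) (at z) v"
        if "z \<in> S" for i z v
        using h that by (simp add: comp[OF sm that])
    qed
  qed
qed

lemma frechet_derivative_compose:
  assumes "f differentiable (at x)" "g differentiable (at (f x))"
  shows "frechet_derivative (\<lambda>x. g (f x)) (at x) v = frechet_derivative g (at (f x)) (frechet_derivative f (at x) v)"
  using has_derivative_compose[OF frechet_derivative_worksI[OF assms(1)] frechet_derivative_worksI[OF assms(2)]]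
  by (simp add: frechet_derivative_eqI)

lemma smooth_on_differentiable: "smooth_on f S \<Longrightarrow> x \<in> S \<Longrightarrow> f differentiable (at x)"
  using smooth_on_has_derivative differentiable_def by blast

text \<open>Both functions have the same derivatives at \<open>x\<close>, and
  \<open>frechet_derivative\<close> is a choice among these, so the equality holds at
  nondifferentiable points as well.\<close>

lemma frechet_derivative_cong_open:
  assumes "open S" "x \<in> S" "\<And>y. y \<in> S \<Longrightarrow> f y = g y"
  shows "frechet_derivative f (at x) = frechet_derivative g (at x)"
proof -
  have "(f has_derivative D) (at x) \<longleftrightarrow> (g has_derivative D) (at x)" for D
    using has_derivative_transform_within_open[OF _ assms(1,2)] assms(3) by metis
  then show ?thesis by (simp add: frechet_derivative_def)
qed

lemma holomorphic_map_compose: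
  fixes f :: "complex^'m::finite \<Rightarrow> complex^'k::finite" and g :: "complex^'k \<Rightarrow> complex^'l::finite"
  assumes "open S" "open T" "f ` S \<subseteq> T" "holomorphic_map f S" "holomorphic_map g T"
  shows "holomorphic_map (\<lambda>z. g (f z)) S"
proof -
  have sm: "smooth_on f S" "smooth_on g T"
    using assms(4,5) holomorphic_map_iff assms(1,2) by blast+
  have "frechet_derivative (\<lambda>z. g (f z)) (at z) (\<i> *s v) = \<i> *s frechet_derivative (\<lambda>z. g (f z)) (at z) v"
    if "z \<in> S" for z v
  proof -
    have "f z \<in> T" using assms(3) that by blast
    then show ?thesis
      using assms(4,5) that holomorphic_map_iff[OF assms(1), of f] holomorphic_map_iff[OF assms(2), of g]
      by (simp add: frechet_derivative_compose smooth_on_differentiable[OF sm(1)] smooth_on_differentiable[OF sm(2)])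
  qed
  then show ?thesis
    using smooth_on_compose[OF assms(1,2,3) sm] holomorphic_map_iff[OF assms(1)] by blast
qed

lemma holomorphic_map_cong:
  assumes "open S" "\<And>z. z \<in> S \<Longrightarrow> f z = g z" "holomorphic_map f S"
  shows "holomorphic_map g S"
proof -
  have f: "smooth_on f S" "\<And>z v. z \<in> S \<Longrightarrow> frechet_derivative f (at z) (\<i> *s v) = \<i> *s frechet_derivative f (at z) v"
    using assms(3) holomorphic_map_iff[OF assms(1), of f] by blast+
  have "smooth_on g S" by (rule smooth_on_cong[OF assms(1,2) f(1)])
  moreover have "frechet_derivative g (at z) = frechet_derivative f (at z)" if "z \<in> S" for z
    by (rule frechet_derivative_cong_open[OF assms(1) that]) (simp add: assms(2))
  ultimately show ?thesis
    using f(2) by (simp add: holomorphic_map_iff[OF assms(1)])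
qed

text \<open>Holomorphic implicit function theorem in the shape of a chart: an entry
  \<open>z $ k\<close> along which \<open>f\<close> has nonzero derivative is replaced by
  \<open>f\<close>. The inverse function theorem supplies a differentiable inverse; smoothness and
  holomorphy of it are read off from the explicit inverse differential.\<close>

lemma hypersurface_coordinates:
  fixes f :: "complex^'m::finite \<Rightarrow> complex"
  assumes "open S" "z0 \<in> S" "holomorphic_fun f S" "surj (frechet_derivative f (at z0))"
  obtains k and V T :: "(complex^'m) set" and \<Psi> G :: "complex^'m \<Rightarrow> complex^'m" where "open V" "z0 \<in> V" "V \<subseteq> S" "open T" "homeomorphism V T \<Psi> G"
    "holomorphic_map \<Psi> V" "holomorphic_map G T" "\<forall>z. \<Psi> z $ k = f z"
proof -
  define D where "D z = frechet_derivative f (at z)" for z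
  have smf: "smooth_on f S" and hol: "\<And>z v. z \<in> S \<Longrightarrow> D z (\<i> *s v) = \<i> * D z v"
    using assms(3) by (auto simp: holomorphic_fun_def D_def)
  have Df: "(f has_derivative D z) (at z)" if "z \<in> S" for z
    unfolding D_def by (rule smooth_on_has_derivative[OF smf that])
  have linD: "linear (D z)" if "z \<in> S" for z
    using Df[OF that] has_derivative_linear by blast
  have scD: "D z (c *s v) = c * D z v" if "z \<in> S" for z c v
    using complex_linear_scale[OF linD[OF that] hol[OF that]] .
  have smD: "smooth_on (\<lambda>z. D z v) S" for v
    unfolding D_def by (rule smooth_on_derivative[OF smf])
  \<comment> \<open>A complex linear differential that vanishes on every \<open>axis k 1\<close> is
    zero, hence not onto.\<close>
  obtain k where k: "D z0 (axis k 1) \<noteq> 0"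
  proof (rule ccontr)
    assume "\<not> thesis"
    then have "D z0 (axis k 1) = 0" for k using that by blast
    then have "D z0 v = 0" for v
      by (subst linear_complex_vec_expand[OF linD[OF assms(2)]]) (simp add: scD[OF assms(2)])
    then show False
      using assms(4) unfolding D_def[symmetric] surj_def by (metis one_neq_zero)
  qed
  define e where "e = (axis k 1 :: complex^'m)"
  have ek: "e $ k = 1" by (simp add: e_def)
  define S' where "S' = S \<inter> (\<lambda>z. D z e) -` (- {0})"
  have oS': "open S'"
    unfolding S'_def
    by (rule continuous_open_preimage[OF smooth_on_continuous[OF smD] assms(1)]) auto
  have S': "z0 \<in> S'" "S' \<subseteq> S" "\<And>z. z \<in> S' \<Longrightarrow> D z e \<noteq> 0"
    using k assms(2) by (auto simp: S'_def e_def)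
  \<comment> \<open>Moving \<open>z\<close> along \<open>e\<close> until its \<open>k\<close>-th
    entry is \<open>f z\<close> leaves the other entries alone. \<open>A\<close> is the differential
    of this map; \<open>B\<close> inverts it by choosing the \<open>k\<close>-th entry so that
    \<open>D z\<close> takes the value \<open>w $ k\<close>.\<close>
  define \<Psi> where "\<Psi> z = z + (f z - z $ k) *s e" for z
  define A where "A z v = v + (D z v - v $ k) *s e" for z v
  define B where "B z w = w + ((w $ k - D z (w - (w $ k) *s e)) * inverse (D z e) - w $ k) *s e" for z w
  have AB: "A z (B z w) = w" if "z \<in> S'" for z w
  proof -
    let ?c = "(w $ k - D z (w - (w $ k) *s e)) * inverse (D z e)"
    have zS: "z \<in> S" using that S' by blast
    have Bw: "B z w = (w - (w $ k) *s e) + ?c *s e"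
      by (simp add: B_def vec_eq_iff algebra_simps)
    have "D z (B z w) = w $ k"
      unfolding Bw using S'(3)[OF that]
      by (simp add: linear_add[OF linD[OF zS]] scD[OF zS] mult.assoc)
    moreover have "B z w $ k = ?c" unfolding Bw by (simp add: ek)
    ultimately have "A z (B z w) = B z w + (w $ k - ?c) *s e"
      unfolding A_def by (simp only:)
    also have "\<dots> = w"
      unfolding Bw by (simp add: vec_eq_iff algebra_simps)
    finally show ?thesis .
  qed
  have BA: "B z (A z v) = v" if "z \<in> S'" for z v
  proof -
    have zS: "z \<in> S" using that S' by blast
    have Ak: "A z v $ k = D z v" by (simp add: A_def ek)
    have "A z v - (A z v $ k) *s e = v - (v $ k) *s e"
      unfolding Ak by (simp add: A_def vec_eq_iff algebra_simps)
    then have "B z (A z v) = A z v + ((D z v - D z (v - (v $ k) *s e)) * inverse (D z e) - D z v) *s e"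
      unfolding B_def Ak by simp
    also have "D z v - D z (v - (v $ k) *s e) = (v $ k) * D z e"
      by (simp add: linear_diff[OF linD[OF zS]] scD[OF zS])
    also have "(v $ k) * D z e * inverse (D z e) = v $ k"
      using S'(3)[OF that] by simp
    also have "A z v + (v $ k - D z v) *s e = v"
      by (simp add: A_def vec_eq_iff algebra_simps)
    finally show ?thesis .
  qed
  have dPsi: "(\<Psi> has_derivative A z) (at z)" if "z \<in> S" for z
    unfolding \<Psi>_def[abs_def] A_def[abs_def] e_def
    by (intro has_derivative_add has_derivative_ident bounded_linear.has_derivative[OF bounded_linear_scale_axis]
        has_derivative_diff bounded_linear.has_derivative[OF bounded_linear_vec_nth] Df that)
  have smPsi: "smooth_on \<Psi> S"
    unfolding \<Psi>_def[abs_def] e_def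
    by (intro smooth_on_add smooth_on_compose_linear[OF bounded_linear_scale_axis] smooth_on_diff smf assms(1)
        smooth_on_linear bounded_linear_ident bounded_linear_vec_nth)
  have blA: "bounded_linear (A z)" if "z \<in> S" for z
    using dPsi[OF that] has_derivative_bounded_linear by blast
  have fdPsi: "frechet_derivative \<Psi> (at z) = A z" if "z \<in> S" for z
    using dPsi[OF that] frechet_derivative_eqI by blast
  have smA: "smooth_on (\<lambda>z. A z v) S" for v
    by (rule smooth_on_cong[OF assms(1) _ smooth_on_derivative[OF smPsi]]) (simp add: fdPsi)
  have blB: "bounded_linear (B z)" if "z \<in> S" for z
  proof -
    have [simp]: "D z (x + y) = D z x + D z y" "D z (r *\<^sub>R x) = r *\<^sub>R D z x" "D z (x - y) = D z x - D z y" for x y r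
      using linD[OF that] by (simp_all add: linear_add linear_scale linear_diff)
    have "linear (B z)"
      by (rule linearI) (simp_all add: B_def vec_eq_iff scD[OF that] algebra_simps)
    then show ?thesis using linear_conv_bounded_linear by blast
  qed
  obtain U' T G G' where V: "open U'" "U' \<subseteq> S'" "z0 \<in> U'" "open T" "homeomorphism U' T \<Psi> G"
    and G': "\<And>y. y \<in> T \<Longrightarrow> (G has_derivative (G' y)) (at y)"
      "\<And>y. y \<in> T \<Longrightarrow> G' y = inv (blinfun_apply (Blinfun (A (G y))))"
  proof (rule inverse_function_theorem[of S' \<Psi> "\<lambda>z. Blinfun (A z)" z0 "Blinfun (B z0)"])
    show "(\<Psi> has_derivative blinfun_apply (Blinfun (A x))) (at x)" if "x \<in> S'" for x
      using that S'(2) dPsi[of x] blA[of x] by (auto simp: bounded_linear_Blinfun_apply)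
    show "continuous_on S' (\<lambda>z. Blinfun (A z))"
    proof (rule continuous_on_blinfun_componentwise)
      fix i :: "complex^'m"
      have "continuous_on S' (\<lambda>z. A z i)"
        using smooth_on_continuous[OF smA] S'(2) continuous_on_subset by blast
      then show "continuous_on S' (\<lambda>z. blinfun_apply (Blinfun (A z)) i)"
        by (rule continuous_on_cong[THEN iffD1, rotated -1])
          (use S'(2) blA in \<open>auto simp: bounded_linear_Blinfun_apply\<close>)
    qed
    show "Blinfun (B z0) o\<^sub>L Blinfun (A z0) = id_blinfun"
      using BA[OF S'(1)] blA[OF assms(2)] blB[OF assms(2)]
      by (intro blinfun_eqI) (simp add: bounded_linear_Blinfun_apply)
  qed (use oS' S' in \<open>blast+\<close>)
  have GT: "G y \<in> S'" if "y \<in> T" for y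
    using V(2,5) that by (auto simp: homeomorphism_def)
  have dG: "(G has_derivative B (G y)) (at y)" if "y \<in> T" for y
  proof -
    have "A (G y) \<circ> B (G y) = id" "B (G y) \<circ> A (G y) = id"
      using AB BA GT[OF that] by auto
    then have "inv (A (G y)) = B (G y)" by (meson inv_unique_comp)
    then show ?thesis
      using G'[OF that] blA[of "G y"] GT[OF that] S'(2) by (auto simp: bounded_linear_Blinfun_apply)
  qed
  \<comment> \<open>Bootstrapping: the differential of \<open>G\<close> at \<open>y\<close> is
    \<open>B (G y)\<close>, a rational expression in values of \<open>D (G y)\<close>, so class
    \<open>n\<close> of \<open>G\<close> yields class \<open>n + 1\<close>.\<close>
  have ckG: "Ck_on n G T" for n
  proof (induction n)
    case 0
    show ?case using V(5) by (simp add: homeomorphism_def)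
  next
    case (Suc n)
    have cD: "Ck_on n (\<lambda>y. D (G y) v) T" for v
      by (rule Ck_on_compose[OF V(4) oS' _ Suc.IH])
        (use GT smooth_on_subset[OF smD S'(2)] in \<open>auto simp: smooth_on_def\<close>)
    have lin: "Ck_on n (\<lambda>y. c y *s e) T" if "Ck_on n c T" for c
      unfolding e_def
      by (rule Ck_on_compose[OF V(4) open_UNIV _ that Ck_on_linear[OF bounded_linear_scale_axis]]) auto
    have "Ck_on n (\<lambda>y. w + ((w $ k + - 1 * D (G y) (w - (w $ k) *s e)) * inverse (D (G y) e) + - (w $ k)) *s e) T" for w
      by (intro Ck_on_add lin Ck_on_bilinear[OF bounded_bilinear_mult] Ck_on_inverse Ck_on_const V(4) cD)
        (use GT S'(3) in auto)
    then have "Ck_on n (\<lambda>y. B (G y) w) T" for w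
      by (simp add: B_def)
    then show ?case
      using Ck_on_SucI[OF dG V(4)] by blast
  qed
  have holA: "A z (\<i> *s v) = \<i> *s A z v" if "z \<in> S" for z v
    by (simp add: A_def vec_eq_iff scD[OF that] algebra_simps)
  have holB: "B z (\<i> *s v) = \<i> *s B z v" if "z \<in> S'" for z v
    by (metis AB BA S'(2) holA subsetD that)
  show ?thesis
  proof (rule that[of U' T \<Psi> G k])
    have "U' \<subseteq> S" using V S' by blast
    then show "holomorphic_map \<Psi> U'"
      using holA smooth_on_subset[OF smPsi] fdPsi by (subst holomorphic_map_iff[OF V(1)]) auto
    show "holomorphic_map G T"
      using ckG holB GT frechet_derivative_eqI[OF dG] by (subst holomorphic_map_iff[OF V(4)]) (auto simp: smooth_on_def)
    show "\<forall>z. \<Psi> z $ k = f z" by (simp add: \<Psi>_def ek)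
  qed (use V S' in auto)
qed


section \<open>Lifting through an immersion\<close>

text \<open>A linear left inverse \<open>g\<close> of \<open>F'\<close> turns
  \<open>F (\<tau> x) = h x\<close> into \<open>\<tau> x = g (h x) - \<rho> (\<tau> x)\<close>,
  where \<rho> has derivative zero at \<open>\<tau> z\<close>. Continuity of \<tau> makes the last
  term small, first enough for a Lipschitz bound, then of lower order than \<open>x - z\<close>.
  This is how two charts of a fibre are compared through the total space.\<close>

lemma differentiable_lift_immersion:
  fixes F :: "'b::euclidean_space \<Rightarrow> 'c::euclidean_space" and \<tau> :: "'a::real_normed_vector \<Rightarrow> 'b"
  assumes F: "(F has_derivative F') (at (\<tau> z))" "inj F'"
    and h: "h differentiable (at z)" and cont: "isCont \<tau> z"
    and N: "open N" "z \<in> N" "\<And>x. x \<in> N \<Longrightarrow> F (\<tau> x) = h x"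
  shows "\<tau> differentiable (at z)"
proof -
  obtain h' where h': "(h has_derivative h') (at z)" using h by (auto simp: differentiable_def)
  obtain g where g: "linear g" "g \<circ> F' = id"
    using linear_injective_left_inverse[OF has_derivative_linear[OF F(1)] F(2)] by blast
  have blg: "bounded_linear g" using g(1) linear_conv_bounded_linear by blast
  define \<rho> where "\<rho> w = g (F w) - w" for w
  define p where "p x = g (h x)" for x
  have \<rho>': "(\<rho> has_derivative (\<lambda>_. 0)) (at (\<tau> z))"
  proof -
    have "(\<rho> has_derivative (\<lambda>v. g (F' v) - v)) (at (\<tau> z))"
      unfolding \<rho>_def[abs_def]
      by (intro has_derivative_diff has_derivative_ident bounded_linear.has_derivative[OF blg F(1)])
    then show ?thesis using g(2) by (simp add: fun_eq_iff)
  qed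
  have p': "(p has_derivative (\<lambda>v. g (h' v))) (at z)"
    unfolding p_def[abs_def] by (rule bounded_linear.has_derivative[OF blg h'])
  have \<tau>: "\<tau> x = p x - \<rho> (\<tau> x)" if "x \<in> N" for x
    using N(3)[OF that] by (simp add: p_def \<rho>_def)
  \<comment> \<open>Only continuity of \<tau> is available so far, so the error is measured against
    the increment of \<tau> itself.\<close>
  have small: "eventually (\<lambda>x. norm (\<rho> (\<tau> x) - \<rho> (\<tau> z)) \<le> e * norm (\<tau> x - \<tau> z)) (nhds z)" if "e > 0" for e
  proof -
    have "\<exists>d>0. \<forall>w. norm (w - \<tau> z) < d \<longrightarrow> norm (\<rho> w - \<rho> (\<tau> z) - 0) \<le> e * norm (w - \<tau> z)"
      using \<rho>' that unfolding has_derivative_at_alt by blast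
    then obtain d where d: "d > 0" "\<And>w. norm (w - \<tau> z) < d \<Longrightarrow> norm (\<rho> w - \<rho> (\<tau> z)) \<le> e * norm (w - \<tau> z)"
      by auto
    have "(\<tau> \<longlongrightarrow> \<tau> z) (nhds z)"
      using cont by (simp add: isCont_def tendsto_at_iff_tendsto_nhds)
    then have "eventually (\<lambda>x. dist (\<tau> x) (\<tau> z) < d) (nhds z)"
      using d(1) by (rule tendstoD)
    then show ?thesis by eventually_elim (auto simp: dist_norm intro: d(2))
  qed
  obtain K where K: "K > 0" "eventually (\<lambda>x. norm (p x - p z) \<le> K * norm (x - z)) (nhds z)"
  proof -
    have blp: "bounded_linear (\<lambda>v. g (h' v))" using p' has_derivative_bounded_linear by blast
    obtain K0 where K0: "K0 > 0" "\<And>v. norm (g (h' v)) \<le> norm v * K0"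
      using bounded_linear.pos_bounded[OF blp] by blast
    have "\<exists>d>0. \<forall>x. norm (x - z) < d \<longrightarrow> norm (p x - p z - g (h' (x - z))) \<le> 1 * norm (x - z)"
      using p' zero_less_one unfolding has_derivative_at_alt by blast
    then obtain d where d: "d > 0" "\<And>x. norm (x - z) < d \<Longrightarrow> norm (p x - p z - g (h' (x - z))) \<le> 1 * norm (x - z)"
      by blast
    have "norm (p x - p z) \<le> (1 + K0) * norm (x - z)" if "dist x z < d" for x
    proof -
      have "norm (p x - p z) \<le> norm (p x - p z - g (h' (x - z))) + norm (g (h' (x - z)))"
        using norm_triangle_sub[of "p x - p z" "g (h' (x - z))"] by (simp add: add.commute)
      also have "\<dots> \<le> 1 * norm (x - z) + norm (x - z) * K0"
        using that by (intro add_mono d(2) K0(2)) (simp add: dist_norm)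
      finally show ?thesis by (simp add: algebra_simps)
    qed
    then have "eventually (\<lambda>x. norm (p x - p z) \<le> (1 + K0) * norm (x - z)) (nhds z)"
      using d(1) unfolding eventually_nhds_metric by blast
    then show ?thesis using that[of "1 + K0"] K0(1) by simp
  qed
  have evN: "eventually (\<lambda>x. x \<in> N) (nhds z)" using N eventually_nhds by blast
  \<comment> \<open>With error factor 1/2, half of the increment of \<tau> is absorbed on the left,
    which costs the factor 2 in the bound.\<close>
  have lip: "eventually (\<lambda>x. norm (\<tau> x - \<tau> z) \<le> 2 * K * norm (x - z)) (nhds z)"
    using small[of "1/2", simplified] K(2) evN
  proof eventually_elim
    case (elim x)
    have "norm (\<tau> x - \<tau> z) = norm ((p x - p z) - (\<rho> (\<tau> x) - \<rho> (\<tau> z)))"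
      by (simp add: p_def \<rho>_def N(3)[OF elim(3)] N(3)[OF N(2)])
    also have "\<dots> \<le> norm (p x - p z) + norm (\<rho> (\<tau> x) - \<rho> (\<tau> z))" by (rule norm_triangle_ineq4)
    finally show ?case using elim by simp
  qed
  have "((\<lambda>x. \<rho> (\<tau> x)) has_derivative (\<lambda>_. 0)) (at z)"
    unfolding has_derivative_at_alt
  proof (intro conjI allI impI)
    fix e :: real assume "e > 0"
    then have "e / (2 * K) > 0" using K(1) by simp
    from small[OF this] lip have "eventually (\<lambda>x. norm (\<rho> (\<tau> x) - \<rho> (\<tau> z)) \<le> e * norm (x - z)) (nhds z)"
    proof eventually_elim
      case (elim x)
      have "e / (2 * K) * norm (\<tau> x - \<tau> z) \<le> e / (2 * K) * (2 * K * norm (x - z))"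
        using elim(2) \<open>e / (2 * K) > 0\<close> by (intro mult_left_mono) auto
      then show ?case using elim(1) K(1) by simp
    qed
    then show "\<exists>d>0. \<forall>y. norm (y - z) < d \<longrightarrow> norm (\<rho> (\<tau> y) - \<rho> (\<tau> z) - 0) \<le> e * norm (y - z)"
      unfolding eventually_nhds_metric dist_norm by simp
  qed simp
  from has_derivative_diff[OF p' this]
  have "((\<lambda>x. p x - \<rho> (\<tau> x)) has_derivative (\<lambda>v. g (h' v))) (at z)" by simp
  then have "(\<tau> has_derivative (\<lambda>v. g (h' v))) (at z)"
    by (rule has_derivative_transform_within_open[OF _ N(1,2)]) (rule \<tau>[symmetric])
  then show ?thesis by (auto simp: differentiable_def)
qed


section \<open>Pullback of differential forms\<close>

lemma isCont_nhd:
  assumes "isCont g z" "open T" "g z \<in> T"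
  shows "\<exists>N. open N \<and> z \<in> N \<and> (\<forall>x\<in>N. g x \<in> T)"
  using continuous_at_open[THEN iffD1, OF assms(1), rule_format, of T] assms(2,3) by simp

text \<open>Product rule for a form evaluated at a moving point on a moving vector. Linearity
  permits expanding the vector in a basis, which leaves derivatives of the form on fixed vectors, as
  controlled by \<open>diff\<close>.\<close>

lemma has_derivative_family_linear:
  fixes \<alpha> :: "'a::real_normed_vector \<Rightarrow> 'b::euclidean_space \<Rightarrow> 'c::real_normed_vector"
    and g :: "'d::real_normed_vector \<Rightarrow> 'a"
  assumes T: "open T" "g z \<in> T" "\<And>y. y \<in> T \<Longrightarrow> linear (\<alpha> y)"
    and diff: "\<And>v. (\<lambda>y. \<alpha> y v) differentiable (at (g z))"
    and g: "(g has_derivative g') (at z)" and h: "(h has_derivative h') (at z)"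
  shows "((\<lambda>x. \<alpha> (g x) (h x)) has_derivative
    (\<lambda>u. frechet_derivative (\<lambda>y. \<alpha> y (h z)) (at (g z)) (g' u) + \<alpha> (g z) (h' u))) (at z)"
proof -
  have expand: "\<alpha> y v = (\<Sum>b\<in>Basis. (v \<bullet> b) *\<^sub>R \<alpha> y b)" if "y \<in> T" for y v
  proof -
    have "\<alpha> y v = \<alpha> y (\<Sum>b\<in>Basis. (v \<bullet> b) *\<^sub>R b)" by (simp add: euclidean_representation)
    also have "\<dots> = (\<Sum>b\<in>Basis. (v \<bullet> b) *\<^sub>R \<alpha> y b)"
      using T(3)[OF that] by (simp add: linear_sum linear_scale)
    finally show ?thesis .
  qed
  define D where "D v = frechet_derivative (\<lambda>y. \<alpha> y v) (at (g z))" for v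
  have D: "((\<lambda>y. \<alpha> y v) has_derivative D v) (at (g z))" for v
    unfolding D_def using frechet_derivative_worksI[OF diff] .
  have Dexp: "D v w = (\<Sum>b\<in>Basis. (v \<bullet> b) *\<^sub>R D b w)" for v w
  proof -
    have "((\<lambda>y. \<Sum>b\<in>Basis. (v \<bullet> b) *\<^sub>R \<alpha> y b) has_derivative (\<lambda>w. \<Sum>b\<in>Basis. (v \<bullet> b) *\<^sub>R D b w)) (at (g z))"
      by (intro has_derivative_sum has_derivative_scaleR_right D)
    then have "((\<lambda>y. \<alpha> y v) has_derivative (\<lambda>w. \<Sum>b\<in>Basis. (v \<bullet> b) *\<^sub>R D b w)) (at (g z))"
      by (rule has_derivative_transform_within_open[OF _ T(1,2)]) (rule expand[symmetric])
    then show ?thesis using D[of v] has_derivative_unique by metis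
  qed
  have "isCont g z" using g has_derivative_continuous by blast
  then obtain N where N: "open N" "z \<in> N" "\<And>x. x \<in> N \<Longrightarrow> g x \<in> T"
    using isCont_nhd[of z g T] T(1,2) by blast
  have "((\<lambda>x. \<Sum>b\<in>Basis. (h x \<bullet> b) *\<^sub>R \<alpha> (g x) b) has_derivative
     (\<lambda>u. \<Sum>b\<in>Basis. (h z \<bullet> b) *\<^sub>R D b (g' u) + (h' u \<bullet> b) *\<^sub>R \<alpha> (g z) b)) (at z)"
    by (intro has_derivative_sum has_derivative_scaleR has_derivative_inner_left h
        has_derivative_compose[OF g D])
  then have "((\<lambda>x. \<alpha> (g x) (h x)) has_derivative
     (\<lambda>u. \<Sum>b\<in>Basis. (h z \<bullet> b) *\<^sub>R D b (g' u) + (h' u \<bullet> b) *\<^sub>R \<alpha> (g z) b)) (at z)"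
    by (rule has_derivative_transform_within_open[OF _ N(1,2)]) (use N(3) expand in metis)
  then show ?thesis
    by (simp add: sum.distrib Dexp[symmetric] expand[OF T(2), symmetric] flip: D_def)
qed

lemma has_derivative_family_bilinear:
  fixes \<omega> :: "'a::real_normed_vector \<Rightarrow> 'b::euclidean_space \<Rightarrow> 'b \<Rightarrow> 'c::real_normed_vector"
    and g :: "'d::real_normed_vector \<Rightarrow> 'a"
  assumes T: "open T" "g z \<in> T" "\<And>y v. y \<in> T \<Longrightarrow> linear (\<omega> y v)" "\<And>y w. y \<in> T \<Longrightarrow> linear (\<lambda>v. \<omega> y v w)"
    and diff: "\<And>v w. (\<lambda>y. \<omega> y v w) differentiable (at (g z))"
    and g: "(g has_derivative g') (at z)" and h: "(h has_derivative h') (at z)"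
    and k: "(k has_derivative k') (at z)"
  shows "((\<lambda>x. \<omega> (g x) (h x) (k x)) has_derivative
    (\<lambda>u. frechet_derivative (\<lambda>y. \<omega> y (h z) (k z)) (at (g z)) (g' u)
       + \<omega> (g z) (h' u) (k z) + \<omega> (g z) (h z) (k' u))) (at z)"
proof -
  have 1: "((\<lambda>x. \<omega> (g x) v (k x)) has_derivative
    (\<lambda>u. frechet_derivative (\<lambda>y. \<omega> y v (k z)) (at (g z)) (g' u) + \<omega> (g z) v (k' u))) (at z)" for v
    by (rule has_derivative_family_linear[where \<alpha> = "\<lambda>y. \<omega> y v", OF T(1,2,3) diff g k])
  have "isCont g z" using g has_derivative_continuous by blast
  then obtain N where N: "open N" "z \<in> N" "\<And>x. x \<in> N \<Longrightarrow> g x \<in> T"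
    using isCont_nhd[of z g T] T(1,2) by blast
  \<comment> \<open>Second use of the linear rule, for the family
    \<open>\<lambda>x v. \<omega> (g x) v (k x)\<close>, whose derivative for fixed \<open>v\<close>
    is fact 1.\<close>
  have "((\<lambda>x. \<omega> (g x) (h x) (k x)) has_derivative
    (\<lambda>u. frechet_derivative (\<lambda>x. \<omega> (g x) (h z) (k x)) (at z) u + \<omega> (g z) (h' u) (k z))) (at z)"
    by (rule has_derivative_family_linear[where \<alpha> = "\<lambda>x v. \<omega> (g x) v (k x)" and g = "\<lambda>x. x" and g' = "\<lambda>u. u",
          OF N(1,2) T(4)[OF N(3)] _ _ h]) (use 1 in \<open>auto simp: differentiable_def\<close>)
  then show ?thesis
    by (simp add: frechet_derivative_eqI[OF 1] add_ac)
qed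

definition pullback1 :: "(complex^'p \<Rightarrow> complex^'q) \<Rightarrow> 'q form1 \<Rightarrow> 'p form1" where
  "pullback1 G \<alpha> z v = \<alpha> (G z) (frechet_derivative G (at z) v)"

definition pullback2 :: "(complex^'p \<Rightarrow> complex^'q) \<Rightarrow> 'q form2 \<Rightarrow> 'p form2" where
  "pullback2 G \<omega> z v w = \<omega> (G z) (frechet_derivative G (at z) v) (frechet_derivative G (at z) w)"

lemma local_form2_antisym:
  assumes "local_form2 S \<omega>" "z \<in> S"
  shows "\<omega> z w v = - \<omega> z v w"
proof -
  have lr: "linear (\<omega> z x)" and ll: "linear (\<lambda>x. \<omega> z x y)" and alt: "\<omega> z x x = 0" for x y
    using assms unfolding local_form2_def by blast+
  have "\<omega> z (v + w) (v + w) = \<omega> z v v + \<omega> z v w + (\<omega> z w v + \<omega> z w w)"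
    by (simp only: linear_add[OF lr] linear_add[OF ll])
  then show ?thesis using alt[of "v + w"] alt[of v] alt[of w] by linarith
qed

lemma local_form2_expand:
  assumes "local_form2 S \<omega>" "z \<in> S"
  shows "\<omega> z v w = (\<Sum>b\<in>Basis. (v \<bullet> b) * (\<Sum>c\<in>Basis. (w \<bullet> c) * \<omega> z b c))"
proof -
  have lr: "linear (\<omega> z v)" and ll: "linear (\<lambda>v. \<omega> z v w)" for v w
    using assms by (auto simp: local_form2_def)
  have 1: "\<omega> z v w = (\<Sum>b\<in>Basis. (v \<bullet> b) * \<omega> z b w)"
    using linear_sum[OF ll, of "\<lambda>b. (v \<bullet> b) *\<^sub>R b" Basis w]
    by (simp add: euclidean_representation linear_scale[OF ll])
  have 2: "\<omega> z v w = (\<Sum>c\<in>Basis. (w \<bullet> c) * \<omega> z v c)" for v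
    using linear_sum[OF lr, of v "\<lambda>b. (w \<bullet> b) *\<^sub>R b" Basis]
    by (simp add: euclidean_representation linear_scale[OF lr])
  show ?thesis unfolding 1 by (simp only: 2)
qed

context
  fixes S :: "(complex^'p::finite) set" and T :: "(complex^'q::finite) set" and G
  assumes ST: "open S" "open T" and G: "smooth_on G S" "G ` S \<subseteq> T"
begin

private lemma GT: "z \<in> S \<Longrightarrow> G z \<in> T"
  using G(2) by blast

private lemma dG: "z \<in> S \<Longrightarrow> (G has_derivative frechet_derivative G (at z)) (at z)"
  using smooth_on_has_derivative[OF G(1)] .

private lemma ddG: "z \<in> S \<Longrightarrow> ((\<lambda>y. frechet_derivative G (at y) v) has_derivative
    frechet_derivative (\<lambda>y. frechet_derivative G (at y) v) (at z)) (at z)"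
  using smooth_on_has_derivative[OF smooth_on_derivative[OF G(1)]] .

private lemma linear_dG: "z \<in> S \<Longrightarrow> linear (frechet_derivative G (at z))"
  using dG has_derivative_linear by blast

lemma local_form1_pullback:
  assumes "local_form1 T \<alpha>"
  shows "local_form1 S (pullback1 G \<alpha>)"
proof -
  have lin: "linear (\<alpha> y)" if "y \<in> T" for y using assms that by (simp add: local_form1_def)
  have "smooth_on (\<lambda>z. pullback1 G \<alpha> z v) S" for v
  proof (rule smooth_on_cong[OF ST(1)])
    show "smooth_on (\<lambda>z. \<Sum>b\<in>Basis. (frechet_derivative G (at z) v \<bullet> b) * \<alpha> (G z) b) S"
      using assms
      by (intro smooth_on_sum smooth_on_mult smooth_on_inner smooth_on_const ST(1) smooth_on_derivative
          smooth_on_compose[OF ST G(2,1)] G(1)) (auto simp: local_form1_def)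
    show "(\<Sum>b\<in>Basis. (frechet_derivative G (at z) v \<bullet> b) * \<alpha> (G z) b) = pullback1 G \<alpha> z v" if "z \<in> S" for z
      unfolding pullback1_def
      using linear_sum[OF lin[OF GT[OF that]], of "\<lambda>b. (frechet_derivative G (at z) v \<bullet> b) *\<^sub>R b" Basis]
      by (simp add: euclidean_representation linear_scale[OF lin[OF GT[OF that]]])
  qed
  moreover have "linear (pullback1 G \<alpha> z)" if "z \<in> S" for z
    unfolding pullback1_def
    using linear_compose[OF linear_dG[OF that] lin[OF GT[OF that]]] by (simp add: o_def)
  ultimately show ?thesis by (simp add: local_form1_def)
qed

lemma local_form2_pullback:
  assumes "local_form2 T \<omega>"
  shows "local_form2 S (pullback2 G \<omega>)"
proof -
  have lr: "linear (\<omega> y v)" and ll: "linear (\<lambda>v. \<omega> y v w)" and alt: "\<omega> y v v = 0" if "y \<in> T" for y v w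
    using assms that by (auto simp: local_form2_def)
  note expand = local_form2_expand[OF assms]
  have "smooth_on (\<lambda>z. pullback2 G \<omega> z v w) S" for v w
  proof (rule smooth_on_cong[OF ST(1)])
    let ?D = "\<lambda>z v. frechet_derivative G (at z) v"
    show "smooth_on (\<lambda>z. \<Sum>b\<in>Basis. (?D z v \<bullet> b) * (\<Sum>c\<in>Basis. (?D z w \<bullet> c) * \<omega> (G z) b c)) S"
      using assms
      by (intro smooth_on_sum smooth_on_mult smooth_on_inner smooth_on_const ST(1) smooth_on_derivative
          smooth_on_compose[OF ST G(2,1)] G(1)) (auto simp: local_form2_def)
    show "(\<Sum>b\<in>Basis. (?D z v \<bullet> b) * (\<Sum>c\<in>Basis. (?D z w \<bullet> c) * \<omega> (G z) b c)) = pullback2 G \<omega> z v w" if "z \<in> S" for z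
      unfolding pullback2_def by (rule expand[OF GT[OF that], symmetric])
  qed
  moreover have "linear (pullback2 G \<omega> z v)" "linear (\<lambda>v. pullback2 G \<omega> z v w)" if "z \<in> S" for z v w
    unfolding pullback2_def
    using linear_compose[OF linear_dG[OF that] lr[OF GT[OF that]]]
      linear_compose[OF linear_dG[OF that] ll[OF GT[OF that]]] by (simp_all add: o_def)
  moreover have "pullback2 G \<omega> z v v = 0" if "z \<in> S" for z v
    unfolding pullback2_def using alt[OF GT[OF that]] .
  ultimately show ?thesis by (simp add: local_form2_def)
qed

text \<open>Differentiating a pullback also produces second derivatives of \<open>G\<close>; they
  are symmetric in \<open>u\<close> and \<open>v\<close>, and the alternation in the exterior
  derivative cancels them.\<close>

lemma d_form1_pullback:
  assumes "local_form1 T \<alpha>" "z \<in> S"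
  shows "d_form1 (pullback1 G \<alpha>) z u v
    = d_form1 \<alpha> (G z) (frechet_derivative G (at z) u) (frechet_derivative G (at z) v)"
proof -
  have "((\<lambda>y. pullback1 G \<alpha> y v) has_derivative
     (\<lambda>u. frechet_derivative (\<lambda>y. \<alpha> y (frechet_derivative G (at z) v)) (at (G z)) (frechet_derivative G (at z) u)
       + \<alpha> (G z) (frechet_derivative (\<lambda>y. frechet_derivative G (at y) v) (at z) u))) (at z)" for v
    unfolding pullback1_def
    by (rule has_derivative_family_linear[OF ST(2) GT[OF assms(2)] _ _ dG[OF assms(2)] ddG[OF assms(2)]])
      (use assms GT in \<open>auto simp: local_form1_def intro: smooth_on_differentiable\<close>)
  from frechet_derivative_eqI[OF this] show ?thesis
    by (simp add: d_form1_def second_derivative_symmetric[OF G(1) ST(1) assms(2), of v u])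
qed

lemma d_form2_pullback:
  assumes "local_form2 T \<omega>" "z \<in> S"
  shows "d_form2 (pullback2 G \<omega>) z u v w
    = d_form2 \<omega> (G z) (frechet_derivative G (at z) u) (frechet_derivative G (at z) v) (frechet_derivative G (at z) w)"
proof -
  let ?D = "\<lambda>v. frechet_derivative G (at z) v"
  define H where "H v u = frechet_derivative (\<lambda>y. frechet_derivative G (at y) v) (at z) u" for v u
  have "((\<lambda>y. pullback2 G \<omega> y v w) has_derivative
     (\<lambda>u. frechet_derivative (\<lambda>y. \<omega> y (?D v) (?D w)) (at (G z)) (?D u)
       + \<omega> (G z) (H v u) (?D w) + \<omega> (G z) (?D v) (H w u))) (at z)" for v w
    unfolding pullback2_def H_def
    by (rule has_derivative_family_bilinear[OF ST(2) GT[OF assms(2)] _ _ _ dG[OF assms(2)] ddG[OF assms(2)] ddG[OF assms(2)]])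
      (use assms in \<open>auto simp: local_form2_def GT intro!: smooth_on_differentiable[where S = T]\<close>)
  note * = frechet_derivative_eqI[OF this]
  \<comment> \<open>The six terms containing \<open>H\<close> cancel in pairs: by this symmetry,
    combined with antisymmetry of \<omega> where the two occurrences of \<open>H\<close> sit in
    different slots.\<close>
  have sym: "H v u = H u v" for u v
    unfolding H_def by (rule second_derivative_symmetric[OF G(1) ST(1) assms(2)])
  note anti = local_form2_antisym[OF assms(1) GT[OF assms(2)]]
  show ?thesis
    unfolding d_form2_def *
    using anti[of "?D v" "H u w"] anti[of "?D w" "H u v"] anti[of "?D u" "H v w"]
    by (simp add: sym[of v u] sym[of w u] sym[of w v])
qed

end

lemma wedge12_pullback:
  "wedge12 (pullback1 G \<alpha>) (pullback2 G \<omega>) z u v w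
    = wedge12 \<alpha> \<omega> (G z) (frechet_derivative G (at z) u) (frechet_derivative G (at z) v) (frechet_derivative G (at z) w)"
  by (simp add: wedge12_def pullback1_def pullback2_def)


section \<open>Charts\<close>

lemma is_chart_openin: "is_chart Y c \<Longrightarrow> openin Y (dom_chart c)"
  and is_chart_open: "is_chart Y c \<Longrightarrow> open (coord c ` dom_chart c)"
  by (simp_all add: is_chart_def)

lemma topspace_chart: "is_chart Y c \<Longrightarrow> topspace (subtopology Y (dom_chart c)) = dom_chart c"
  by (metis is_chart_openin openin_subset topspace_subtopology_subset)

lemma inv_chart_coord: "is_chart Y c \<Longrightarrow> x \<in> dom_chart c \<Longrightarrow> inv_chart c (coord c x) = x"
  by (metis homeomorphic_imp_injective_map inv_into_f_f is_chart_def topspace_chart)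

lemma coord_inv_chart: "z \<in> coord c ` dom_chart c \<Longrightarrow> coord c (inv_chart c z) = z"
  by (rule f_inv_into_f)

lemma inv_chart_in: "z \<in> coord c ` dom_chart c \<Longrightarrow> inv_chart c z \<in> dom_chart c"
  by (rule inv_into_into)

lemma coord_image_Int:
  assumes "is_chart Y c"
  shows "coord c ` (dom_chart c \<inter> N) = coord c ` dom_chart c \<inter> inv_chart c -` N"
  using inv_chart_coord[OF assms] by fastforce

lemma coord_in_image_iff:
  assumes "is_chart Y c" "x \<in> dom_chart c"
  shows "coord c x \<in> coord c ` (dom_chart c \<inter> N) \<longleftrightarrow> x \<in> N"
  using assms by (auto simp: coord_image_Int inv_chart_coord)

lemma chart_open_image:
  assumes "is_chart Y c" "openin Y N"
  shows "open (coord c ` (dom_chart c \<inter> N))"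
proof -
  have "open_map (subtopology Y (dom_chart c)) (top_of_set (coord c ` dom_chart c)) (coord c)"
    using assms(1) homeomorphic_imp_open_map by (auto simp: is_chart_def)
  moreover have "openin (subtopology Y (dom_chart c)) (dom_chart c \<inter> N)"
    using assms(2) openin_subtopology_Int2 by blast
  ultimately have "openin (top_of_set (coord c ` dom_chart c)) (coord c ` (dom_chart c \<inter> N))"
    by (simp add: open_map_def)
  then show ?thesis
    using openin_open_eq[OF is_chart_open[OF assms(1)]] by blast
qed

lemma chart_open_preimage:
  assumes "is_chart Y c" "open T"
  shows "openin Y (dom_chart c \<inter> coord c -` T)"
proof -
  have c: "continuous_map (subtopology Y (dom_chart c)) (top_of_set (coord c ` dom_chart c)) (coord c)"
    using assms(1) homeomorphic_imp_continuous_map by (auto simp: is_chart_def)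
  have "openin (top_of_set (coord c ` dom_chart c)) (coord c ` dom_chart c \<inter> T)"
    using assms(2) by (simp add: openin_open_Int)
  from openin_continuous_map_preimage[OF c this]
  have "openin (subtopology Y (dom_chart c)) {x \<in> dom_chart c. coord c x \<in> coord c ` dom_chart c \<inter> T}"
    by (simp only: topspace_chart[OF assms(1)])
  moreover have "{x \<in> dom_chart c. coord c x \<in> coord c ` dom_chart c \<inter> T} = dom_chart c \<inter> coord c -` T"
    by auto
  ultimately show ?thesis
    using openin_trans_full[OF _ is_chart_openin[OF assms(1)]] by simp
qed


section \<open>Smooth functions and maps on a complex manifold\<close>

locale cmanifold =
  fixes X :: "'a topology" and A :: "('a, 'm::finite) chart set"
  assumes complex_manifold: "complex_manifold X A"
begin

lemma chart: "c \<in> A \<Longrightarrow> is_chart X c"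
  using complex_manifold by (auto simp: complex_manifold_def)

lemma chart_at:
  assumes "x \<in> topspace X"
  obtains c where "c \<in> A" "x \<in> dom_chart c"
  using assms complex_manifold unfolding complex_manifold_def by blast

lemma holomorphic_transition:
  "c \<in> A \<Longrightarrow> d \<in> A \<Longrightarrow> holomorphic_map (\<lambda>z. coord d (inv_chart c z)) (overlap c d)"
  using complex_manifold by (auto simp: complex_manifold_def transition_def o_def)

lemma open_overlap: "c \<in> A \<Longrightarrow> openin X N \<Longrightarrow> open (coord c ` (dom_chart c \<inter> N))"
  using chart_open_image chart by blast

lemma smooth_transition:
  assumes "c \<in> A" "d \<in> A"
  shows "smooth_on (\<lambda>z. coord d (inv_chart c z)) (overlap c d)"
  using holomorphic_transition[OF assms] holomorphic_map_iff[OF open_overlap[OF assms(1) is_chart_openin[OF chart[OF assms(2)]]]]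
  by blast

text \<open>Openness of the domain is built in, since \<open>smooth_on\<close> is meant for open
  sets.\<close>

definition smooth_fun :: "('a \<Rightarrow> 'b::real_normed_vector) \<Rightarrow> 'a set \<Rightarrow> bool" where
  "smooth_fun f N \<longleftrightarrow> openin X N \<and> (\<forall>c\<in>A. smooth_on (\<lambda>z. f (inv_chart c z)) (coord c ` (dom_chart c \<inter> N)))"

text \<open>Smooth maps from an open set of a vector space into the manifold. The third clause is
  continuity; it makes the sets open on which the fourth reads the map in charts. Inverse charts of
  the total space and of the fibres are both of this kind.\<close>

definition smooth_par :: "('b::real_normed_vector \<Rightarrow> 'a) \<Rightarrow> 'b set \<Rightarrow> bool" where
  "smooth_par q S \<longleftrightarrow> open S \<and> q ` S \<subseteq> topspace X \<and> (\<forall>N. openin X N \<longrightarrow> open (S \<inter> q -` N)) \<and>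
     (\<forall>d\<in>A. smooth_on (\<lambda>z. coord d (q z)) (S \<inter> q -` dom_chart d))"

definition smooth_map :: "('a \<Rightarrow> 'a) \<Rightarrow> 'a set \<Rightarrow> bool" where
  "smooth_map r W \<longleftrightarrow> openin X W \<and>
     (\<forall>c\<in>A. smooth_par (\<lambda>z. r (inv_chart c z)) (coord c ` (dom_chart c \<inter> W)))"

text \<open>Smoothness is local, so near each parameter a chart around \<open>q x\<close> can be
  inserted between \<open>f\<close> and \<open>q\<close>.\<close>

lemma smooth_fun_par:
  assumes f: "smooth_fun f N" and q: "smooth_par q S"
  shows "smooth_on (\<lambda>z. f (q z)) (S \<inter> q -` N)"
proof (rule smooth_on_local)
  fix x assume x: "x \<in> S \<inter> q -` N"
  then obtain c where c: "c \<in> A" "q x \<in> dom_chart c"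
    using chart_at q unfolding smooth_par_def by blast
  let ?S = "S \<inter> q -` (dom_chart c \<inter> N)" and ?T = "coord c ` (dom_chart c \<inter> N)"
  have oN: "openin X (dom_chart c \<inter> N)"
    using f is_chart_openin[OF chart[OF c(1)]] by (auto simp: smooth_fun_def)
  have oS: "open ?S" using q oN by (auto simp: smooth_par_def)
  have "smooth_on (\<lambda>z. f (inv_chart c (coord c (q z)))) ?S"
  proof (rule smooth_on_compose[where T = ?T and f = "\<lambda>z. coord c (q z)", OF oS])
    show "open ?T" using open_overlap[OF c(1)] f by (auto simp: smooth_fun_def)
    show "smooth_on (\<lambda>z. coord c (q z)) ?S"
      using q c(1) smooth_on_subset[of "\<lambda>z. coord c (q z)" "S \<inter> q -` dom_chart c" ?S]
      by (auto simp: smooth_par_def)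
    show "smooth_on (\<lambda>z. f (inv_chart c z)) ?T" using f c(1) by (auto simp: smooth_fun_def)
  qed auto
  then have "smooth_on (\<lambda>z. f (q z)) ?S"
    by (rule smooth_on_cong[OF oS, rotated]) (auto simp: inv_chart_coord[OF chart[OF c(1)]])
  then show "\<exists>M. open M \<and> x \<in> M \<and> smooth_on (\<lambda>z. f (q z)) M"
    using x c(2) oS by (intro exI[of _ ?S]) auto
qed

lemma smooth_par_chart:
  assumes "c \<in> A" "openin X N"
  shows "smooth_par (inv_chart c) (coord c ` (dom_chart c \<inter> N))"
proof -
  have *: "coord c ` (dom_chart c \<inter> N) \<inter> inv_chart c -` M = coord c ` (dom_chart c \<inter> (N \<inter> M))" for M
    using coord_image_Int[OF chart[OF assms(1)]] by auto
  have "smooth_on (\<lambda>z. coord d (inv_chart c z)) (coord c ` (dom_chart c \<inter> (N \<inter> dom_chart d)))" if "d \<in> A" for d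
    by (rule smooth_on_subset[OF smooth_transition[OF assms(1) that]]) auto
  then show ?thesis
    unfolding smooth_par_def *
    using open_overlap[OF assms(1)] assms(2) inv_chart_coord[OF chart[OF assms(1)]] openin_subset[OF assms(2)]
    by (auto intro!: openin_Int)
qed

lemma smooth_fun_coord:
  assumes "d \<in> A"
  shows "smooth_fun (coord d) (dom_chart d)"
  using smooth_transition assms is_chart_openin[OF chart] by (auto simp: smooth_fun_def)

lemma smooth_fun_openin: "smooth_fun f N \<Longrightarrow> openin X N"
  by (simp add: smooth_fun_def)

lemma smooth_fun_subset:
  assumes "smooth_fun f N" "openin X N'" "N' \<subseteq> N"
  shows "smooth_fun f N'"
proof -
  have "smooth_on (\<lambda>z. f (inv_chart c z)) (coord c ` (dom_chart c \<inter> N'))" if "c \<in> A" for c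
    by (rule smooth_on_subset[of _ "coord c ` (dom_chart c \<inter> N)"]) (use assms that in \<open>auto simp: smooth_fun_def\<close>)
  then show ?thesis using assms(2) by (simp add: smooth_fun_def)
qed

lemma smooth_fun_compose:
  fixes f :: "'a \<Rightarrow> 'b::euclidean_space"
  assumes "smooth_fun f N" "open T" "smooth_on g T" "f ` N \<subseteq> T"
  shows "smooth_fun (\<lambda>x. g (f x)) N"
proof -
  have "smooth_on (\<lambda>z. g (f (inv_chart c z))) (coord c ` (dom_chart c \<inter> N))" if "c \<in> A" for c
  proof (rule smooth_on_compose[where T = T and f = "\<lambda>z. f (inv_chart c z)"])
    show "(\<lambda>z. f (inv_chart c z)) ` coord c ` (dom_chart c \<inter> N) \<subseteq> T"
      using inv_chart_coord[OF chart[OF that]] assms(4) by auto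
  qed (use assms that open_overlap in \<open>auto simp: smooth_fun_def\<close>)
  then show ?thesis using assms(1) by (simp add: smooth_fun_def)
qed

lemma smooth_fun_compose_linear:
  assumes "smooth_fun f N" "bounded_linear g"
  shows "smooth_fun (\<lambda>x. g (f x)) N"
  using assms smooth_on_compose_linear[OF assms(2) open_overlap] by (simp add: smooth_fun_def)

lemma smooth_fun_add:
  "smooth_fun f N \<Longrightarrow> smooth_fun g N \<Longrightarrow> smooth_fun (\<lambda>x. f x + g x) N"
  by (simp add: smooth_fun_def smooth_on_add open_overlap)

lemma smooth_fun_diff:
  "smooth_fun f N \<Longrightarrow> smooth_fun g N \<Longrightarrow> smooth_fun (\<lambda>x. f x - g x) N"
  by (simp add: smooth_fun_def smooth_on_diff open_overlap)

lemma smooth_fun_scaleR: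
  "smooth_fun f N \<Longrightarrow> smooth_fun g N \<Longrightarrow> smooth_fun (\<lambda>x. f x *\<^sub>R g x) N"
  by (simp add: smooth_fun_def smooth_on_scaleR open_overlap)

lemma openin_smooth_preimage:
  fixes f :: "'a \<Rightarrow> 'b::real_normed_vector"
  assumes "smooth_fun f N" "open T"
  shows "openin X (N \<inter> f -` T)"
proof (subst openin_subopen, intro ballI)
  fix x assume x: "x \<in> N \<inter> f -` T"
  then obtain c where c: "c \<in> A" "x \<in> dom_chart c"
    using chart_at smooth_fun_openin[OF assms(1)] openin_subset by blast
  let ?U = "coord c ` (dom_chart c \<inter> N)"
  let ?O = "?U \<inter> (\<lambda>z. f (inv_chart c z)) -` T"
  have "open ?O"
    using continuous_open_preimage[OF smooth_on_continuous open_overlap assms(2)] assms(1) c(1)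
    by (auto simp: smooth_fun_def)
  then have "openin X (dom_chart c \<inter> coord c -` ?O)"
    by (rule chart_open_preimage[OF chart[OF c(1)]])
  moreover have "x \<in> dom_chart c \<inter> coord c -` ?O"
    using x c inv_chart_coord[OF chart[OF c(1)]] by auto
  moreover have "dom_chart c \<inter> coord c -` ?O \<subseteq> N \<inter> f -` T"
  proof
    fix y assume y: "y \<in> dom_chart c \<inter> coord c -` ?O"
    then have d: "y \<in> dom_chart c" by blast
    show "y \<in> N \<inter> f -` T"
      using y by (simp add: coord_in_image_iff[OF chart[OF c(1)] d] inv_chart_coord[OF chart[OF c(1)] d])
  qed
  ultimately show "\<exists>M. openin X M \<and> x \<in> M \<and> M \<subseteq> N \<inter> f -` T" by blast
qed

lemma smooth_par_local:
  assumes "open S" "\<And>z. z \<in> S \<Longrightarrow> \<exists>S' q'. z \<in> S' \<and> S' \<subseteq> S \<and> smooth_par q' S' \<and> (\<forall>y\<in>S'. q y = q' y)"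
  shows "smooth_par q S"
proof -
  have "q z \<in> topspace X" if "z \<in> S" for z
    using assms(2)[OF that] unfolding smooth_par_def by fastforce
  moreover have "open (S \<inter> q -` N)" if "openin X N" for N
  proof (subst open_subopen, intro ballI)
    fix z assume z: "z \<in> S \<inter> q -` N"
    then obtain S' q' where S': "z \<in> S'" "S' \<subseteq> S" "smooth_par q' S'" "\<forall>y\<in>S'. q y = q' y"
      using assms(2) by blast
    have "open (S' \<inter> q' -` N)" using S'(3) that by (simp add: smooth_par_def)
    then show "\<exists>T. open T \<and> z \<in> T \<and> T \<subseteq> S \<inter> q -` N"
      using S' z by (intro exI[of _ "S' \<inter> q' -` N"]) auto
  qed
  moreover have "smooth_on (\<lambda>z. coord d (q z)) (S \<inter> q -` dom_chart d)" if "d \<in> A" for d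
  proof (rule smooth_on_local)
    fix z assume z: "z \<in> S \<inter> q -` dom_chart d"
    then obtain S' q' where S': "z \<in> S'" "S' \<subseteq> S" "smooth_par q' S'" "\<forall>y\<in>S'. q y = q' y"
      using assms(2) by blast
    let ?M = "S' \<inter> q' -` dom_chart d"
    have o: "open ?M" using S'(3) is_chart_openin[OF chart[OF that]] by (simp add: smooth_par_def)
    have "smooth_on (\<lambda>z. coord d (q' z)) ?M" using S'(3) that by (simp add: smooth_par_def)
    then have "smooth_on (\<lambda>z. coord d (q z)) ?M"
      by (rule smooth_on_cong[OF o, rotated]) (use S'(4) in auto)
    then show "\<exists>N. open N \<and> z \<in> N \<and> smooth_on (\<lambda>z. coord d (q z)) N"
      using o z S' by (intro exI[of _ ?M]) auto
  qed
  ultimately show ?thesis using assms(1) by (auto simp: smooth_par_def)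
qed

lemma smooth_par_subset:
  assumes "smooth_par q S" "open S'" "S' \<subseteq> S"
  shows "smooth_par q S'"
proof -
  have "S' \<inter> q -` N = S' \<inter> (S \<inter> q -` N)" for N using assms(3) by auto
  moreover have "smooth_on (\<lambda>z. coord d (q z)) (S' \<inter> q -` dom_chart d)" if "d \<in> A" for d
    by (rule smooth_on_subset[of _ "S \<inter> q -` dom_chart d"]) (use assms that in \<open>auto simp: smooth_par_def\<close>)
  ultimately show ?thesis
    using assms unfolding smooth_par_def by (metis (no_types, lifting) image_mono open_Int subset_trans)
qed

lemma smooth_par_compose:
  fixes f :: "'b::real_normed_vector \<Rightarrow> 'c::euclidean_space"
  assumes "smooth_par q T" "smooth_on f S" "open S" "f ` S \<subseteq> T"
  shows "smooth_par (\<lambda>z. q (f z)) S"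
proof -
  have *: "S \<inter> (\<lambda>z. q (f z)) -` N = S \<inter> f -` (T \<inter> q -` N)" for N using assms(4) by auto
  have o: "open (S \<inter> f -` (T \<inter> q -` N))" if "openin X N" for N
    using continuous_open_preimage[OF smooth_on_continuous[OF assms(2)] assms(3)] assms(1) that
    by (simp add: smooth_par_def del: vimage_Int)
  have "smooth_on (\<lambda>z. coord d (q (f z))) (S \<inter> f -` (T \<inter> q -` dom_chart d))" if "d \<in> A" for d
    by (rule smooth_on_compose[where T = "T \<inter> q -` dom_chart d" and f = f])
      (use o that assms is_chart_openin[OF chart[OF that]] in
        \<open>auto simp: smooth_par_def intro: smooth_on_subset[OF assms(2)]\<close>)
  then show ?thesis
    unfolding smooth_par_def * using assms(1,3,4) o by (auto simp: smooth_par_def simp del: vimage_Int) blast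
qed

section \<open>Smooth maps from open subsets of the manifold to itself\<close>

lemma smooth_map_openin: "smooth_map r W \<Longrightarrow> openin X W"
  by (simp add: smooth_map_def)

text \<open>Made for maps defined by cases, such as the glued retraction: it suffices that near each
  point a single smooth formula is valid.\<close>

lemma smooth_map_local:
  assumes "\<And>x. x \<in> W \<Longrightarrow> \<exists>W' r'. x \<in> W' \<and> W' \<subseteq> W \<and> smooth_map r' W' \<and> (\<forall>y\<in>W'. r y = r' y)"
  shows "smooth_map r W"
proof -
  have o: "openin X W"
    by (subst openin_subopen) (use assms smooth_map_openin in metis)
  have "smooth_par (\<lambda>z. r (inv_chart c z)) (coord c ` (dom_chart c \<inter> W))" if c: "c \<in> A" for c
  proof (rule smooth_par_local[OF open_overlap[OF c o]])
    fix z assume z: "z \<in> coord c ` (dom_chart c \<inter> W)"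
    then have "inv_chart c z \<in> W" using inv_chart_coord[OF chart[OF c]] by auto
    then obtain W' r' where W': "inv_chart c z \<in> W'" "W' \<subseteq> W" "smooth_map r' W'" "\<forall>y\<in>W'. r y = r' y"
      using assms by blast
    have "z \<in> coord c ` (dom_chart c \<inter> W')"
      using z W'(1) by (auto simp: coord_image_Int[OF chart[OF c]])
    moreover have "\<forall>y\<in>coord c ` (dom_chart c \<inter> W'). r (inv_chart c y) = r' (inv_chart c y)"
      using W'(4) inv_chart_coord[OF chart[OF c]] by auto
    moreover have "coord c ` (dom_chart c \<inter> W') \<subseteq> coord c ` (dom_chart c \<inter> W)" using W'(2) by auto
    moreover have "smooth_par (\<lambda>z. r' (inv_chart c z)) (coord c ` (dom_chart c \<inter> W'))"
      using W'(3) c by (simp add: smooth_map_def)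
    ultimately show "\<exists>S' q'. z \<in> S' \<and> S' \<subseteq> coord c ` (dom_chart c \<inter> W) \<and> smooth_par q' S' \<and>
        (\<forall>y\<in>S'. r (inv_chart c y) = q' y)"
      by (intro exI[of _ "coord c ` (dom_chart c \<inter> W')"] exI[of _ "\<lambda>z. r' (inv_chart c z)"]) simp
  qed
  then show ?thesis using o by (simp add: smooth_map_def)
qed

lemma smooth_map_subset:
  assumes "smooth_map r W" "openin X W'" "W' \<subseteq> W"
  shows "smooth_map r W'"
proof -
  have "smooth_par (\<lambda>z. r (inv_chart c z)) (coord c ` (dom_chart c \<inter> W'))" if "c \<in> A" for c
    by (rule smooth_par_subset[of _ "coord c ` (dom_chart c \<inter> W)"])
      (use assms that open_overlap in \<open>auto simp: smooth_map_def\<close>)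
  then show ?thesis using assms(2) by (simp add: smooth_map_def)
qed

lemma openin_smooth_map_preimage:
  assumes "smooth_map r W" "openin X N"
  shows "openin X (W \<inter> r -` N)"
proof (subst openin_subopen, intro ballI)
  fix x assume x: "x \<in> W \<inter> r -` N"
  then obtain c where c: "c \<in> A" "x \<in> dom_chart c"
    using chart_at smooth_map_openin[OF assms(1)] openin_subset by blast
  let ?O = "coord c ` (dom_chart c \<inter> W) \<inter> (\<lambda>z. r (inv_chart c z)) -` N"
  have "open ?O" using assms c(1) by (simp add: smooth_map_def smooth_par_def)
  then have "openin X (dom_chart c \<inter> coord c -` ?O)"
    by (rule chart_open_preimage[OF chart[OF c(1)]])
  moreover have "x \<in> dom_chart c \<inter> coord c -` ?O"
    using x c inv_chart_coord[OF chart[OF c(1)]] by auto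
  moreover have "dom_chart c \<inter> coord c -` ?O \<subseteq> W \<inter> r -` N"
  proof
    fix y assume y: "y \<in> dom_chart c \<inter> coord c -` ?O"
    then have d: "y \<in> dom_chart c" by blast
    show "y \<in> W \<inter> r -` N"
      using y by (simp add: coord_in_image_iff[OF chart[OF c(1)] d] inv_chart_coord[OF chart[OF c(1)] d])
  qed
  ultimately show "\<exists>M. openin X M \<and> x \<in> M \<and> M \<subseteq> W \<inter> r -` N" by blast
qed

lemma smooth_map_range: "smooth_map r W \<Longrightarrow> x \<in> W \<Longrightarrow> r x \<in> topspace X"
proof -
  assume r: "smooth_map r W" and x: "x \<in> W"
  then obtain c where c: "c \<in> A" "x \<in> dom_chart c"
    using chart_at smooth_map_openin[OF r] openin_subset by blast
  then have "coord c x \<in> coord c ` (dom_chart c \<inter> W)" using x by auto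
  then have "r (inv_chart c (coord c x)) \<in> topspace X"
    using r c(1) unfolding smooth_map_def smooth_par_def by blast
  then show ?thesis using inv_chart_coord[OF chart[OF c(1)] c(2)] by simp
qed

lemma smooth_fun_map:
  assumes "smooth_fun f N" "smooth_map r W"
  shows "smooth_fun (\<lambda>x. f (r x)) (W \<inter> r -` N)"
proof -
  have o: "openin X (W \<inter> r -` N)"
    using openin_smooth_map_preimage[OF assms(2) smooth_fun_openin[OF assms(1)]] .
  have "smooth_on (\<lambda>z. f (r (inv_chart c z))) (coord c ` (dom_chart c \<inter> (W \<inter> r -` N)))" if c: "c \<in> A" for c
  proof -
    have "smooth_par (\<lambda>z. r (inv_chart c z)) (coord c ` (dom_chart c \<inter> W))"
      using assms(2) c by (simp add: smooth_map_def)
    from smooth_fun_par[OF assms(1) this]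
    show ?thesis
      by (rule smooth_on_subset) (auto simp: coord_image_Int[OF chart[OF c]])
  qed
  then show ?thesis using o by (simp add: smooth_fun_def)
qed

lemma smooth_map_par_fun:
  fixes F :: "'a \<Rightarrow> 'b::euclidean_space"
  assumes "smooth_par q S" "smooth_fun F N" "F ` N \<subseteq> S"
  shows "smooth_map (\<lambda>x. q (F x)) N"
proof -
  have "smooth_par (\<lambda>z. q (F (inv_chart c z))) (coord c ` (dom_chart c \<inter> N))" if c: "c \<in> A" for c
    by (rule smooth_par_compose[OF assms(1)])
      (use assms c open_overlap inv_chart_coord[OF chart[OF c]] in \<open>auto simp: smooth_fun_def\<close>)
  then show ?thesis using assms(2) by (simp add: smooth_map_def smooth_fun_def)
qed

text \<open>A coordinate system of the maximal atlas, with image a ball, in which \<open>\<pi>\<close> is the \<open>k\<close>-th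
  coordinate; \<open>\<phi>\<close> is the inverse of \<open>\<psi>\<close>.\<close>

definition slice_chart ::
  "('a \<Rightarrow> complex) \<Rightarrow> 'a set \<Rightarrow> ('a \<Rightarrow> complex^'m) \<Rightarrow> (complex^'m \<Rightarrow> 'a) \<Rightarrow> complex^'m \<Rightarrow> real \<Rightarrow> 'm \<Rightarrow> bool" where
  "slice_chart \<pi> U \<psi> \<phi> a R k \<longleftrightarrow> 0 < R \<and> smooth_fun \<psi> U \<and> smooth_par \<phi> (ball a R) \<and>
     \<psi> ` U \<subseteq> ball a R \<and> \<phi> ` ball a R \<subseteq> U \<and> (\<forall>x\<in>U. \<phi> (\<psi> x) = x) \<and> (\<forall>z\<in>ball a R. \<psi> (\<phi> z) = z) \<and>
     (\<forall>x\<in>U. \<psi> x $ k = \<pi> x) \<and>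
     (\<forall>d\<in>A. holomorphic_map (\<lambda>z. coord d (\<phi> z)) (ball a R \<inter> \<phi> -` dom_chart d))"

text \<open>A chart around \<open>p\<close> is followed by the hypersurface coordinates of \<pi> as
  read in that chart. The range is cut down to a ball because its convexity is what later permits
  averaging.\<close>

lemma slice_chart_exists:
  assumes \<pi>: "holomorphic_submersion A \<pi>" and p: "p \<in> topspace X"
  obtains U \<psi> \<phi> R k where "slice_chart \<pi> U \<psi> \<phi> (\<psi> p) R k" "p \<in> U"
proof -
  obtain c where c: "c \<in> A" "p \<in> dom_chart c" using chart_at[OF p] by blast
  note ch = chart[OF c(1)]
  let ?S = "coord c ` dom_chart c"
  have pin: "coord c p \<in> ?S" using c(2) by blast
  have h: "holomorphic_fun (\<pi> \<circ> inv_chart c) ?S" "surj (frechet_derivative (\<pi> \<circ> inv_chart c) (at (coord c p)))"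
    using \<pi> c(1) pin unfolding holomorphic_submersion_def by blast+
  obtain k V and T :: "(complex^'m) set" and \<Psi> G where V: "open V" "coord c p \<in> V" "V \<subseteq> ?S" "open T" "homeomorphism V T \<Psi> G"
    and hol: "holomorphic_map \<Psi> V" "holomorphic_map G T" and k: "\<forall>z. \<Psi> z $ k = (\<pi> \<circ> inv_chart c) z"
    by (rule hypersurface_coordinates[OF is_chart_open[OF ch] pin h]) (rule that)
  have smPG: "smooth_on \<Psi> V" "smooth_on G T" using hol holomorphic_map_iff V(1,4) by blast+
  have hom: "\<Psi> z \<in> T" "G (\<Psi> z) = z" if "z \<in> V" for z
    using V(5) that by (auto simp: homeomorphism_def)
  have hom': "G y \<in> V" "\<Psi> (G y) = y" if "y \<in> T" for y
    using V(5) that by (auto simp: homeomorphism_def)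
  define \<psi> where "\<psi> x = \<Psi> (coord c x)" for x
  define \<phi> where "\<phi> y = inv_chart c (G y)" for y
  obtain R where R: "R > 0" "ball (\<psi> p) R \<subseteq> T"
    using V(2,4) hom(1) unfolding \<psi>_def by (meson open_contains_ball)
  let ?B = "ball (\<psi> p) R"
  define N where "N = dom_chart c \<inter> coord c -` V"
  have oN: "openin X N" unfolding N_def by (rule chart_open_preimage[OF ch V(1)])
  have smc: "smooth_fun (coord c) N"
    by (rule smooth_fun_subset[OF smooth_fun_coord[OF c(1)] oN]) (auto simp: N_def)
  have sm\<psi>N: "smooth_fun \<psi> N"
    unfolding \<psi>_def[abs_def] by (rule smooth_fun_compose[OF smc V(1) smPG(1)]) (auto simp: N_def)
  define U where "U = N \<inter> \<psi> -` ?B"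
  have oU: "openin X U" unfolding U_def by (rule openin_smooth_preimage[OF sm\<psi>N open_ball])
  have GS: "G y \<in> ?S" if "y \<in> ?B" for y using R(2) that hom'(1) V(3) by blast
  have c\<phi>: "coord c (\<phi> y) = G y" "\<phi> y \<in> dom_chart c" if "y \<in> ?B" for y
    unfolding \<phi>_def using coord_inv_chart[OF GS[OF that]] inv_chart_in[OF GS[OF that]] by auto
  have GB: "smooth_on G ?B" using smooth_on_subset[OF smPG(2) R(2)] .
  have par: "smooth_par \<phi> ?B"
    unfolding \<phi>_def[abs_def]
    by (rule smooth_par_compose[OF smooth_par_chart[OF c(1) openin_topspace] GB open_ball])
      (use GS openin_subset[OF is_chart_openin[OF ch]] in \<open>simp add: Int_absorb2 image_subset_iff\<close>)
  have "holomorphic_map (\<lambda>z. coord d (\<phi> z)) (?B \<inter> \<phi> -` dom_chart d)" if d: "d \<in> A" for d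
    unfolding \<phi>_def
  proof (rule holomorphic_map_compose[OF _ _ _ _ holomorphic_transition[OF c(1) d]])
    show o: "open (?B \<inter> (\<lambda>y. inv_chart c (G y)) -` dom_chart d)"
      using par is_chart_openin[OF chart[OF d]] by (auto simp: smooth_par_def \<phi>_def[abs_def])
    show "open (overlap c d)" by (rule open_overlap[OF c(1) is_chart_openin[OF chart[OF d]]])
    show "G ` (?B \<inter> (\<lambda>y. inv_chart c (G y)) -` dom_chart d) \<subseteq> overlap c d"
      using GS by (auto simp: coord_image_Int[OF ch])
    show "holomorphic_map G (?B \<inter> (\<lambda>y. inv_chart c (G y)) -` dom_chart d)"
    proof -
      have "?B \<inter> (\<lambda>y. inv_chart c (G y)) -` dom_chart d \<subseteq> T" using R(2) by auto
      then show ?thesis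
        using hol(2) unfolding holomorphic_map_iff[OF o] holomorphic_map_iff[OF V(4)]
        by (meson smooth_on_subset subsetD)
    qed
  qed
  then have "slice_chart \<pi> U \<psi> \<phi> (\<psi> p) R k"
    unfolding slice_chart_def
    using R(1) smooth_fun_subset[OF sm\<psi>N oU] par
  proof (intro conjI ballI)
    show "\<psi> ` U \<subseteq> ?B" by (auto simp: U_def)
    show "\<psi> (\<phi> y) = y" if "y \<in> ?B" for y
      unfolding \<psi>_def c\<phi>(1)[OF that] using hom'(2) R(2) that by auto
    then show "\<phi> ` ?B \<subseteq> U"
      using c\<phi> hom'(1) R(2) by (auto simp: U_def N_def)
    show "\<phi> (\<psi> x) = x" if "x \<in> U" for x
      using that hom(2) inv_chart_coord[OF ch] by (simp add: U_def N_def \<psi>_def \<phi>_def)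
    show "\<psi> x $ k = \<pi> x" if "x \<in> U" for x
      using that inv_chart_coord[OF ch] by (simp add: U_def N_def \<psi>_def k)
  qed (auto simp: U_def)
  moreover have "p \<in> U" using c(2) V(2) R(1) by (auto simp: U_def N_def)
  ultimately show ?thesis using that by blast
qed

end


section \<open>A smooth retraction onto the central fibre\<close>

context cmanifold
begin

lemma continuous_map_smooth_par: "smooth_par q S \<Longrightarrow> continuous_map (top_of_set S) X q"
  unfolding smooth_par_def continuous_map_def
  by (auto simp: openin_open Int_def vimage_def)

lemma continuous_map_smooth_fun:
  assumes "smooth_fun f N"
  shows "continuous_map (subtopology X N) euclidean f"
proof -
  have N: "topspace (subtopology X N) = N"
    by (rule topspace_subtopology_subset[OF openin_subset[OF smooth_fun_openin[OF assms]]])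
  have "openin (subtopology X N) {x \<in> N. f x \<in> T}" if "open T" for T
  proof -
    have "{x \<in> N. f x \<in> T} = N \<inter> (N \<inter> f -` T)" by auto
    then show ?thesis
      using openin_subtopology_Int2[OF openin_smooth_preimage[OF assms that], of N] by (simp only:)
  qed
  then show ?thesis by (simp add: continuous_map_def N del: topspace_subtopology)
qed

text \<open>\<open>W\<close> may be any open set, even the empty one: partial retractions are what
  the compactness argument enlarges step by step.\<close>

definition smooth_retraction :: "('a \<Rightarrow> complex) \<Rightarrow> ('a \<Rightarrow> 'a) \<Rightarrow> 'a set \<Rightarrow> bool" where
  "smooth_retraction \<pi> r W \<longleftrightarrow> smooth_map r W \<and> (\<forall>x\<in>W. \<pi> (r x) = 0) \<and> (\<forall>x\<in>W. \<pi> x = 0 \<longrightarrow> r x = x)"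

text \<open>Inside the coordinate ball the fibre is the linear slice \<open>z\<^sub>k = 0\<close>, so two retractions can be
  interpolated by convex combinations of coordinates.\<close>

lemma smooth_retraction_extend:
  assumes r: "smooth_retraction \<pi> r W" and sl: "slice_chart \<pi> U \<psi> \<phi> a R k"
    and ak: "a $ k = 0" and s: "0 < s" "s < R"
  shows "\<exists>r' W'. smooth_retraction \<pi> r' W' \<and> {x \<in> W. \<pi> x = 0} \<subseteq> W' \<and> U \<inter> \<psi> -` ball a s \<subseteq> W'"
proof -
  have sm\<psi>: "smooth_fun \<psi> U" and par: "smooth_par \<phi> (ball a R)"
    and \<psi>B: "\<And>x. x \<in> U \<Longrightarrow> \<psi> x \<in> ball a R" and \<phi>U: "\<And>z. z \<in> ball a R \<Longrightarrow> \<phi> z \<in> U"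
    and \<phi>\<psi>: "\<And>x. x \<in> U \<Longrightarrow> \<phi> (\<psi> x) = x" and \<psi>\<phi>: "\<And>z. z \<in> ball a R \<Longrightarrow> \<psi> (\<phi> z) = z"
    and \<psi>k: "\<And>x. x \<in> U \<Longrightarrow> \<psi> x $ k = \<pi> x"
    using sl by (auto simp: slice_chart_def)
  have smr: "smooth_map r W" and r0: "\<And>x. x \<in> W \<Longrightarrow> \<pi> (r x) = 0"
    and rid: "\<And>x. x \<in> W \<Longrightarrow> \<pi> x = 0 \<Longrightarrow> r x = x"
    using r by (auto simp: smooth_retraction_def)
  have oU: "openin X U" and oW: "openin X W"
    by (rule smooth_fun_openin[OF sm\<psi>], rule smooth_map_openin[OF smr])
  \<comment> \<open>A radius strictly between \<open>s\<close> and \<open>R\<close>: the bump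
    function vanishes outside radius \<open>s'\<close>, whose closed ball still lies in the
    coordinate range.\<close>
  define s' where "s' = (s + R) / 2"
  have s': "s < s'" "s' < R" using s by (auto simp: s'_def)
  obtain h :: "complex^'m \<Rightarrow> real" where smh: "smooth_on h UNIV" and h01: "\<And>x. 0 \<le> h x \<and> h x \<le> 1"
    and h1: "\<And>x. x \<in> ball a s \<Longrightarrow> h x = 1" and h0: "\<And>x. x \<notin> ball a s' \<Longrightarrow> h x = 0"
    by (rule smooth_bump[OF s(1) s'(1), of a]) (rule that)
  \<comment> \<open>Compact as an image of a closed ball, hence closed in the Hausdorff space
    \<open>X\<close>; so \<open>W - K\<close>, where the old retraction is kept, is open.\<close>
  define K where "K = \<phi> ` cball a s'"
  have cb: "cball a s' \<subseteq> ball a R" using s'(2) by auto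
  have "compactin X K"
    unfolding K_def
    by (rule image_compactin[OF _ continuous_map_smooth_par[OF par]]) (use cb in \<open>simp add: compactin_subtopology\<close>)
  then have clK: "closedin X K"
    using compactin_imp_closedin[of X K] complex_manifold by (simp add: complex_manifold_def)
  have KU: "K \<subseteq> U" using cb \<phi>U by (auto simp: K_def)
  \<comment> \<open>Projection to the slice \<open>z $ k = 0\<close>. It does not increase the
    distance to \<open>a\<close>, which lies in the slice, so it preserves the ball.\<close>
  define P where "P z = z - (z $ k) *s (axis k 1)" for z :: "complex^'m"
  have blP: "bounded_linear P"
    unfolding P_def[abs_def]
    by (intro bounded_linear_sub bounded_linear_ident
        bounded_linear_compose[OF bounded_linear_scale_axis bounded_linear_vec_nth])
  have Pk: "P z $ k = 0" for z by (simp add: P_def)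
  have Pid: "P z = z" if "z $ k = 0" for z using that by (simp add: P_def)
  have PB: "P z \<in> ball a R" if "z \<in> ball a R" for z
  proof -
    have "P z - a = P (z - a)"
      using linear_diff[OF bounded_linear.linear[OF blP]] Pid[OF ak] by simp
    moreover have "norm (P v) \<le> norm v" for v
      unfolding norm_vec_def by (rule L2_set_mono) (auto simp: P_def axis_def)
    ultimately have "norm (P z - a) \<le> norm (z - a)" by metis
    then show ?thesis using that by (simp add: dist_norm norm_minus_commute)
  qed
  define V where "V = U \<inter> \<psi> -` ball a s"
  \<comment> \<open>Averaging needs coordinates of both \<open>x\<close> and \<open>r x\<close>.
    Points of \<open>W \<inter> U\<close> on the central fibre qualify, being fixed by
    \<open>r\<close>.\<close>
  define Wb where "Wb = (W \<inter> r -` U) \<inter> U"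
  define F where "F x = (1 - h (\<psi> x)) *\<^sub>R \<psi> (r x) + h (\<psi> x) *\<^sub>R P (\<psi> x)" for x
  \<comment> \<open>On \<open>V\<close>, which need not lie in \<open>W\<close>, the weight
    \<open>h\<close> is 1 and \<open>r\<close> drops out of \<open>F\<close>; outside
    \<open>K\<close> the weight is 0 and \<open>r\<close> alone remains. Hence the three formulas
    agree where the open sets \<open>V\<close>, \<open>W - K\<close> and \<open>Wb\<close>
    meet.\<close>
  define r' where "r' x = (if x \<in> V then \<phi> (P (\<psi> x)) else if x \<in> K then \<phi> (F x) else r x)" for x
  define W' where "W' = V \<union> (W - K) \<union> Wb"
  have oV: "openin X V" unfolding V_def by (rule openin_smooth_preimage[OF sm\<psi> open_ball])
  have VK: "V \<subseteq> K"
  proof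
    fix x assume "x \<in> V"
    then have "\<psi> x \<in> cball a s'" "\<phi> (\<psi> x) = x" using s'(1) \<phi>\<psi> by (auto simp: V_def)
    then show "x \<in> K" unfolding K_def by (metis imageI)
  qed
  have oWb: "openin X Wb"
    unfolding Wb_def using openin_smooth_map_preimage[OF smr oU] oU by blast
  have FB: "F x \<in> ball a R" if "x \<in> Wb" for x
    unfolding F_def using that h01[of "\<psi> x"]
    by (intro convexD[OF convex_ball]) (auto simp: Wb_def intro: \<psi>B PB simp del: mem_ball)
  have smP\<psi>: "smooth_fun (\<lambda>x. P (\<psi> x)) U"
    by (rule smooth_fun_compose_linear[OF sm\<psi> blP])
  have smh\<psi>: "smooth_fun (\<lambda>x. h (\<psi> x)) U"
    by (rule smooth_fun_compose[OF sm\<psi> open_UNIV smh]) auto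
  have one: "smooth_fun (\<lambda>x. 1 :: real) U"
    by (rule smooth_fun_compose[OF sm\<psi> open_UNIV smooth_on_const]) auto
  have smF: "smooth_fun F Wb"
    unfolding F_def[abs_def]
    by (intro smooth_fun_add smooth_fun_scaleR smooth_fun_diff
        smooth_fun_subset[OF one oWb] smooth_fun_subset[OF smh\<psi> oWb] smooth_fun_subset[OF smP\<psi> oWb]
        smooth_fun_subset[OF smooth_fun_map[OF sm\<psi> smr] oWb]) (auto simp: Wb_def)
  have r'V: "r' x = \<phi> (P (\<psi> x))" if "x \<in> V" for x using that by (simp add: r'_def)
  have r'W: "r' x = r x" if "x \<in> W - K" for x using that VK by (auto simp: r'_def)
  have r'Wb: "r' x = \<phi> (F x)" if x: "x \<in> Wb" for x
  proof -
    consider "x \<in> V" | "x \<notin> V" "x \<in> K" | "x \<notin> V" "x \<notin> K" by blast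
    then show ?thesis
    proof cases
      case 1
      then show ?thesis using h1[of "\<psi> x"] by (simp add: r'_def F_def V_def)
    next
      case 3
      have "\<psi> x \<notin> cball a s'"
        using 3 x \<phi>\<psi> unfolding K_def Wb_def by (metis Int_iff imageI)
      then have "h (\<psi> x) = 0" using h0[of "\<psi> x"] by auto
      then show ?thesis using 3 x by (simp add: r'_def F_def Wb_def \<phi>\<psi>)
    qed (simp add: r'_def)
  qed
  have "smooth_map r' W'"
  proof (rule smooth_map_local)
    fix x assume "x \<in> W'"
    then consider "x \<in> V" | "x \<in> W - K" | "x \<in> Wb" by (auto simp: W'_def)
    then show "\<exists>N q. x \<in> N \<and> N \<subseteq> W' \<and> smooth_map q N \<and> (\<forall>y\<in>N. r' y = q y)"
    proof cases
      case 1
      have "smooth_map (\<lambda>x. \<phi> (P (\<psi> x))) V"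
        by (rule smooth_map_par_fun[OF par smooth_fun_subset[OF smP\<psi> oV]]) (auto simp: V_def simp del: mem_ball intro: PB \<psi>B)
      then show ?thesis
        using 1 r'V by (intro exI[of _ V] exI[of _ "\<lambda>x. \<phi> (P (\<psi> x))"]) (auto simp: W'_def)
    next
      case 2
      have "smooth_map r (W - K)"
        by (rule smooth_map_subset[OF smr]) (use oW clK in \<open>auto intro: openin_diff\<close>)
      then show ?thesis
        using 2 r'W by (intro exI[of _ "W - K"] exI[of _ r]) (auto simp: W'_def)
    next
      case 3
      have "smooth_map (\<lambda>x. \<phi> (F x)) Wb"
        by (rule smooth_map_par_fun[OF par smF]) (use FB in blast)
      then show ?thesis
        using 3 r'Wb by (intro exI[of _ Wb] exI[of _ "\<lambda>x. \<phi> (F x)"]) (auto simp: W'_def)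
    qed
  qed
  moreover have "\<pi> (r' x) = 0 \<and> (\<pi> x = 0 \<longrightarrow> r' x = x)" if xW: "x \<in> W'" for x
  proof -
    have sl0: "\<pi> (\<phi> z) = 0" if "z \<in> ball a R" "z $ k = 0" for z
      using \<psi>k[OF \<phi>U[OF that(1)]] \<psi>\<phi>[OF that(1)] that(2) by simp
    consider "x \<in> V" | "x \<in> W - K" | "x \<in> Wb" using xW by (auto simp: W'_def)
    then show ?thesis
    proof cases
      case 1
      then have x: "x \<in> U" by (simp add: V_def)
      show ?thesis
        unfolding r'V[OF 1] using sl0[OF PB[OF \<psi>B[OF x]] Pk] Pid[of "\<psi> x"] \<psi>k[OF x] \<phi>\<psi>[OF x] by simp
    next
      case 2
      then show ?thesis using r'W[OF 2] r0 rid by auto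
    next
      case 3
      then have x: "x \<in> U" "x \<in> W" "r x \<in> U" by (auto simp: Wb_def)
      have "F x $ k = 0"
        using \<psi>k[OF x(3)] r0[OF x(2)] by (simp add: F_def Pk)
      moreover have "F x = \<psi> x" if "\<pi> x = 0"
        using rid[OF x(2) that] Pid[of "\<psi> x"] \<psi>k[OF x(1)] that by (simp add: F_def algebra_simps)
      ultimately show ?thesis
        unfolding r'Wb[OF 3] using sl0[OF FB[OF 3]] \<phi>\<psi>[OF x(1)] by simp
    qed
  qed
  ultimately have "smooth_retraction \<pi> r' W'" by (simp add: smooth_retraction_def)
  \<comment> \<open>A point of \<open>W\<close> on the central fibre either avoids \<open>K\<close>
    or lies in \<open>K \<subseteq> U\<close> and is fixed by \<open>r\<close>, hence lies in
    \<open>Wb\<close>.\<close>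
  moreover have "{x \<in> W. \<pi> x = 0} \<subseteq> W'"
    using rid KU by (auto simp: W'_def Wb_def)
  moreover have "U \<inter> \<psi> -` ball a s \<subseteq> W'" by (auto simp: W'_def V_def)
  ultimately show ?thesis by blast
qed

text \<open>Finitely many extension steps exhaust the compact fibre. A step may shrink the domain
  away from the fibre, so the induction tracks only points with \<open>\<pi> x = 0\<close>.\<close>

lemma smooth_retraction_exists:
  assumes \<pi>: "holomorphic_submersion A \<pi>" and cpt: "compactin X {x \<in> topspace X. \<pi> x = 0}"
  obtains r W where "smooth_retraction \<pi> r W" "{x \<in> topspace X. \<pi> x = 0} \<subseteq> W"
proof -
  let ?M = "{x \<in> topspace X. \<pi> x = 0}"
  \<comment> \<open>Open sets that can be added to the domain of every partial retraction; the
    quantifier over all retractions makes membership usable at any stage of the finite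
    induction.\<close>
  define \<C> where "\<C> = {C. openin X C \<and> (\<forall>r W. smooth_retraction \<pi> r W \<longrightarrow>
     (\<exists>r' W'. smooth_retraction \<pi> r' W' \<and> {x \<in> W. \<pi> x = 0} \<union> C \<subseteq> W'))}"
  have "\<exists>C\<in>\<C>. p \<in> C" if p: "p \<in> ?M" for p
  proof -
    obtain U \<psi> \<phi> R k where sl: "slice_chart \<pi> U \<psi> \<phi> (\<psi> p) R k" "p \<in> U"
      using slice_chart_exists[OF \<pi>] p by blast
    have ak: "\<psi> p $ k = 0" and R: "0 < R / 2" "R / 2 < R" and sm: "smooth_fun \<psi> U"
      using sl p by (auto simp: slice_chart_def)
    let ?C = "U \<inter> \<psi> -` ball (\<psi> p) (R / 2)"
    have "openin X ?C" by (rule openin_smooth_preimage[OF sm open_ball])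
    then have "?C \<in> \<C>"
      unfolding \<C>_def using smooth_retraction_extend[OF _ sl(1) ak R] by auto
    moreover have "p \<in> ?C" using sl(2) R by simp
    ultimately show ?thesis by (rule rev_bexI)
  qed
  then have "?M \<subseteq> \<Union>\<C>" by (meson UnionI subsetI)
  moreover have "\<forall>C\<in>\<C>. openin X C" by (simp add: \<C>_def)
  ultimately obtain \<F> where \<F>: "finite \<F>" "\<F> \<subseteq> \<C>" "?M \<subseteq> \<Union>\<F>"
    using compactinD[OF cpt, of \<C>] by auto
  have "\<exists>r W. smooth_retraction \<pi> r W \<and> {x \<in> \<Union>\<F>. \<pi> x = 0} \<subseteq> W"
    using \<F>(1,2)
  proof (induction \<F>)
    case empty
    have e: "smooth_on (\<lambda>z. coord d (inv_chart c z)) {}" for c d :: "('a, 'm) chart"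
      by (rule smooth_on_local) simp
    have "smooth_retraction \<pi> (\<lambda>x. x) {}"
      by (simp add: smooth_retraction_def smooth_map_def smooth_par_def e)
    then show ?case by (intro exI[of _ "\<lambda>x. x"] exI[of _ "{}"]) simp
  next
    case (insert C \<F>)
    then obtain r W where r: "smooth_retraction \<pi> r W" "{x \<in> \<Union>\<F>. \<pi> x = 0} \<subseteq> W" by auto
    have "C \<in> \<C>" using insert.prems by simp
    then have "\<exists>r' W'. smooth_retraction \<pi> r' W' \<and> {x \<in> W. \<pi> x = 0} \<union> C \<subseteq> W'"
      using r(1) by (simp only: \<C>_def mem_Collect_eq)
    then obtain r' W' where "smooth_retraction \<pi> r' W'" "{x \<in> W. \<pi> x = 0} \<union> C \<subseteq> W'"
      by (elim exE conjE)
    then show ?case using r(2) by (intro exI[of _ r'] exI[of _ W']) auto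
  qed
  then obtain r W where r: "smooth_retraction \<pi> r W" "{x \<in> \<Union>\<F>. \<pi> x = 0} \<subseteq> W" by (elim exE conjE)
  have "?M \<subseteq> {x \<in> \<Union>\<F>. \<pi> x = 0}" using \<F>(3) by (auto dest: subsetD)
  then have "?M \<subseteq> W" using r(2) by (rule subset_trans)
  then show ?thesis by (rule that[OF r(1)])
qed

text \<open>On the central fibre the entry \<open>k\<close> of slice coordinates is constantly zero;
  dropping it gives a chart. The same formula is defined and smooth on the open set \<open>U\<close>
  of the total space, the extension needed for composing with a retraction.\<close>

lemma fibre_chart_exists:
  assumes \<pi>: "holomorphic_submersion A \<pi>" and card: "CARD('m) = CARD('n::finite) + 1"
    and p: "p \<in> topspace X" "\<pi> p = 0"
  shows "\<exists>e\<in>(fibre_atlas X A \<pi> 0 :: ('a, 'n) chart set).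
     p \<in> dom_chart e \<and> (\<exists>U. dom_chart e = U \<inter> {x. \<pi> x = 0} \<and> smooth_fun (coord e) U)"
proof -
  obtain U \<psi> \<phi> R k where sl: "slice_chart \<pi> U \<psi> \<phi> (\<psi> p) R k" "p \<in> U"
    using slice_chart_exists[OF \<pi> p(1)] by blast
  define B where "B = ball (\<psi> p) R"
  have sm\<psi>: "smooth_fun \<psi> U" and par: "smooth_par \<phi> B" and oB: "open B"
    and \<psi>B: "\<And>x. x \<in> U \<Longrightarrow> \<psi> x \<in> B" and \<phi>U: "\<And>z. z \<in> B \<Longrightarrow> \<phi> z \<in> U"
    and \<phi>\<psi>: "\<And>x. x \<in> U \<Longrightarrow> \<phi> (\<psi> x) = x" and \<psi>\<phi>: "\<And>z. z \<in> B \<Longrightarrow> \<psi> (\<phi> z) = z"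
    and \<psi>k: "\<And>x. x \<in> U \<Longrightarrow> \<psi> x $ k = \<pi> x"
    and hol: "\<And>d. d \<in> A \<Longrightarrow> holomorphic_map (\<lambda>z. coord d (\<phi> z)) (B \<inter> \<phi> -` dom_chart d)"
    using sl by (auto simp: slice_chart_def B_def)
  have oU: "openin X U" by (rule smooth_fun_openin[OF sm\<psi>])
  \<comment> \<open>\<tau> numbers the entries other than \<open>k\<close> by the index type of the
    fibre; the cardinality hypothesis provides it.\<close>
  obtain \<tau> :: "'n \<Rightarrow> 'm" where \<tau>: "bij_betw \<tau> UNIV (UNIV - {k})"
  proof -
    have "card (UNIV :: 'n set) = card (UNIV - {k} :: 'm set)" using card by simp
    from finite_same_card_bij[OF finite finite this] show ?thesis using that by blast
  qed
  have \<tau>k: "\<tau> j \<noteq> k" for j using \<tau> by (auto simp: bij_betw_def)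
  have inj\<tau>: "inj \<tau>" using \<tau> by (simp add: bij_betw_def)
  define \<sigma> :: "complex^'m \<Rightarrow> complex^'n" where "\<sigma> z = (\<chi> j. z $ \<tau> j)" for z
  define \<iota> :: "complex^'n \<Rightarrow> complex^'m" where "\<iota> y = (\<chi> i. if i = k then 0 else y $ inv \<tau> i)" for y
  have \<sigma>\<iota>: "\<sigma> (\<iota> y) = y" for y by (simp add: \<sigma>_def \<iota>_def vec_eq_iff \<tau>k inj\<tau>)
  have \<iota>\<sigma>: "\<iota> (\<sigma> z) = z" if "z $ k = 0" for z
  proof -
    have "\<tau> (inv \<tau> i) = i" if "i \<noteq> k" for i
      using that \<tau> by (metis DiffI UNIV_I bij_betw_imp_surj_on empty_iff f_inv_into_f insert_iff)
    then show ?thesis using that by (simp add: \<sigma>_def \<iota>_def vec_eq_iff)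
  qed
  have \<iota>k: "\<iota> y $ k = 0" for y by (simp add: \<iota>_def)
  have bl\<sigma>: "bounded_linear \<sigma>"
    unfolding linear_conv_bounded_linear[symmetric] by (auto intro!: linearI simp: \<sigma>_def vec_eq_iff)
  have bl\<iota>: "bounded_linear \<iota>"
    unfolding linear_conv_bounded_linear[symmetric] by (auto intro!: linearI simp: \<iota>_def vec_eq_iff)
  define e where "e = (U \<inter> {x. \<pi> x = 0}, \<lambda>x. \<sigma> (\<psi> x))"
  have dom: "dom_chart e = U \<inter> {x. \<pi> x = 0}" and co: "coord e = (\<lambda>x. \<sigma> (\<psi> x))"
    by (simp_all add: e_def)
  define E where "E = \<iota> -` B"
  have oE: "open E"
    unfolding E_def by (rule open_vimage[OF oB linear_continuous_on[OF bl\<iota>]])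
  have im: "coord e ` dom_chart e = E"
  proof
    show "coord e ` dom_chart e \<subseteq> E"
      unfolding dom co E_def using \<psi>B \<psi>k \<iota>\<sigma> by auto
    show "E \<subseteq> coord e ` dom_chart e"
    proof
      fix y assume "y \<in> E"
      then have y: "\<iota> y \<in> B" by (simp add: E_def)
      then have "\<phi> (\<iota> y) \<in> dom_chart e"
        using \<phi>U[OF y] \<psi>k[OF \<phi>U[OF y]] \<psi>\<phi>[OF y] \<iota>k by (simp add: dom)
      moreover have "coord e (\<phi> (\<iota> y)) = y" by (simp add: co \<psi>\<phi>[OF y] \<sigma>\<iota>)
      ultimately show "y \<in> coord e ` dom_chart e" by (metis imageI)
    qed
  qed
  have g_in: "\<phi> (\<iota> y) \<in> dom_chart e" and cg: "coord e (\<phi> (\<iota> y)) = y" if "y \<in> E" for y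
  proof -
    have y: "\<iota> y \<in> B" using that by (simp add: E_def)
    show "\<phi> (\<iota> y) \<in> dom_chart e"
      using \<phi>U[OF y] \<psi>k[OF \<phi>U[OF y]] \<psi>\<phi>[OF y] \<iota>k by (simp add: dom)
    show "coord e (\<phi> (\<iota> y)) = y" by (simp add: co \<psi>\<phi>[OF y] \<sigma>\<iota>)
  qed
  have gc: "\<phi> (\<iota> (coord e x)) = x" if "x \<in> dom_chart e" for x
    using that \<iota>\<sigma>[of "\<psi> x"] \<psi>k \<phi>\<psi> by (simp add: dom co)
  have parE: "smooth_par (\<lambda>y. \<phi> (\<iota> y)) E"
    by (rule smooth_par_compose[OF par smooth_on_linear[OF bl\<iota> oE] oE]) (auto simp: E_def)
  have sme: "smooth_fun (coord e) U"
    unfolding co by (rule smooth_fun_compose_linear[OF sm\<psi> bl\<sigma>])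
  have sub: "subtopology (fibre_space X \<pi> 0) (dom_chart e) = subtopology X (dom_chart e)"
    by (simp add: fibre_space_def subtopology_subtopology dom Int_absorb1 Int_commute Int_left_commute)
  have chart_e: "is_chart (fibre_space X \<pi> 0) e"
    unfolding is_chart_def im sub
  proof (intro conjI oE)
    show "openin (fibre_space X \<pi> 0) (dom_chart e)"
      unfolding fibre_space_def dom openin_subtopology using oU by blast
    have c1: "continuous_map (subtopology X (dom_chart e)) (top_of_set E) (coord e)"
    proof -
      have "continuous_map (subtopology X (dom_chart e)) euclidean (coord e)"
        by (rule continuous_map_from_subtopology_mono[OF continuous_map_smooth_fun[OF sme]]) (auto simp: dom)
      then show ?thesis using im by (auto simp: continuous_map_in_subtopology)
    qed
    have c2: "continuous_map (top_of_set E) (subtopology X (dom_chart e)) (\<lambda>y. \<phi> (\<iota> y))"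
      using continuous_map_smooth_par[OF parE] g_in by (auto simp: continuous_map_in_subtopology)
    have "homeomorphic_maps (subtopology X (dom_chart e)) (top_of_set E) (coord e) (\<lambda>y. \<phi> (\<iota> y))"
      unfolding homeomorphic_maps_def using c1 c2 gc cg by simp
    then show "homeomorphic_map (subtopology X (dom_chart e)) (top_of_set E) (coord e)"
      using homeomorphic_map_maps by blast
  qed
  have inv_e: "inv_chart e y = \<phi> (\<iota> y)" if "y \<in> E" for y
    using inv_chart_coord[OF chart_e g_in[OF that]] cg[OF that] by simp
  have trans: "holomorphic_map (transition e d) (overlap e d) \<and>
      (\<forall>z\<in>overlap e d. inj (frechet_derivative (transition e d) (at z)))" if d: "d \<in> A" for d
  proof -
    define O1 where "O1 = overlap e d"
    have O1: "O1 = E \<inter> (\<lambda>y. \<phi> (\<iota> y)) -` dom_chart d"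
      unfolding O1_def coord_image_Int[OF chart_e] im using inv_e by auto
    have oO1: "open O1"
      unfolding O1 using parE is_chart_openin[OF chart[OF d]] by (simp add: smooth_par_def)
    have O1B: "\<iota> ` O1 \<subseteq> B \<inter> \<phi> -` dom_chart d" by (auto simp: O1 E_def)
    have oBd: "open (B \<inter> \<phi> -` dom_chart d)"
      using par is_chart_openin[OF chart[OF d]] by (simp add: smooth_par_def)
    have "holomorphic_map \<iota> O1"
      unfolding holomorphic_map_iff[OF oO1]
      using smooth_on_linear[OF bl\<iota> oO1] frechet_derivative_eqI[OF bounded_linear_imp_has_derivative[OF bl\<iota>]]
      by (simp add: \<iota>_def vec_eq_iff)
    from holomorphic_map_compose[OF oO1 oBd O1B this hol[OF d]]
    have h: "holomorphic_map (transition e d) O1"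
      by (rule holomorphic_map_cong[OF oO1, rotated]) (simp add: transition_def inv_e O1)
    have smt: "smooth_on (transition e d) O1" using h holomorphic_map_iff[OF oO1] by blast
    have "inj (frechet_derivative (transition e d) (at y))" if y: "y \<in> O1" for y
    proof (rule injI)
      fix v w assume vw: "frechet_derivative (transition e d) (at y) v = frechet_derivative (transition e d) (at y) w"
      \<comment> \<open>The extended coordinate, read in \<open>d\<close>, is a differentiable left
        inverse of the transition map, so the differential of the latter is injective.\<close>
      let ?G = "\<lambda>z. coord e (inv_chart d z)"
      have t: "transition e d z \<in> coord d ` (dom_chart d \<inter> U) \<and> ?G (transition e d z) = z" if "z \<in> O1" for z
        using that inv_e cg g_in inv_chart_coord[OF chart[OF d]] by (auto simp: O1 transition_def dom)
      have "?G differentiable (at (transition e d y))"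
        using sme d t[OF y] smooth_on_differentiable unfolding smooth_fun_def by blast
      then have comp: "frechet_derivative (\<lambda>z. ?G (transition e d z)) (at y) u
         = frechet_derivative ?G (at (transition e d y)) (frechet_derivative (transition e d) (at y) u)" for u
        by (rule frechet_derivative_compose[OF smooth_on_differentiable[OF smt y]])
      have "frechet_derivative (\<lambda>z. ?G (transition e d z)) (at y) = frechet_derivative (\<lambda>z. z) (at y)"
        by (rule frechet_derivative_cong_open[OF oO1 y]) (use t in blast)
      then have "frechet_derivative (\<lambda>z. ?G (transition e d z)) (at y) u = u" for u
        by (simp add: frechet_derivative_eqI[OF has_derivative_ident])
      then show "v = w" using comp[of v] comp[of w] vw by simp
    qed
    then show ?thesis using h by (simp add: O1_def)
  qed
  have "e \<in> fibre_atlas X A \<pi> 0"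
    using chart_e trans by (simp add: fibre_atlas_def)
  moreover have "p \<in> dom_chart e" using sl(2) p(2) by (simp add: dom)
  ultimately show ?thesis using dom sme by blast
qed

end


section \<open>Linear algebra and compactness for positivity\<close>

text \<open>Preimages of 1 and \<open>\<i>\<close> are linearly independent over the reals modulo
  the kernel.\<close>

lemma dim_kernel_le:
  fixes L :: "'a::euclidean_space \<Rightarrow> complex"
  assumes "linear L" "surj L"
  shows "dim {x. L x = 0} + 2 \<le> DIM('a)"
proof -
  obtain u w where u: "L u = 1" and w: "L w = \<i>" using assms(2) by (metis surj_def)
  let ?K = "{x. L x = 0}"
  have sp: "span ?K = ?K" using linear_subspace_kernel[OF assms(1)] by simp
  have "u \<notin> span ?K" unfolding sp using u by simp
  then have 1: "dim (insert u ?K) = dim ?K + 1" by (simp add: dim_insert)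
  have "w \<notin> span (insert u ?K)"
  proof
    assume "w \<in> span (insert u ?K)"
    then obtain k where "w - k *\<^sub>R u \<in> span ?K" using span_breakdown_eq by blast
    then have "L (w - k *\<^sub>R u) = 0" unfolding sp by simp
    then have "\<i> = of_real k"
      using u w by (simp add: linear_diff[OF assms(1)] linear_scale[OF assms(1)] scaleR_conv_of_real)
    then show False by (metis Im_complex_of_real imaginary_unit.simps(2) zero_neq_one)
  qed
  then have "dim (insert w (insert u ?K)) = dim ?K + 2" using 1 by (simp add: dim_insert)
  then show ?thesis using dim_subset_UNIV[of "insert w (insert u ?K)"] by simp
qed

text \<open>In use, \<open>L\<close> is the differential of \<pi> and \<open>H\<close> that of an
  inverse fibre chart: the tangent space of the fibre fills the kernel because it already has the
  largest real dimension the kernel can have.\<close>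

lemma range_eq_kernel:
  fixes L :: "complex^'m::finite \<Rightarrow> complex" and H :: "complex^'n::finite \<Rightarrow> complex^'m"
  assumes "linear L" "surj L" "linear H" "inj H" "CARD('m) = CARD('n) + 1" "\<And>v. L (H v) = 0" "L \<xi> = 0"
  shows "\<exists>\<eta>. \<xi> = H \<eta>"
proof -
  have "dim (range H) = 2 * CARD('n)"
    using dim_image_eq[OF assms(3), of UNIV] assms(4) by simp
  then have "dim {x. L x = 0} \<le> dim (range H)"
    using dim_kernel_le[OF assms(1,2)] assms(5) by simp
  then have "range H = {x. L x = 0}"
    using subspace_dim_equal[OF linear_subspace_image[OF assms(3) subspace_UNIV] linear_subspace_kernel[OF assms(1)]]
      assms(6) by auto
  then show ?thesis using assms(7) by blast
qed

text \<open>If positivity failed arbitrarily close to \<open>y0\<close>, unit vectors violating it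
  would accumulate, by compactness of the sphere, at a unit vector in the kernel of
  \<open>L y0\<close> with nonpositive value. Carrying the equation \<open>L y \<xi> = 0\<close>
  along the sequence replaces a choice of bases for the varying kernels.\<close>

lemma positive_neighbourhood:
  fixes \<omega> :: "'m::finite form2" and L :: "complex^'m \<Rightarrow> complex^'m \<Rightarrow> complex"
  assumes \<omega>: "local_form2 S \<omega>" and S: "open S" "y0 \<in> S"
    and L: "\<And>y. y \<in> S \<Longrightarrow> linear (L y)" "\<And>v. continuous_on S (\<lambda>y. L y v)"
    and pos: "\<And>\<xi>. \<xi> \<noteq> 0 \<Longrightarrow> L y0 \<xi> = 0 \<Longrightarrow> \<omega> y0 \<xi> (\<i> *s \<xi>) > 0"
  obtains N where "open N" "y0 \<in> N" "N \<subseteq> S"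
    "\<And>y \<xi>. y \<in> N \<Longrightarrow> \<xi> \<noteq> 0 \<Longrightarrow> L y \<xi> = 0 \<Longrightarrow> \<omega> y \<xi> (\<i> *s \<xi>) > 0"
proof (rule ccontr)
  assume neg: "\<not> thesis"
  have "\<exists>y \<xi>. y \<in> S \<and> dist y0 y < inverse (real (Suc n)) \<and> norm \<xi> = 1 \<and> L y \<xi> = 0 \<and> \<omega> y \<xi> (\<i> *s \<xi>) \<le> 0" for n
  proof -
    let ?N = "S \<inter> ball y0 (inverse (real (Suc n)))"
    have "\<exists>y \<xi>. y \<in> ?N \<and> \<xi> \<noteq> 0 \<and> L y \<xi> = 0 \<and> \<not> \<omega> y \<xi> (\<i> *s \<xi>) > 0"
    proof (rule ccontr)
      assume *: "\<not> (\<exists>y \<xi>. y \<in> ?N \<and> \<xi> \<noteq> 0 \<and> L y \<xi> = 0 \<and> \<not> \<omega> y \<xi> (\<i> *s \<xi>) > 0)"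
      have thesis
      proof (rule that)
        show "open ?N" "y0 \<in> ?N" "?N \<subseteq> S" using S by auto
        show "\<omega> y \<xi> (\<i> *s \<xi>) > 0" if "y \<in> ?N" "\<xi> \<noteq> 0" "L y \<xi> = 0" for y \<xi>
          using * that by blast
      qed
      then show False using neg by blast
    qed
    then obtain y \<xi> where y: "y \<in> ?N" and \<xi>: "\<xi> \<noteq> 0" "L y \<xi> = 0" "\<not> \<omega> y \<xi> (\<i> *s \<xi>) > 0"
      by (elim exE conjE)
    have yS: "y \<in> S" using y by simp
    have lr: "linear (\<omega> y v)" and ll: "linear (\<lambda>v. \<omega> y v w)" for v w
      using \<omega> yS by (auto simp: local_form2_def)
    \<comment> \<open>The quadratic form is homogeneous of degree 2, so normalising the vector
      preserves the sign.\<close>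
    define \<zeta> where "\<zeta> = inverse (norm \<xi>) *\<^sub>R \<xi>"
    have i\<zeta>: "\<i> *s \<zeta> = inverse (norm \<xi>) *\<^sub>R (\<i> *s \<xi>)" by (simp add: \<zeta>_def vec_eq_iff)
    have "\<omega> y \<zeta> (\<i> *s \<zeta>) = inverse (norm \<xi>) * (inverse (norm \<xi>) * \<omega> y \<xi> (\<i> *s \<xi>))"
      unfolding i\<zeta> linear_scale[OF lr] unfolding \<zeta>_def linear_scale[OF ll] by simp
    then have "\<omega> y \<zeta> (\<i> *s \<zeta>) \<le> 0"
      using \<xi> by (simp add: mult_le_0_iff)
    moreover have "norm \<zeta> = 1" "L y \<zeta> = 0"
      using \<xi> by (simp_all add: \<zeta>_def linear_scale[OF L(1)[OF yS]])
    ultimately show ?thesis using y by (intro exI[of _ y] exI[of _ \<zeta>]) simp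
  qed
  then obtain y \<xi> where y: "\<And>n. y n \<in> S" "\<And>n. dist y0 (y n) < inverse (real (Suc n))"
    and \<xi>: "\<And>n. norm (\<xi> n) = 1" "\<And>n. L (y n) (\<xi> n) = 0" "\<And>n. \<omega> (y n) (\<xi> n) (\<i> *s \<xi> n) \<le> 0"
    by metis
  have "\<And>n. \<xi> n \<in> sphere 0 1" using \<xi>(1) by simp
  then obtain \<zeta> \<rho> where \<zeta>: "\<zeta> \<in> sphere 0 1" and \<rho>: "strict_mono \<rho>" and lim: "(\<xi> \<circ> \<rho>) \<longlonglongrightarrow> \<zeta>"
    using compact_sphere unfolding compact_def by metis
  have "(\<lambda>n. dist (y n) y0) \<longlonglongrightarrow> 0"
    by (rule tendsto_sandwich[OF _ _ tendsto_const LIMSEQ_inverse_real_of_nat])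
      (use y(2) in \<open>auto simp: dist_commute intro!: always_eventually less_imp_le\<close>)
  then have "y \<longlonglongrightarrow> y0" by (rule tendsto_dist_iff[THEN iffD2])
  then have ylim: "(\<lambda>n. y (\<rho> n)) \<longlonglongrightarrow> y0"
    using LIMSEQ_subseq_LIMSEQ[OF _ \<rho>] by (simp add: o_def)
  have xlim: "(\<lambda>n. \<xi> (\<rho> n)) \<longlonglongrightarrow> \<zeta>" using lim by (simp add: o_def)
  have bli: "bounded_linear (\<lambda>v::complex^'m. \<i> *s v)"
    unfolding linear_conv_bounded_linear[symmetric] by (auto intro!: linearI simp: vec_eq_iff algebra_simps)
  have ixlim: "(\<lambda>n. \<i> *s \<xi> (\<rho> n)) \<longlonglongrightarrow> \<i> *s \<zeta>"
    by (rule bounded_linear.tendsto[OF bli xlim])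
  have Lexp: "L y v = (\<Sum>b\<in>Basis. (v \<bullet> b) *\<^sub>R L y b)" if "y \<in> S" for y v
    using linear_sum[OF L(1)[OF that], of "\<lambda>b. (v \<bullet> b) *\<^sub>R b" Basis]
    by (simp add: euclidean_representation linear_scale[OF L(1)[OF that]])
  have Llim: "(\<lambda>n. L (y (\<rho> n)) b) \<longlonglongrightarrow> L y0 b" for b
    by (rule isCont_tendsto_compose[OF _ ylim]) (use L(2) S in \<open>simp add: continuous_on_eq_continuous_at\<close>)
  have \<omega>lim: "(\<lambda>n. \<omega> (y (\<rho> n)) b c) \<longlonglongrightarrow> \<omega> y0 b c" for b c
  proof (rule isCont_tendsto_compose[OF _ ylim])
    have "smooth_on (\<lambda>y. \<omega> y b c) S" using \<omega> by (simp add: local_form2_def)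
    then have "continuous_on S (\<lambda>y. \<omega> y b c)" by (rule smooth_on_continuous)
    then show "isCont (\<lambda>y. \<omega> y b c) y0"
      using S by (simp add: continuous_on_eq_continuous_at)
  qed
  have "(\<lambda>n. L (y (\<rho> n)) (\<xi> (\<rho> n))) \<longlonglongrightarrow> L y0 \<zeta>"
  proof -
    have 1: "(\<lambda>n. L (y (\<rho> n)) (\<xi> (\<rho> n))) = (\<lambda>n. \<Sum>b\<in>Basis. (\<xi> (\<rho> n) \<bullet> b) *\<^sub>R L (y (\<rho> n)) b)"
      by (rule ext) (rule Lexp[OF y(1)])
    show ?thesis
      unfolding 1 Lexp[OF S(2), of \<zeta>] by (intro tendsto_intros xlim Llim)
  qed
  then have "L y0 \<zeta> = 0" by (simp add: \<xi>(2) LIMSEQ_const_iff)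
  have "(\<lambda>n. \<omega> (y (\<rho> n)) (\<xi> (\<rho> n)) (\<i> *s \<xi> (\<rho> n))) \<longlonglongrightarrow> \<omega> y0 \<zeta> (\<i> *s \<zeta>)"
  proof -
    have 1: "(\<lambda>n. \<omega> (y (\<rho> n)) (\<xi> (\<rho> n)) (\<i> *s \<xi> (\<rho> n))) = (\<lambda>n. \<Sum>b\<in>Basis. (\<xi> (\<rho> n) \<bullet> b) *
        (\<Sum>c\<in>Basis. ((\<i> *s \<xi> (\<rho> n)) \<bullet> c) * \<omega> (y (\<rho> n)) b c))"
      by (rule ext) (rule local_form2_expand[OF \<omega> y(1)])
    show ?thesis
      unfolding 1 local_form2_expand[OF \<omega> S(2), of \<zeta> "\<i> *s \<zeta>"]
      by (intro tendsto_intros xlim ixlim \<omega>lim)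
  qed
  then have "\<omega> y0 \<zeta> (\<i> *s \<zeta>) \<le> 0"
    by (rule LIMSEQ_le_const2) (use \<xi>(3) in auto)
  moreover have "\<zeta> \<noteq> 0" using \<zeta> by auto
  ultimately show False using pos[of \<zeta>] \<open>L y0 \<zeta> = 0\<close> by simp
qed


section \<open>Charts of the fibres\<close>

context cmanifold
begin

lemma fibre_chart: "c \<in> fibre_atlas X A \<pi> t \<Longrightarrow> is_chart (fibre_space X \<pi> t) c"
  by (simp add: fibre_atlas_def)

lemma fibre_chart_dom:
  assumes "c \<in> fibre_atlas X A \<pi> t" "x \<in> dom_chart c"
  shows "x \<in> topspace X" "\<pi> x = t"
  using openin_subset[OF is_chart_openin[OF fibre_chart[OF assms(1)]]] assms(2)
  by (auto simp: fibre_space_def)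

lemma open_fibre_image:
  assumes c: "c \<in> fibre_atlas X A \<pi> t" and "openin X N"
  shows "open (coord c ` (dom_chart c \<inter> N))"
proof -
  have "openin (fibre_space X \<pi> t) (N \<inter> {x. \<pi> x = t})"
    unfolding fibre_space_def by (rule openin_subtopology_Int[OF assms(2)])
  from chart_open_image[OF fibre_chart[OF c] this]
  have "open (coord c ` (dom_chart c \<inter> (N \<inter> {x. \<pi> x = t})))" .
  moreover have "dom_chart c \<inter> (N \<inter> {x. \<pi> x = t}) = dom_chart c \<inter> N"
    using fibre_chart_dom(2)[OF c] by blast
  ultimately show ?thesis by simp
qed

lemma fibre_transition:
  assumes c: "c \<in> fibre_atlas X A \<pi> t" and d: "d \<in> A"
  shows "smooth_on (transition c d) (overlap c d)"
    and "z \<in> overlap c d \<Longrightarrow>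
      frechet_derivative (transition c d) (at z) (\<i> *s v) = \<i> *s frechet_derivative (transition c d) (at z) v"
    and "z \<in> overlap c d \<Longrightarrow> inj (frechet_derivative (transition c d) (at z))"
proof -
  have h: "holomorphic_map (transition c d) (overlap c d)"
    and i: "\<forall>z\<in>overlap c d. inj (frechet_derivative (transition c d) (at z))"
    using c d by (simp_all add: fibre_atlas_def)
  note iff = holomorphic_map_iff[OF open_fibre_image[OF c is_chart_openin[OF chart[OF d]]], of "transition c d"]
  show "smooth_on (transition c d) (overlap c d)"
    using h unfolding iff by blast
  show "frechet_derivative (transition c d) (at z) (\<i> *s v) = \<i> *s frechet_derivative (transition c d) (at z) v"
    if "z \<in> overlap c d"
    using h that unfolding iff by blast
  show "inj (frechet_derivative (transition c d) (at z))" if "z \<in> overlap c d"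
    using i that by blast
qed

text \<open>The inclusion of a fibre is smooth: through \<open>smooth_fun_par\<close>, smooth
  functions on open sets of the total space restrict to smooth functions in the charts of the
  fibre.\<close>

lemma smooth_par_fibre_chart:
  assumes "c \<in> fibre_atlas X A \<pi> t"
  shows "smooth_par (inv_chart c) (coord c ` dom_chart c)"
  unfolding smooth_par_def coord_image_Int[OF fibre_chart[OF assms], symmetric]
proof (intro conjI allI impI ballI)
  show "open (coord c ` dom_chart c)" by (rule is_chart_open[OF fibre_chart[OF assms]])
  show "inv_chart c ` coord c ` dom_chart c \<subseteq> topspace X"
    using inv_chart_coord[OF fibre_chart[OF assms]] fibre_chart_dom(1)[OF assms] by auto
  show "open (coord c ` (dom_chart c \<inter> N))" if "openin X N" for N
    using open_fibre_image[OF assms that] by simp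
  show "smooth_on (\<lambda>z. coord d (inv_chart c z)) (overlap c d)" if "d \<in> A" for d
    using fibre_transition(1)[OF assms that] by (simp add: transition_def o_def)
qed

text \<open>Membership in the fibre atlas relates a chart to the total space only. In a chart
  \<open>d\<close> there, the change of charts is a continuous lift of \<open>transition c d\<close>
  through the immersion \<open>transition c' d\<close>, hence differentiable, which is what the
  chain rule asks for.\<close>

lemma fibre_transition_differentiable:
  fixes c c' :: "('a, 'n::finite) chart"
  assumes c: "c \<in> fibre_atlas X A \<pi> t" and c': "c' \<in> fibre_atlas X A \<pi> t" and z: "z \<in> overlap c c'"
  shows "transition c c' differentiable (at z)"
proof -
  note ch = fibre_chart[OF c] and ch' = fibre_chart[OF c']
  have iz: "inv_chart c z \<in> dom_chart c \<inter> dom_chart c'"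
    using z inv_chart_coord[OF ch] by auto
  obtain d where d: "d \<in> A" "inv_chart c z \<in> dom_chart d"
    using chart_at fibre_chart_dom(1)[OF c] iz by blast
  let ?N = "coord c ` (dom_chart c \<inter> (dom_chart c' \<inter> dom_chart d))"
  have zN: "z \<in> ?N"
  proof -
    have "z \<in> coord c ` dom_chart c" using z by blast
    then have "z = coord c (inv_chart c z)" using coord_inv_chart by metis
    then show ?thesis using iz d(2) by blast
  qed
  have o1: "openin (fibre_space X \<pi> t) (dom_chart d \<inter> {x. \<pi> x = t})"
    unfolding fibre_space_def by (rule openin_subtopology_Int[OF is_chart_openin[OF chart[OF d(1)]]])
  have "open (coord c ` (dom_chart c \<inter> (dom_chart c' \<inter> (dom_chart d \<inter> {x. \<pi> x = t}))))"
    by (intro chart_open_image[OF ch] openin_Int is_chart_openin[OF ch'] o1)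
  moreover have "dom_chart c \<inter> (dom_chart c' \<inter> (dom_chart d \<inter> {x. \<pi> x = t})) = dom_chart c \<inter> (dom_chart c' \<inter> dom_chart d)"
    using fibre_chart_dom(2)[OF c] by blast
  ultimately have oN: "open ?N" by simp
  have Nprop: "inv_chart c x \<in> dom_chart c \<inter> dom_chart c' \<inter> dom_chart d \<and>
      transition c' d (transition c c' x) = transition c d x" if "x \<in> ?N" for x
    using that inv_chart_coord[OF ch] inv_chart_coord[OF ch'] by (auto simp: transition_def)
  have tz: "transition c c' z \<in> overlap c' d"
    using Nprop[OF zN] by (simp add: transition_def)
  have "isCont (transition c c') z"
    unfolding continuous_at_open
  proof (intro allI impI)
    fix T assume T: "open T \<and> transition c c' z \<in> T"
    let ?M = "coord c ` (dom_chart c \<inter> (dom_chart c' \<inter> coord c' -` T))"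
    have "open ?M" using chart_open_image[OF ch chart_open_preimage[OF ch']] T by blast
    moreover have "z \<in> ?M"
      using z T inv_chart_coord[OF ch] by (auto simp: transition_def)
    moreover have "\<forall>x\<in>?M. transition c c' x \<in> T"
      using inv_chart_coord[OF ch] by (auto simp: transition_def)
    ultimately show "\<exists>s. open s \<and> z \<in> s \<and> (\<forall>x'\<in>s. transition c c' x' \<in> T)" by blast
  qed
  moreover have "transition c d differentiable at z"
    by (rule smooth_on_differentiable[OF fibre_transition(1)[OF c d(1)]]) (use zN in blast)
  moreover have "transition c' d (transition c c' x) = transition c d x" if "x \<in> ?N" for x
    using Nprop[OF that] by blast
  ultimately show ?thesis
    using differentiable_lift_immersion[where \<tau> = "transition c c'" and z = z,
        OF smooth_on_has_derivative[OF fibre_transition(1)[OF c' d(1)] tz]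
          fibre_transition(3)[OF c' d(1) tz] _ _ oN zN] by blast
qed

end


section \<open>Pulling back the locally conformally symplectic form\<close>

text \<open>\<open>B\<close> is a cover of the central fibre by charts whose coordinates extend
  smoothly to open sets of the total space. Membership in the maximal atlas does not hand over such
  an extension, and it is what lets \<open>coord e\<close> be composed smoothly with
  \<open>r\<close>.\<close>

locale fibre_retraction = cmanifold X A
  for X :: "'a topology" and A :: "('a, 'm::finite) chart set" +
  fixes \<pi> :: "'a \<Rightarrow> complex" and r :: "'a \<Rightarrow> 'a" and W :: "'a set" and B :: "('a, 'n::finite) chart set"
    and \<Omega> :: "('a, 'n) chart \<Rightarrow> 'n form2" and \<theta> :: "('a, 'n) chart \<Rightarrow> 'n form1"
  assumes retraction: "smooth_retraction \<pi> r W"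
    and B_atlas: "B \<subseteq> fibre_atlas X A \<pi> 0"
    and B_cover: "\<And>p. p \<in> topspace X \<Longrightarrow> \<pi> p = 0 \<Longrightarrow> \<exists>e\<in>B. p \<in> dom_chart e"
    and B_smooth: "\<And>e. e \<in> B \<Longrightarrow> \<exists>U. dom_chart e = U \<inter> {x. \<pi> x = 0} \<and> smooth_fun (coord e) U"
    and form_\<Omega>: "manifold_form2 (fibre_atlas X A \<pi> 0) \<Omega>"
    and lee_\<theta>: "lee_form (fibre_atlas X A \<pi> 0) \<Omega> \<theta>"
    and pos_\<Omega>: "positive_part11 (fibre_atlas X A \<pi> 0) \<Omega>"
begin

lemma B_chart: "e \<in> B \<Longrightarrow> e \<in> fibre_atlas X A \<pi> 0"
  using B_atlas by blast

lemma r_zero: "x \<in> W \<Longrightarrow> \<pi> (r x) = 0" and r_id: "x \<in> W \<Longrightarrow> \<pi> x = 0 \<Longrightarrow> r x = x"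
  and r_smooth: "smooth_map r W"
  using retraction by (simp_all add: smooth_retraction_def)

definition region :: "('a, 'n) chart \<Rightarrow> 'a set" where
  "region e = W \<inter> r -` dom_chart e"

text \<open>Values of \<open>r\<close> lie on the central fibre, so landing in
  \<open>dom_chart e\<close> is the same as landing in the open set \<open>U\<close> to which the
  coordinate extends.\<close>

lemma smooth_fun_coord_r: "e \<in> B \<Longrightarrow> smooth_fun (\<lambda>x. coord e (r x)) (region e)"
proof -
  assume "e \<in> B"
  then obtain U where U: "dom_chart e = U \<inter> {x. \<pi> x = 0}" "smooth_fun (coord e) U"
    using B_smooth by blast
  have "region e = W \<inter> r -` U" unfolding region_def U(1) using r_zero by auto
  then show ?thesis using smooth_fun_map[OF U(2) r_smooth] by simp
qed

lemma region_cover: "x \<in> W \<Longrightarrow> \<exists>e\<in>B. x \<in> region e"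
  using B_cover[OF smooth_map_range[OF r_smooth] r_zero] by (auto simp: region_def)

text \<open>The source chart may belong to a fibre or to the total space, hence the free dimension
  \<open>'k\<close>.\<close>

definition retr :: "('a, 'k::finite) chart \<Rightarrow> ('a, 'n) chart \<Rightarrow> complex^'k \<Rightarrow> complex^'n" where
  "retr c e z = coord e (r (inv_chart c z))"

lemma retr_in: "inv_chart c z \<in> region e \<Longrightarrow> retr c e z \<in> coord e ` dom_chart e"
  by (simp add: retr_def region_def)

lemma form2_e: "e \<in> B \<Longrightarrow> local_form2 (coord e ` dom_chart e) (\<Omega> e)"
  using form_\<Omega> B_chart by (simp add: manifold_form2_def)

lemma form1_e: "e \<in> B \<Longrightarrow> local_form1 (coord e ` dom_chart e) (\<theta> e)"
  using lee_\<theta> B_chart by (simp add: manifold_form1_def lee_form_def)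

lemma open_e: "e \<in> B \<Longrightarrow> open (coord e ` dom_chart e)"
  using is_chart_open[OF fibre_chart[OF B_chart]] .

definition choice :: "'a \<Rightarrow> ('a, 'n) chart" where
  "choice x = (SOME e. e \<in> B \<and> x \<in> region e)"

lemma choice: "x \<in> W \<Longrightarrow> choice x \<in> B \<and> x \<in> region (choice x)"
  unfolding choice_def by (rule someI_ex) (use region_cover in blast)

text \<open>A form is one function per chart \<open>c\<close>, while the retracted points may lie in
  different charts of \<open>B\<close>. The chart is chosen pointwise; \<open>\<Omega>_pb_eq\<close>
  shows that the result is independent of the choice.\<close>

definition \<Omega>_pb :: "('a, 'n) chart \<Rightarrow> 'n form2" where
  "\<Omega>_pb c z = pullback2 (retr c (choice (inv_chart c z))) (\<Omega> (choice (inv_chart c z))) z"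

definition \<theta>_pb :: "('a, 'n) chart \<Rightarrow> 'n form1" where
  "\<theta>_pb c z = pullback1 (retr c (choice (inv_chart c z))) (\<theta> (choice (inv_chart c z))) z"

section \<open>The pulled-back forms in one chart of a fibre\<close>

context
  fixes t and c :: "('a, 'n) chart"
  assumes c: "c \<in> fibre_atlas X A \<pi> t"
begin

definition patch :: "('a, 'n) chart \<Rightarrow> (complex^'n) set" where
  "patch e = coord c ` dom_chart c \<inter> inv_chart c -` region e"

lemma open_patch: "e \<in> B \<Longrightarrow> open (patch e)"
  using smooth_par_fibre_chart[OF c] smooth_fun_openin[OF smooth_fun_coord_r]
  by (simp add: patch_def smooth_par_def)

lemma smooth_retr: "e \<in> B \<Longrightarrow> smooth_on (retr c e) (patch e)"
  unfolding retr_def[abs_def] patch_def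
  by (rule smooth_fun_par[OF smooth_fun_coord_r smooth_par_fibre_chart[OF c]])

lemma retr_patch: "retr c e ` patch e \<subseteq> coord e ` dom_chart e"
  using retr_in unfolding patch_def by blast

lemma retr_change:
  assumes e: "e \<in> B" "e' \<in> B" and z: "z \<in> patch e" "z \<in> patch e'"
  shows "retr c e z \<in> overlap e e'" "retr c e' z = transition e e' (retr c e z)"
    "frechet_derivative (retr c e') (at z) v
      = frechet_derivative (transition e e') (at (retr c e z)) (frechet_derivative (retr c e) (at z) v)"
proof -
  note ch = fibre_chart[OF B_chart[OF e(1)]]
  have *: "retr c e y \<in> overlap e e' \<and> retr c e' y = transition e e' (retr c e y)"
    if "y \<in> patch e \<inter> patch e'" for y
    using that inv_chart_coord[OF ch] by (auto simp: retr_def patch_def region_def transition_def)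
  show ov: "retr c e z \<in> overlap e e'" and "retr c e' z = transition e e' (retr c e z)"
    using * z by blast+
  have "frechet_derivative (retr c e') (at z) = frechet_derivative (\<lambda>y. transition e e' (retr c e y)) (at z)"
    by (rule frechet_derivative_cong_open[OF open_Int[OF open_patch[OF e(1)] open_patch[OF e(2)]]])
      (use * z in blast)+
  moreover have "frechet_derivative (\<lambda>y. transition e e' (retr c e y)) (at z) v
      = frechet_derivative (transition e e') (at (retr c e z)) (frechet_derivative (retr c e) (at z) v)"
    by (rule frechet_derivative_compose[OF smooth_on_differentiable[OF smooth_retr[OF e(1)] z(1)]
          fibre_transition_differentiable[OF B_chart[OF e(1)] B_chart[OF e(2)] ov]])
  ultimately show "frechet_derivative (retr c e') (at z) v
      = frechet_derivative (transition e e') (at (retr c e z)) (frechet_derivative (retr c e) (at z) v)" by simp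
qed

lemma choice_patch:
  assumes "e \<in> B" "z \<in> patch e"
  shows "choice (inv_chart c z) \<in> B" "z \<in> patch (choice (inv_chart c z))"
proof -
  have "inv_chart c z \<in> W" using assms(2) by (simp add: patch_def region_def)
  from choice[OF this] show "choice (inv_chart c z) \<in> B" "z \<in> patch (choice (inv_chart c z))"
    using assms(2) by (simp_all add: patch_def)
qed

text \<open>The transformation rule of \<Omega> between \<open>e\<close> and the chosen chart
  cancels against the chain rule for \<open>retr\<close>. On the open patch of \<open>e\<close> the
  pointwise choice is thereby replaced by the fixed \<open>e\<close>, which gives access to
  smoothness and derivatives.\<close>

lemma \<Omega>_pb_eq:
  assumes e: "e \<in> B" and z: "z \<in> patch e"
  shows "\<Omega>_pb c z = pullback2 (retr c e) (\<Omega> e) z"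
proof (intro ext)
  fix v w
  let ?e = "choice (inv_chart c z)"
  note e' = choice_patch[OF e z]
  note ch = retr_change[OF e e'(1) z e'(2)]
  have "\<Omega> e y u x = \<Omega> ?e (transition e ?e y) (frechet_derivative (transition e ?e) (at y) u)
      (frechet_derivative (transition e ?e) (at y) x)" if "y \<in> overlap e ?e" for y u x
    using form_\<Omega> B_chart[OF e] B_chart[OF e'(1)] that unfolding manifold_form2_def by blast
  from this[OF ch(1)] show "\<Omega>_pb c z v w = pullback2 (retr c e) (\<Omega> e) z v w"
    unfolding \<Omega>_pb_def pullback2_def ch(2,3) by simp
qed

lemma \<theta>_pb_eq:
  assumes e: "e \<in> B" and z: "z \<in> patch e"
  shows "\<theta>_pb c z = pullback1 (retr c e) (\<theta> e) z"
proof (intro ext)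
  fix v
  let ?e = "choice (inv_chart c z)"
  note e' = choice_patch[OF e z]
  note ch = retr_change[OF e e'(1) z e'(2)]
  have "\<theta> e y u = \<theta> ?e (transition e ?e y) (frechet_derivative (transition e ?e) (at y) u)"
    if "y \<in> overlap e ?e" for y u
    using lee_\<theta> B_chart[OF e] B_chart[OF e'(1)] that unfolding lee_form_def manifold_form1_def by blast
  from this[OF ch(1)] show "\<theta>_pb c z v = pullback1 (retr c e) (\<theta> e) z v"
    unfolding \<theta>_pb_def pullback1_def ch(2,3) by simp
qed

lemma pb_form2_patch: "e \<in> B \<Longrightarrow> local_form2 (patch e) (pullback2 (retr c e) (\<Omega> e))"
  by (rule local_form2_pullback[OF open_patch open_e smooth_retr retr_patch form2_e])

lemma pb_form1_patch: "e \<in> B \<Longrightarrow> local_form1 (patch e) (pullback1 (retr c e) (\<theta> e))"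
  by (rule local_form1_pullback[OF open_patch open_e smooth_retr retr_patch form1_e])

text \<open>Exterior derivative and wedge product commute with pullback along
  \<open>retr c e\<close>, so both equations are inherited from the central fibre.\<close>

lemma d_pb:
  assumes e: "e \<in> B" and z: "z \<in> patch e"
  shows "d_form1 (\<theta>_pb c) z u v = 0" "d_form2 (\<Omega>_pb c) z u v w = wedge12 (\<theta>_pb c) (\<Omega>_pb c) z u v w"
proof -
  let ?D = "frechet_derivative (retr c e) (at z)"
  have in_e: "retr c e z \<in> coord e ` dom_chart e" using retr_patch z by blast
  \<comment> \<open>Derivatives depend only on a neighbourhood, so the fixed \<open>e\<close> may
    replace the pointwise choice before differentiating.\<close>
  have f1: "frechet_derivative (\<lambda>y. \<theta>_pb c y x) (at z) = frechet_derivative (\<lambda>y. pullback1 (retr c e) (\<theta> e) y x) (at z)" for x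
    by (rule frechet_derivative_cong_open[OF open_patch[OF e] z]) (simp add: \<theta>_pb_eq[OF e])
  have f2: "frechet_derivative (\<lambda>y. \<Omega>_pb c y x x') (at z) = frechet_derivative (\<lambda>y. pullback2 (retr c e) (\<Omega> e) y x x') (at z)" for x x'
    by (rule frechet_derivative_cong_open[OF open_patch[OF e] z]) (simp add: \<Omega>_pb_eq[OF e])
  have "d_form1 (\<theta>_pb c) z u v = d_form1 (pullback1 (retr c e) (\<theta> e)) z u v"
    by (simp add: d_form1_def f1)
  also have "\<dots> = d_form1 (\<theta> e) (retr c e z) (?D u) (?D v)"
    by (rule d_form1_pullback[OF open_patch[OF e] open_e[OF e] smooth_retr[OF e] retr_patch form1_e[OF e] z])
  also have "\<dots> = 0"
    using lee_\<theta> B_chart[OF e] in_e unfolding lee_form_def closed_form1_def by blast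
  finally show "d_form1 (\<theta>_pb c) z u v = 0" .
  have "d_form2 (\<Omega>_pb c) z u v w = d_form2 (pullback2 (retr c e) (\<Omega> e)) z u v w"
    by (simp add: d_form2_def f2)
  also have "\<dots> = d_form2 (\<Omega> e) (retr c e z) (?D u) (?D v) (?D w)"
    by (rule d_form2_pullback[OF open_patch[OF e] open_e[OF e] smooth_retr[OF e] retr_patch form2_e[OF e] z])
  also have "\<dots> = wedge12 (\<theta> e) (\<Omega> e) (retr c e z) (?D u) (?D v) (?D w)"
    using lee_\<theta> B_chart[OF e] in_e unfolding lee_form_def by blast
  also have "\<dots> = wedge12 (pullback1 (retr c e) (\<theta> e)) (pullback2 (retr c e) (\<Omega> e)) z u v w"
    by (rule wedge12_pullback[symmetric])
  also have "\<dots> = wedge12 (\<theta>_pb c) (\<Omega>_pb c) z u v w"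
    by (simp add: wedge12_def \<theta>_pb_eq[OF e z] \<Omega>_pb_eq[OF e z])
  finally show "d_form2 (\<Omega>_pb c) z u v w = wedge12 (\<theta>_pb c) (\<Omega>_pb c) z u v w" .
qed

lemma patch_cover:
  assumes "dom_chart c \<subseteq> W" "z \<in> coord c ` dom_chart c"
  obtains e where "e \<in> B" "z \<in> patch e"
proof -
  have "inv_chart c z \<in> W" using inv_chart_in[OF assms(2)] assms(1) by blast
  then obtain e where "e \<in> B" "inv_chart c z \<in> region e" using region_cover by blast
  then show ?thesis using that[of e] assms(2) by (simp add: patch_def)
qed

lemma local_form2_pb:
  assumes "dom_chart c \<subseteq> W"
  shows "local_form2 (coord c ` dom_chart c) (\<Omega>_pb c)"
proof -
  have "(\<forall>v. linear (\<Omega>_pb c z v)) \<and> (\<forall>w. linear (\<lambda>v. \<Omega>_pb c z v w)) \<and> (\<forall>v. \<Omega>_pb c z v v = 0)"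
    if z: "z \<in> coord c ` dom_chart c" for z
  proof -
    obtain e where e: "e \<in> B" "z \<in> patch e" using patch_cover[OF assms z] .
    show ?thesis
      unfolding \<Omega>_pb_eq[OF e] using pb_form2_patch[OF e(1)] e(2) by (simp add: local_form2_def)
  qed
  moreover have "smooth_on (\<lambda>z. \<Omega>_pb c z v w) (coord c ` dom_chart c)" for v w
  proof (rule smooth_on_local)
    fix z assume z: "z \<in> coord c ` dom_chart c"
    obtain e where e: "e \<in> B" "z \<in> patch e" using patch_cover[OF assms z] .
    have "smooth_on (\<lambda>z. \<Omega>_pb c z v w) (patch e)"
      by (rule smooth_on_cong[OF open_patch[OF e(1)], of "\<lambda>z. pullback2 (retr c e) (\<Omega> e) z v w"])
        (use pb_form2_patch[OF e(1)] \<Omega>_pb_eq[OF e(1)] in \<open>auto simp: local_form2_def\<close>)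
    then show "\<exists>N. open N \<and> z \<in> N \<and> smooth_on (\<lambda>z. \<Omega>_pb c z v w) N"
      using open_patch[OF e(1)] e(2) by blast
  qed
  ultimately show ?thesis by (simp add: local_form2_def)
qed

lemma local_form1_pb:
  assumes "dom_chart c \<subseteq> W"
  shows "local_form1 (coord c ` dom_chart c) (\<theta>_pb c)"
proof -
  have "linear (\<theta>_pb c z)" if z: "z \<in> coord c ` dom_chart c" for z
  proof -
    obtain e where e: "e \<in> B" "z \<in> patch e" using patch_cover[OF assms z] .
    show ?thesis
      unfolding \<theta>_pb_eq[OF e] using pb_form1_patch[OF e(1)] e(2) by (simp add: local_form1_def)
  qed
  moreover have "smooth_on (\<lambda>z. \<theta>_pb c z v) (coord c ` dom_chart c)" for v
  proof (rule smooth_on_local)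
    fix z assume z: "z \<in> coord c ` dom_chart c"
    obtain e where e: "e \<in> B" "z \<in> patch e" using patch_cover[OF assms z] .
    have "smooth_on (\<lambda>z. \<theta>_pb c z v) (patch e)"
      by (rule smooth_on_cong[OF open_patch[OF e(1)], of "\<lambda>z. pullback1 (retr c e) (\<theta> e) z v"])
        (use pb_form1_patch[OF e(1)] \<theta>_pb_eq[OF e(1)] in \<open>auto simp: local_form1_def\<close>)
    then show "\<exists>N. open N \<and> z \<in> N \<and> smooth_on (\<lambda>z. \<theta>_pb c z v) N"
      using open_patch[OF e(1)] e(2) by blast
  qed
  ultimately show ?thesis by (simp add: local_form1_def)
qed

end

text \<open>Whether \<open>e\<close> is admissible depends only on the point of the total space, so
  one \<open>e\<close> serves both charts, and \<open>retr c e\<close> is \<open>retr c' e\<close>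
  after the change of charts.\<close>

lemma retr_transition:
  fixes c c' :: "('a, 'n) chart"
  assumes c: "c \<in> fibre_atlas X A \<pi> t" "c' \<in> fibre_atlas X A \<pi> t" and W: "dom_chart c \<subseteq> W"
    and z: "z \<in> overlap c c'"
  obtains e where "e \<in> B" "z \<in> patch c e" "transition c c' z \<in> patch c' e"
    "\<And>v. frechet_derivative (retr c e) (at z) v
      = frechet_derivative (retr c' e) (at (transition c c' z)) (frechet_derivative (transition c c') (at z) v)"
    "retr c e z = retr c' e (transition c c' z)"
proof -
  note ch = fibre_chart[OF c(1)] and ch' = fibre_chart[OF c(2)]
  have zc: "z \<in> coord c ` dom_chart c" using z by blast
  obtain e where e: "e \<in> B" "z \<in> patch c e" using patch_cover[OF c(1) W zc] .
  have pe: "patch c e = coord c ` dom_chart c \<inter> inv_chart c -` region e" by (simp add: patch_def[OF c(1)])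
  have pe': "patch c' e = coord c' ` dom_chart c' \<inter> inv_chart c' -` region e" by (simp add: patch_def[OF c(2)])
  have ovc: "inv_chart c' (transition c c' y) = inv_chart c y \<and> transition c c' y \<in> coord c' ` dom_chart c'"
    if "y \<in> overlap c c'" for y
    using that inv_chart_coord[OF ch] inv_chart_coord[OF ch'] by (auto simp: transition_def)
  have tz: "transition c c' z \<in> patch c' e"
    using ovc[OF z] e(2) by (simp add: pe pe')
  have rt: "retr c e y = retr c' e (transition c c' y)" if "y \<in> overlap c c'" for y
    using ovc[OF that] by (simp add: retr_def)
  have oo: "open (overlap c c')"
    by (rule chart_open_image[OF ch is_chart_openin[OF ch']])
  have "frechet_derivative (retr c e) (at z) = frechet_derivative (\<lambda>y. retr c' e (transition c c' y)) (at z)"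
    by (rule frechet_derivative_cong_open[OF oo z]) (rule rt)
  then have "frechet_derivative (retr c e) (at z) v
      = frechet_derivative (retr c' e) (at (transition c c' z)) (frechet_derivative (transition c c') (at z) v)" for v
    using frechet_derivative_compose[OF fibre_transition_differentiable[OF c z]
        smooth_on_differentiable[OF smooth_retr[OF c(2) e(1)] tz]] by simp
  then show ?thesis using that[OF e tz] rt[OF z] by blast
qed

section \<open>The pulled-back forms on a whole fibre inside \<open>W\<close>\<close>

lemma manifold_form2_pb:
  assumes W: "\<And>c :: ('a, 'n) chart. c \<in> fibre_atlas X A \<pi> t \<Longrightarrow> dom_chart c \<subseteq> W"
  shows "manifold_form2 (fibre_atlas X A \<pi> t) \<Omega>_pb"
  unfolding manifold_form2_def
proof (intro conjI ballI allI)
  show "local_form2 (coord c ` dom_chart c) (\<Omega>_pb c)" if "c \<in> fibre_atlas X A \<pi> t" for c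
    by (rule local_form2_pb[OF that W[OF that]])
  fix c c' :: "('a, 'n) chart" and z v w
  assume c: "c \<in> fibre_atlas X A \<pi> t" "c' \<in> fibre_atlas X A \<pi> t" and z: "z \<in> overlap c c'"
  obtain e where e: "e \<in> B" "z \<in> patch c e" "transition c c' z \<in> patch c' e"
    and D: "\<And>v. frechet_derivative (retr c e) (at z) v
      = frechet_derivative (retr c' e) (at (transition c c' z)) (frechet_derivative (transition c c') (at z) v)"
    and eq: "retr c e z = retr c' e (transition c c' z)"
    by (rule retr_transition[OF c W[OF c(1)] z]) (rule that)
  show "\<Omega>_pb c z v w = \<Omega>_pb c' (transition c c' z) (frechet_derivative (transition c c') (at z) v)
      (frechet_derivative (transition c c') (at z) w)"
    unfolding \<Omega>_pb_eq[OF c(1) e(1,2)] \<Omega>_pb_eq[OF c(2) e(1,3)] pullback2_def D eq ..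
qed

lemma manifold_form1_pb:
  assumes W: "\<And>c :: ('a, 'n) chart. c \<in> fibre_atlas X A \<pi> t \<Longrightarrow> dom_chart c \<subseteq> W"
  shows "manifold_form1 (fibre_atlas X A \<pi> t) \<theta>_pb"
  unfolding manifold_form1_def
proof (intro conjI ballI allI)
  show "local_form1 (coord c ` dom_chart c) (\<theta>_pb c)" if "c \<in> fibre_atlas X A \<pi> t" for c
    by (rule local_form1_pb[OF that W[OF that]])
  fix c c' :: "('a, 'n) chart" and z v
  assume c: "c \<in> fibre_atlas X A \<pi> t" "c' \<in> fibre_atlas X A \<pi> t" and z: "z \<in> overlap c c'"
  obtain e where e: "e \<in> B" "z \<in> patch c e" "transition c c' z \<in> patch c' e"
    and D: "\<And>v. frechet_derivative (retr c e) (at z) v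
      = frechet_derivative (retr c' e) (at (transition c c' z)) (frechet_derivative (transition c c') (at z) v)"
    and eq: "retr c e z = retr c' e (transition c c' z)"
    by (rule retr_transition[OF c W[OF c(1)] z]) (rule that)
  show "\<theta>_pb c z v = \<theta>_pb c' (transition c c' z) (frechet_derivative (transition c c') (at z) v)"
    unfolding \<theta>_pb_eq[OF c(1) e(1,2)] \<theta>_pb_eq[OF c(2) e(1,3)] pullback1_def D eq ..
qed

lemma lee_form_pb:
  assumes W: "\<And>c :: ('a, 'n) chart. c \<in> fibre_atlas X A \<pi> t \<Longrightarrow> dom_chart c \<subseteq> W"
  shows "lee_form (fibre_atlas X A \<pi> t) \<Omega>_pb \<theta>_pb"
  unfolding lee_form_def closed_form1_def
proof (intro conjI ballI allI manifold_form1_pb[OF W])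
  fix c :: "('a, 'n) chart" and z u v w
  assume c: "c \<in> fibre_atlas X A \<pi> t" and z: "z \<in> coord c ` dom_chart c"
  obtain e where e: "e \<in> B" "z \<in> patch c e" using patch_cover[OF c W[OF c] z] .
  show "d_form1 (\<theta>_pb c) z u v = 0" "d_form2 (\<Omega>_pb c) z u v w = wedge12 (\<theta>_pb c) (\<Omega>_pb c) z u v w"
    using d_pb[OF c e] by blast+
qed assumption

text \<open>Near a point of the central fibre, positivity is tested in one chart \<open>d\<close> of the total space: there
  the tangent spaces of the fibres are the kernels of the differential of \<open>\<pi>\<close>.\<close>

lemma positive_near:
  assumes card: "CARD('m) = CARD('n) + 1" and sub: "holomorphic_submersion A \<pi>"
    and p: "p \<in> topspace X" "\<pi> p = 0" "p \<in> W"
  shows "\<exists>N. openin X N \<and> p \<in> N \<and> N \<subseteq> W \<and>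
    (\<forall>t. \<forall>c\<in>(fibre_atlas X A \<pi> t :: ('a, 'n) chart set). \<forall>x\<in>N \<inter> dom_chart c. \<forall>v. v \<noteq> 0 \<longrightarrow> \<Omega>_pb c (coord c x) v (\<i> *s v) > 0)"
proof -
  obtain e where e: "e \<in> B" "p \<in> dom_chart e" using B_cover[OF p(1,2)] by blast
  obtain d where d: "d \<in> A" "p \<in> dom_chart d" using chart_at[OF p(1)] .
  note chd = chart[OF d(1)] and ea = B_chart[OF e(1)]
  note che = fibre_chart[OF ea]
  have p_reg: "p \<in> region e" using p e(2) r_id by (simp add: region_def)
  have oreg: "openin X (region e)" using smooth_fun_openin[OF smooth_fun_coord_r[OF e(1)]] .
  define S where "S = coord d ` (dom_chart d \<inter> region e)"
  have oS: "open S" unfolding S_def by (rule open_overlap[OF d(1) oreg])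
  define y0 where "y0 = coord d p"
  have y0S: "y0 \<in> S" using d(2) p_reg by (simp add: S_def y0_def)
  define H where "H = retr d e"
  have inv_S: "inv_chart d y \<in> dom_chart d \<inter> region e" "coord d (inv_chart d y) = y" if "y \<in> S" for y
    using that inv_chart_coord[OF chd] by (auto simp: S_def)
  have smH: "smooth_on H S"
    using smooth_fun_coord_r[OF e(1)] d(1) by (simp add: smooth_fun_def S_def H_def retr_def[abs_def])
  have H_in: "H ` S \<subseteq> coord e ` dom_chart e" using retr_in inv_S unfolding H_def by blast
  define \<omega> where "\<omega> = pullback2 H (\<Omega> e)"
  have form\<omega>: "local_form2 S \<omega>"
    unfolding \<omega>_def by (rule local_form2_pullback[OF oS open_e[OF e(1)] smH H_in form2_e[OF e(1)]])
  define f where "f y = \<pi> (inv_chart d y)" for y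
  define L where "L y = frechet_derivative f (at y)" for y
  have smf: "smooth_on f (coord d ` dom_chart d)"
    using sub d(1) by (auto simp: holomorphic_submersion_def holomorphic_fun_def f_def[abs_def] o_def)
  have S_sub: "S \<subseteq> coord d ` dom_chart d" by (auto simp: S_def)
  have Lder: "(f has_derivative L y) (at y)" if "y \<in> coord d ` dom_chart d" for y
    unfolding L_def by (rule smooth_on_has_derivative[OF smf that])
  have Llin: "linear (L y)" if "y \<in> coord d ` dom_chart d" for y
    using Lder[OF that] has_derivative_linear by blast
  have Lsurj: "surj (L y0)"
    using sub d unfolding holomorphic_submersion_def L_def f_def[abs_def] y0_def by (auto simp: o_def)
  have Lcont: "continuous_on S (\<lambda>y. L y v)" for v
    unfolding L_def using smooth_on_continuous[OF smooth_on_derivative[OF smf]] S_sub continuous_on_subset by blast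
  \<comment> \<open>At \<open>p\<close> a vector in the kernel is tangent to the central fibre, so
    it comes from a vector \<eta> in the chart \<open>e\<close>. As \<open>r\<close> fixes the
    fibre, the differential of \<open>H\<close> carries it back to \<eta>, and positivity of
    \<Omega> applies.\<close>
  have pos0: "\<omega> y0 \<xi> (\<i> *s \<xi>) > 0" if \<xi>: "\<xi> \<noteq> 0" "L y0 \<xi> = 0" for \<xi>
  proof -
    define z0 where "z0 = coord e p"
    let ?T = "transition e d"
    define O1 where "O1 = coord e ` (dom_chart e \<inter> (dom_chart d \<inter> region e))"
    have oO1: "open O1"
      unfolding O1_def by (intro open_fibre_image[OF ea] openin_Int is_chart_openin[OF chd] oreg)
    have z0: "z0 \<in> O1" using e(2) d(2) p_reg by (auto simp: O1_def z0_def)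
    have z0d: "z0 \<in> overlap e d" using z0 by (auto simp: O1_def)
    have T0: "?T z0 = y0" by (simp add: transition_def z0_def y0_def inv_chart_coord[OF che e(2)])
    have TS: "?T y \<in> S" "H (?T y) = y" "f (?T y) = 0" if "y \<in> O1" for y
    proof -
      obtain x where x: "x \<in> dom_chart e" "x \<in> dom_chart d" "x \<in> region e" "y = coord e x"
        using \<open>y \<in> O1\<close> by (auto simp: O1_def)
      have Ty: "?T y = coord d x" using inv_chart_coord[OF che x(1)] by (simp add: transition_def x(4))
      have x0: "\<pi> x = 0" using fibre_chart_dom(2)[OF ea x(1)] .
      show "?T y \<in> S" unfolding Ty S_def using x by blast
      show "H (?T y) = y" "f (?T y) = 0"
        unfolding Ty using r_id[OF _ x0] x x0 by (simp_all add: H_def retr_def f_def inv_chart_coord[OF chd x(2)] region_def)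
    qed
    have difT: "?T differentiable (at z0)"
      by (rule smooth_on_differentiable[OF fibre_transition(1)[OF ea d(1)] z0d])
    let ?D = "frechet_derivative ?T (at z0)"
    have linD: "linear ?D" using frechet_derivative_worksI[OF difT] has_derivative_linear by blast
    have "frechet_derivative (\<lambda>y. H (?T y)) (at z0) = frechet_derivative (\<lambda>y. y) (at z0)"
      by (rule frechet_derivative_cong_open[OF oO1 z0]) (rule TS(2))
    moreover have "H differentiable (at (?T z0))"
      using smooth_on_differentiable[OF smH y0S] by (simp add: T0)
    ultimately have DH: "frechet_derivative H (at y0) (?D v) = v" for v
      using frechet_derivative_compose[OF difT, of H v] T0 by (simp add: frechet_derivative_eqI[OF has_derivative_ident])
    have "frechet_derivative (\<lambda>y. f (?T y)) (at z0) = frechet_derivative (\<lambda>y. 0) (at z0)"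
      by (rule frechet_derivative_cong_open[OF oO1 z0]) (rule TS(3))
    moreover have "f differentiable (at (?T z0))"
      using Lder y0S S_sub unfolding T0 differentiable_def by blast
    ultimately have LD: "L y0 (?D v) = 0" for v
      using frechet_derivative_compose[OF difT, of f v] T0 by (simp add: L_def frechet_derivative_eqI[OF has_derivative_const])
    \<comment> \<open>The fibre has complex codimension one by \<open>card\<close>, so the image of
      its tangent space is the full kernel.\<close>
    obtain \<eta> where \<eta>: "\<xi> = ?D \<eta>"
      using range_eq_kernel[OF Llin Lsurj linD fibre_transition(3)[OF ea d(1) z0d] card LD \<xi>(2)] y0S S_sub by blast
    have "\<eta> \<noteq> 0" using \<xi>(1) \<eta> linear_0[OF linD] by auto
    moreover have "\<i> *s \<xi> = ?D (\<i> *s \<eta>)" using fibre_transition(2)[OF ea d(1) z0d] by (simp add: \<eta>)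
    moreover have "H y0 = z0" using TS(2)[OF z0] by (simp add: T0)
    moreover have "\<Omega> e z0 \<eta> (\<i> *s \<eta>) > 0" if "\<eta> \<noteq> 0"
      using pos_\<Omega> ea e(2) that unfolding positive_part11_iff[OF form_\<Omega>] z0_def by blast
    ultimately show ?thesis
      by (simp add: \<omega>_def pullback2_def \<eta> DH)
  qed
  obtain N where N: "open N" "y0 \<in> N" "N \<subseteq> S"
    and Npos: "\<And>y \<xi>. y \<in> N \<Longrightarrow> \<xi> \<noteq> 0 \<Longrightarrow> L y \<xi> = 0 \<Longrightarrow> \<omega> y \<xi> (\<i> *s \<xi>) > 0"
    by (rule positive_neighbourhood[where L = L, OF form\<omega> oS y0S _ Lcont pos0]) (use Llin S_sub in auto)
  let ?N = "dom_chart d \<inter> coord d -` N"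
  have N_reg: "x \<in> region e" if "x \<in> ?N" for x
    using that inv_S(1)[of "coord d x"] N(3) inv_chart_coord[OF chd, of x] by auto
  \<comment> \<open>The neighbourhood was found in the chart \<open>d\<close>, hence is uniform in
    \<open>t\<close> and \<open>c\<close>. Vectors tangent to a fibre are killed by
    \<open>L\<close>, since \<pi> is constant along it; injectivity and complex linearity of the
    inclusion differential transfer positivity back to \<open>c\<close>.\<close>
  have "\<Omega>_pb c (coord c x) v (\<i> *s v) > 0"
    if c: "c \<in> fibre_atlas X A \<pi> t" and x: "x \<in> ?N \<inter> dom_chart c" and v: "v \<noteq> 0"
    for t x v and c :: "('a, 'n) chart"
  proof -
    note chc = fibre_chart[OF c]
    let ?z = "coord c x" and ?T = "transition c d"
    define O1 where "O1 = coord c ` (dom_chart c \<inter> (dom_chart d \<inter> region e))"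
    have oO1: "open O1"
      unfolding O1_def by (intro open_fibre_image[OF c] openin_Int is_chart_openin[OF chd] oreg)
    have z: "?z \<in> O1" using x N_reg by (auto simp: O1_def)
    have zd: "?z \<in> overlap c d" using x by auto
    have invz: "inv_chart c ?z = x" using inv_chart_coord[OF chc] x by blast
    have T0: "?T ?z = coord d x" by (simp add: transition_def invz)
    have TS: "?T y \<in> S" "H (?T y) = retr c e y" "f (?T y) = t" if "y \<in> O1" for y
    proof -
      obtain x where x: "x \<in> dom_chart c" "x \<in> dom_chart d" "x \<in> region e" "y = coord c x"
        using \<open>y \<in> O1\<close> by (auto simp: O1_def)
      have Ty: "?T y = coord d x" using inv_chart_coord[OF chc x(1)] by (simp add: transition_def x(4))
      have xt: "\<pi> x = t" using fibre_chart_dom(2)[OF c x(1)] .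
      show "?T y \<in> S" unfolding Ty S_def using x by blast
      show "H (?T y) = retr c e y" "f (?T y) = t"
        unfolding Ty using x xt by (simp_all add: H_def retr_def f_def inv_chart_coord[OF chd x(2)] inv_chart_coord[OF chc x(1)])
    qed
    have difT: "?T differentiable (at ?z)"
      by (rule smooth_on_differentiable[OF fibre_transition(1)[OF c d(1)] zd])
    let ?D = "frechet_derivative ?T (at ?z)"
    have linD: "linear ?D" using frechet_derivative_worksI[OF difT] has_derivative_linear by blast
    have xS: "coord d x \<in> S" using x N(3) by blast
    have "frechet_derivative (\<lambda>y. H (?T y)) (at ?z) = frechet_derivative (retr c e) (at ?z)"
      by (rule frechet_derivative_cong_open[OF oO1 z]) (rule TS(2))
    moreover have "H differentiable (at (?T ?z))"
      using smooth_on_differentiable[OF smH xS] by (simp add: T0)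
    ultimately have DH: "frechet_derivative (retr c e) (at ?z) v = frechet_derivative H (at (coord d x)) (?D v)" for v
      using frechet_derivative_compose[OF difT, of H v] T0 by simp
    have "frechet_derivative (\<lambda>y. f (?T y)) (at ?z) = frechet_derivative (\<lambda>y. t) (at ?z)"
      by (rule frechet_derivative_cong_open[OF oO1 z]) (rule TS(3))
    moreover have "f differentiable (at (?T ?z))"
      using Lder xS S_sub unfolding T0 differentiable_def by blast
    ultimately have LD: "L (coord d x) (?D v) = 0"
      using frechet_derivative_compose[OF difT, of f v] T0 by (simp add: L_def frechet_derivative_eqI[OF has_derivative_const])
    have "?D v \<noteq> 0"
      using v fibre_transition(3)[OF c d(1) zd] linear_0[OF linD] by (metis injD)
    then have "\<omega> (coord d x) (?D v) (\<i> *s ?D v) > 0"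
      using Npos LD x by blast
    moreover have "?z \<in> patch c e"
      using x N_reg by (simp add: patch_def[OF c] invz)
    ultimately show ?thesis
      unfolding \<Omega>_pb_eq[OF c e(1) \<open>?z \<in> patch c e\<close>] using TS(2)[OF z] T0
      by (simp add: pullback2_def DH \<omega>_def fibre_transition(2)[OF c d(1) zd])
  qed
  moreover have "openin X ?N" by (rule chart_open_preimage[OF chd N(1)])
  moreover have "p \<in> ?N" using d(2) N(2) by (simp add: y0_def)
  moreover have "?N \<subseteq> W" using N_reg by (auto simp: region_def)
  ultimately show ?thesis by (intro exI[of _ ?N]) blast
qed

text \<open>Properness makes \<pi> a closed map: the closed set where positivity is not guaranteed
  has a closed image missing 0, and a small disc avoids that image.\<close>

lemma taming_near:
  assumes card: "CARD('m) = CARD('n) + 1" and fam: "analytic_family X A \<pi> \<epsilon>" and \<epsilon>: "\<epsilon> > 0"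
    and M0: "{x \<in> topspace X. \<pi> x = 0} \<subseteq> W"
  shows "\<exists>\<delta>. 0 < \<delta> \<and> \<delta> \<le> \<epsilon> \<and> (\<forall>t\<in>ball 0 \<delta>. taming_LCS_form (fibre_atlas X A \<pi> t) \<Omega>_pb)"
proof -
  have sub: "holomorphic_submersion A \<pi>" and proper: "proper_map X (top_of_set (ball 0 \<epsilon>)) \<pi>"
    using fam by (auto simp: analytic_family_def)
  \<comment> \<open>The condition is pointwise and quantifies over all fibres and charts, so it
    passes to unions and \<open>N\<close> is the largest good set.\<close>
  define good where "good N \<longleftrightarrow> openin X N \<and> N \<subseteq> W \<and>
    (\<forall>t. \<forall>c\<in>(fibre_atlas X A \<pi> t :: ('a, 'n) chart set). \<forall>x\<in>N \<inter> dom_chart c. \<forall>v. v \<noteq> 0 \<longrightarrow> \<Omega>_pb c (coord c x) v (\<i> *s v) > 0)" for N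
  define N where "N = \<Union>{N. good N}"
  have oN: "openin X N" unfolding N_def by (rule openin_Union) (simp add: good_def)
  have M0N: "x \<in> N" if "x \<in> topspace X" "\<pi> x = 0" for x
  proof -
    have "x \<in> W" using M0 that by blast
    from positive_near[OF card sub that this] show ?thesis unfolding N_def good_def by blast
  qed
  have "closed_map X (top_of_set (ball 0 \<epsilon>)) \<pi>" using proper by (simp add: proper_map_def)
  moreover have "closedin X (topspace X - N)" using oN by (rule closedin_diff[OF closedin_topspace])
  ultimately have "closedin (top_of_set (ball 0 \<epsilon>)) (\<pi> ` (topspace X - N))"
    by (simp add: closed_map_def)
  then have "openin (top_of_set (ball 0 \<epsilon>)) (ball 0 \<epsilon> - \<pi> ` (topspace X - N))"
    by (simp add: closedin_def)
  then have "open (ball 0 \<epsilon> - \<pi> ` (topspace X - N))"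
    using openin_open_eq[OF open_ball] by blast
  moreover have "0 \<in> ball 0 \<epsilon> - \<pi> ` (topspace X - N)" using \<epsilon> M0N by auto
  ultimately obtain \<delta> where \<delta>: "\<delta> > 0" "ball 0 \<delta> \<subseteq> ball 0 \<epsilon> - \<pi> ` (topspace X - N)"
    by (meson open_contains_ball)
  have "taming_LCS_form (fibre_atlas X A \<pi> t) \<Omega>_pb" if t: "t \<in> ball 0 (min \<delta> \<epsilon>)" for t
  proof -
    have domN: "dom_chart c \<subseteq> N" if "c \<in> fibre_atlas X A \<pi> t" for c :: "('a, 'n) chart"
      using fibre_chart_dom[OF that] \<delta>(2) t by fastforce
    have "N \<subseteq> W" unfolding N_def good_def by blast
    then have W: "dom_chart c \<subseteq> W" if "c \<in> fibre_atlas X A \<pi> t" for c :: "('a, 'n) chart"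
      using domN[OF that] by blast
    have m2: "manifold_form2 (fibre_atlas X A \<pi> t) \<Omega>_pb" by (rule manifold_form2_pb[OF W])
    have "\<Omega>_pb c (coord c x) v (\<i> *s v) > 0"
      if "c \<in> fibre_atlas X A \<pi> t" "x \<in> dom_chart c" "v \<noteq> 0" for x v and c :: "('a, 'n) chart"
      using domN[OF that(1)] that unfolding N_def good_def by blast
    then have "positive_part11 (fibre_atlas X A \<pi> t) \<Omega>_pb"
      by (subst positive_part11_iff[OF m2]) blast
    then show ?thesis
      unfolding taming_LCS_form_def using m2 lee_form_pb[OF W] by blast
  qed
  then show ?thesis using \<delta>(1) \<epsilon> by (intro exI[of _ "min \<delta> \<epsilon>"]) auto
qed

end

theorem proposition4p6:
  fixes X :: "'a topology"
    and A :: "('a, 'm::finite) chart set"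
    and \<pi> :: "'a \<Rightarrow> complex"
    and \<epsilon> :: real
  assumes "CARD('m) = CARD('n::finite) + 1"
    and "\<epsilon> > 0"
    and "analytic_family X A \<pi> \<epsilon>"
    and "\<exists>\<Omega>. taming_LCS_form (fibre_atlas X A \<pi> 0 :: ('a, 'n) chart set) \<Omega>"
  shows "\<exists>\<delta>. 0 < \<delta> \<and> \<delta> \<le> \<epsilon> \<and>
    (\<forall>t\<in>ball 0 \<delta>. \<exists>\<Omega>. taming_LCS_form (fibre_atlas X A \<pi> t :: ('a, 'n) chart set) \<Omega>)"
proof -
  interpret cmanifold X A
    using assms(3) by unfold_locales (simp add: analytic_family_def)
  have sub: "holomorphic_submersion A \<pi>" using assms(3) by (simp add: analytic_family_def)
  have cpt: "compactin X {x \<in> topspace X. \<pi> x = 0}"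
    using assms(2,3) by (simp add: analytic_family_def proper_map_def)
  obtain r W where r: "smooth_retraction \<pi> r W" "{x \<in> topspace X. \<pi> x = 0} \<subseteq> W"
    using smooth_retraction_exists[OF sub cpt] .
  obtain \<Omega> \<theta> where \<Omega>: "manifold_form2 (fibre_atlas X A \<pi> 0) \<Omega>" "lee_form (fibre_atlas X A \<pi> 0) \<Omega> \<theta>"
    "positive_part11 (fibre_atlas X A \<pi> 0 :: ('a, 'n) chart set) \<Omega>"
    using assms(4) unfolding taming_LCS_form_def by blast
  define B :: "('a, 'n) chart set" where
    "B = {e \<in> fibre_atlas X A \<pi> 0. \<exists>U. dom_chart e = U \<inter> {x. \<pi> x = 0} \<and> smooth_fun (coord e) U}"
  interpret fibre_retraction X A \<pi> r W B \<Omega> \<theta>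
  proof unfold_locales
    show "\<exists>e\<in>B. p \<in> dom_chart e" if "p \<in> topspace X" "\<pi> p = 0" for p
      using fibre_chart_exists[OF sub assms(1) that] unfolding B_def by blast
  qed (use r \<Omega> in \<open>auto simp: B_def\<close>)
  show ?thesis using taming_near[OF assms(1,3,2) r(2)] by blast
qed

end
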